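(* Let $(\mathbb{X},\mathcal{X})$ be a Borel space with a finite and diffuse measure $\lambda$, and let $\kappa\colon\mathbb{X}\times\mathbf{N}\to[0,\infty)$ be measurable with $\kappa(x,\mu)\kappa(y,\mu+\delta_x)=\kappa(y,\mu)\kappa(x,\mu+\delta_y)$ for all $(x,y,\mu)\in\mathbb{X}^2\times\mathbf{N}$. Assume that $\Pi_\lambda$-a.e. $\psi\in\mathbf{N}^*$ is stable, i.e. satisfies $Z_B(\psi_{\mathbb{X}\setminus B})<\infty$ for all $B\in\mathcal{X}$. Let $\Phi$ be a Poisson process on $\mathbb{X}\times\mathbb{R}_+$ with intensity measure $\lambda\otimes\lambda_1$, where $\lambda_1$ is Lebesgue measure on $\mathbb{R}_+=[0,\infty)$. Then $T(\Phi)$ is a Gibbs process with Papangelou intensity $\kappa$, where $T$ is the embedding operator defined in the context.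
   Context: A measure is diffuse if it has no atoms at points. $\mathbf{N}$ is the set of all measures on $\mathbb{X}$ that are $\mathbb{N}_0$-valued on all sets of finite $\lambda$-measure (since $\lambda$ is finite, these are the finite $\mathbb{N}_0$-valued measures), with the $\sigma$-field generated by $\mu\mapsto\mu(B)$, $B\in\mathcal{X}$; $\mathbf{N}^*\subset\mathbf{N}$ is the subset of simple and finite measures (simple: $\mu(\{x\})\le 1$ for all $x$). A point process is a random element of $\mathbf{N}$. $\mu_B:=\mu(B\cap\cdot)$. $\Pi_\nu$ is the distribution of a Poisson process with intensity measure $\nu$. A point process $\xi$ is a Gibbs process with Papangelou intensity $\kappa$ if $\mathbb{E}\int f(x,\xi)\,\xi(\mathrm{d}x)=\mathbb{E}\int f(x,\xi+\delta_x)\kappa(x,\xi)\,\lambda(\mathrm{d}x)$ for all measurable $f\colon\mathbb{X}\times\mathbf{N}\to[0,\infty)$. For $m\in\mathbb{N}$ let $\kappa_m(x_1,\ldots,x_m,\mu):=\kappa(x_1,\mu)\kappa(x_2,\mu+\delta_{x_1})\cdots\kappa(x_m,\mu+\delta_{x_1}+\cdots+\delta_{x_{m-1}})$ and let $\tilde\kappa_m$ be its symmetrization in the first $m$ arguments. $H(\mu,\psi):=0$ if $\mu(\mathbb{X})=0$, $H(\mu,\psi):=-\log\tilde\kappa_m(x_1,\ldots,x_m,\psi)$ if $\mu=\delta_{x_1}+\cdots+\delta_{x_m}$, and $H(\mu,\psi):=\infty$ if $\mu(\mathbb{X})=\infty$. For $B\in\mathcal{X}$, $Z_B(\psi):=\int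 e^{-H(\mu,\psi)}\,\Pi_{\lambda_B}(\mathrm{d}\mu)$, $\psi\in\mathbf{N}$. Fix an injective measurable $\varphi\colon\mathbb{X}\to\mathbb{R}$ with measurable image and measurable inverse on its image, and order $\mathbb{X}$ totally by $x\le y:\Leftrightarrow\varphi(x)\le\varphi(y)$. Put $(x,\infty):=\{z\in\mathbb{X}:z>x\}$ and $\psi_x:=\psi_{\{z:z<x\}}$. Define $p(x,\psi):=\kappa(x,\psi_x)\,Z_{(x,\infty)}(\psi_x+\delta_x)/Z_{(x,\infty)}(\psi_x)$ for $(x,\psi)\in\mathbb{X}\times\mathbf{N}^*$, with $\infty/\infty:=0$. Embedding operator $T$. Let $\mathbf{N}^*_\ell(\mathbb{X}\times\mathbb{R}_+)$ be the space of all simple counting measures $\theta$ on $\mathbb{X}\times\mathbb{R}_+$ such that $\theta(B)<\infty$ for each measurable $B\subset\mathbb{X}\times\mathbb{R}_+$ with $(\lambda\otimes\lambda_1)(B)<\infty$, equipped with the standard $\sigma$-field. For $\theta\in\mathbf{N}^*_\ell(\mathbb{X}\times\mathbb{R}_+)$ define $x_1(\theta),x_2(\theta),\ldots\in\mathbb{X}\cup\{-\infty,\infty\}$ recursively. If $\int p(x,0)\,\lambda(\mathrm{d}x)=\infty$ (where $0$ denotes the zero measure), set $x_1(\theta):=-\infty$; otherwise $\theta(\{(x,t):t\le p(x,0)\})<\infty$ and $x_1(\theta):=\min\{x\in\mathbb{X}:\text{there exists }t\ge0\text{ with }(x,t)\in\theta\text{ and }t\le p(x,0)\}$, with $\min\emptyset:=\infty$.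 If $x_n(\theta)\notin\mathbb{X}$, set $x_{n+1}(\theta):=x_n(\theta)$. If $x_n(\theta)\in\mathbb{X}$, put $\mu_n:=\delta_{x_1(\theta)}+\cdots+\delta_{x_n(\theta)}$; if $\int\mathbf{1}\{x_n(\theta)<x\}p(x,\mu_n)\,\lambda(\mathrm{d}x)=\infty$, set $x_{n+1}(\theta):=-\infty$; otherwise $x_{n+1}(\theta):=\min\{x>x_n(\theta):\text{there exists }t\ge0\text{ with }(x,t)\in\theta\text{ and }t\le p(x,\mu_n)\}$. Let $\tau(\theta):=\sup\{n\ge1:x_n(\theta)\in\mathbb{X}\}$ (with $\sup\emptyset:=0$) and $T(\theta):=\mathbf{1}\{\tau(\theta)<\infty\}\sum_{n=1}^{\tau(\theta)}\delta_{x_n(\theta)}\in\mathbf{N}^*$. Here $(x,t)\in\theta$ means $\theta(\{(x,t)\})>0$.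
   Formalization: Φ and T live on counting measures finite on each strip X×[0,n] (simplicity not required), since finiteness on all sets of finite λ⊗λ_1-measure forces θ finite and excludes Φ; T also takes the value −∞ when the relevant θ-mass is infinite, a null event for Φ. *)

theory Defs
  imports "HOL-Probability.Probability" "HOL-Library.Extended"
begin

no_notation Pinf ("\<infinity>") and Minf ("-\<infinity>")

section \<open>Counting measures\<close>

text \<open>
  The measure \<open>M\<close> plays the role of \<open>\<lambda>\<close>; its measurable space is \<open>(\<X>, sets M)\<close>
  with \<open>\<X> = space M\<close>. Measures on this measurable space are the \<open>\<mu>\<close> with \<open>sets \<mu> = sets M\<close>.
\<close>

definition add_measure :: "'a measure \<Rightarrow> 'a measure \<Rightarrow> 'a measure" (infixl "\<oplus>\<^sub>m" 65) where
  "\<mu> \<oplus>\<^sub>m \<nu> = measure_of (space \<mu>) (sets \<mu>) (\<lambda>A. emeasure \<mu> A + emeasure \<nu> A)"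

text \<open>\<open>restrict_to \<mu> B\<close> is \<open>\<mu>(B \<inter> \<cdot>)\<close>, still a measure on the whole space (unlike
  \<^const>\<open>restrict_space\<close>).\<close>

definition restrict_to :: "'a measure \<Rightarrow> 'a set \<Rightarrow> 'a measure" where
  "restrict_to \<mu> B = density \<mu> (indicator B)"

primrec dirac_sum :: "'a measure \<Rightarrow> 'a list \<Rightarrow> 'a measure" where
  "dirac_sum M [] = null_measure M"
| "dirac_sum M (x # xs) = dirac_sum M xs \<oplus>\<^sub>m return M x"

text \<open>Measures on \<open>M\<close> that are \<open>\<nat>\<close>-valued on all sets of a given system \<open>\<B>\<close>, and the
  \<open>\<sigma>\<close>-field on them generated by the evaluations \<open>\<mu> \<mapsto> \<mu>(B)\<close>, \<open>B \<in> sets M\<close>.\<close>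

definition counting_measures :: "'a measure \<Rightarrow> 'a set set \<Rightarrow> 'a measure set" where
  "counting_measures M \<B> =
     {\<mu>. sets \<mu> = sets M \<and> (\<forall>B\<in>\<B>. emeasure \<mu> B \<in> range of_nat)}"

definition counting_algebra :: "'a measure \<Rightarrow> 'a set set \<Rightarrow> 'a measure measure" where
  "counting_algebra M \<B> =
     (SUP B \<in> sets M. vimage_algebra (counting_measures M \<B>) (\<lambda>\<mu>. emeasure \<mu> B) borel)"

definition finite_measure_sets :: "'a measure \<Rightarrow> 'a set set" where
  "finite_measure_sets M = {B \<in> sets M. emeasure M B < \<infinity>}"

text \<open>The measurable space \<open>N\<close>: \<open>space (N_alg M)\<close> consists of the measures that are
  \<open>\<nat>\<close>-valued on all sets of finite \<open>M\<close>-measure.\<close>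

definition N_alg :: "'a measure \<Rightarrow> 'a measure measure" where
  "N_alg M = counting_algebra M (finite_measure_sets M)"

definition N_simple :: "'a measure \<Rightarrow> 'a measure set" where
  "N_simple M = {\<mu> \<in> space (N_alg M).
     emeasure \<mu> (space M) < \<infinity> \<and> (\<forall>x\<in>space M. emeasure \<mu> {x} \<le> 1)}"

definition diffuse :: "'a measure \<Rightarrow> bool" where
  "diffuse M \<longleftrightarrow> (\<forall>x\<in>space M. emeasure M {x} = 0)"

section \<open>Poisson and Gibbs processes\<close>

text \<open>\<open>\<xi>\<close>, defined on the probability space \<open>P\<close> and taking values in a measurable space \<open>S\<close> of
  counting measures, is a Poisson process with intensity measure \<open>\<nu>\<close>. The Poisson probabilities
  are written out because the library's \<open>poisson_pmf\<close> does not cover the rate \<open>0\<close>.\<close>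

definition poisson_process ::
  "'w measure \<Rightarrow> 'a measure measure \<Rightarrow> 'a measure \<Rightarrow> ('w \<Rightarrow> 'a measure) \<Rightarrow> bool" where
  "poisson_process P S \<nu> \<xi> \<longleftrightarrow>
     prob_space P \<and> \<xi> \<in> P \<rightarrow>\<^sub>M S \<and>
     (\<forall>B\<in>sets \<nu>. emeasure \<nu> B < \<infinity> \<longrightarrow>
        (\<forall>k. measure P {\<omega>\<in>space P. emeasure (\<xi> \<omega>) B = of_nat k}
             = measure \<nu> B ^ k / fact k * exp (- measure \<nu> B))) \<and>
     (\<forall>B\<in>sets \<nu>. emeasure \<nu> B = \<infinity> \<longrightarrow> (AE \<omega> in P. emeasure (\<xi> \<omega>) B = \<infinity>)) \<and>
     (\<forall>(n::nat) B. (\<forall>i<n. B i \<in> sets \<nu>) \<and> disjoint_family_on B {..<n} \<longrightarrow>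
        prob_space.indep_vars P (\<lambda>_. borel) (\<lambda>i \<omega>. emeasure (\<xi> \<omega>) (B i)) {..<n})"

text \<open>The distribution \<open>\<Pi>\<^sub>\<nu>\<close> on \<open>N\<close>: the law under which the identity is a Poisson process.\<close>

definition poisson_law :: "'a measure \<Rightarrow> 'a measure \<Rightarrow> 'a measure measure" where
  "poisson_law M \<nu> =
     (THE Q. sets Q = sets (N_alg M) \<and> poisson_process Q (N_alg M) \<nu> (\<lambda>\<mu>. \<mu>))"

definition gibbs_process ::
  "'w measure \<Rightarrow> 'a measure \<Rightarrow> ('a \<Rightarrow> 'a measure \<Rightarrow> real) \<Rightarrow> ('w \<Rightarrow> 'a measure) \<Rightarrow> bool" where
  "gibbs_process P M \<kappa> \<xi> \<longleftrightarrow>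
     prob_space P \<and> \<xi> \<in> P \<rightarrow>\<^sub>M N_alg M \<and>
     (\<forall>f :: 'a \<times> 'a measure \<Rightarrow> real.
        f \<in> borel_measurable (M \<Otimes>\<^sub>M N_alg M) \<and> (\<forall>z\<in>space (M \<Otimes>\<^sub>M N_alg M). 0 \<le> f z) \<longrightarrow>
        (\<integral>\<^sup>+\<omega>. (\<integral>\<^sup>+x. ennreal (f (x, \<xi> \<omega>)) \<partial>\<xi> \<omega>) \<partial>P) =
        (\<integral>\<^sup>+\<omega>. (\<integral>\<^sup>+x. ennreal (f (x, \<xi> \<omega> \<oplus>\<^sub>m return M x)) * ennreal (\<kappa> x (\<xi> \<omega>)) \<partial>M) \<partial>P))"

section \<open>Hamiltonian and partition function\<close>

primrec kappa_list ::
  "'a measure \<Rightarrow> ('a \<Rightarrow> 'a measure \<Rightarrow> real) \<Rightarrow> 'a list \<Rightarrow> 'a measure \<Rightarrow> real" where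
  "kappa_list M \<kappa> [] \<mu> = 1"
| "kappa_list M \<kappa> (x # xs) \<mu> = \<kappa> x \<mu> * kappa_list M \<kappa> xs (\<mu> \<oplus>\<^sub>m return M x)"

definition kappa_sym ::
  "'a measure \<Rightarrow> ('a \<Rightarrow> 'a measure \<Rightarrow> real) \<Rightarrow> 'a list \<Rightarrow> 'a measure \<Rightarrow> real" where
  "kappa_sym M \<kappa> xs \<mu> =
     (\<Sum>\<sigma> | \<sigma> permutes {..<length xs}. kappa_list M \<kappa> (permute_list \<sigma> xs) \<mu>) / fact (length xs)"

text \<open>The points of \<open>\<mu>\<close> are listed in an arbitrary order, on which \<^const>\<open>kappa_sym\<close> does not
  depend.\<close>

definition hamiltonian ::
  "'a measure \<Rightarrow> ('a \<Rightarrow> 'a measure \<Rightarrow> real) \<Rightarrow> 'a measure \<Rightarrow> 'a measure \<Rightarrow> ereal" where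
  "hamiltonian M \<kappa> \<mu> \<psi> =
     (if emeasure \<mu> (space M) = 0 then 0
      else if emeasure \<mu> (space M) = \<infinity> then \<infinity>
      else let xs = (SOME xs. set xs \<subseteq> space M \<and> \<mu> = dirac_sum M xs);
               k = kappa_sym M \<kappa> xs \<psi>
           in if k = 0 then \<infinity> else ereal (- ln k))"

definition exp_minus :: "ereal \<Rightarrow> ennreal" where
  "exp_minus h = (case h of ereal r \<Rightarrow> ennreal (exp (- r)) | PInfty \<Rightarrow> 0 | MInfty \<Rightarrow> \<infinity>)"

definition partition_fun ::
  "'a measure \<Rightarrow> ('a \<Rightarrow> 'a measure \<Rightarrow> real) \<Rightarrow> 'a set \<Rightarrow> 'a measure \<Rightarrow> ennreal" where
  "partition_fun M \<kappa> B \<psi> =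
     (\<integral>\<^sup>+\<mu>. exp_minus (hamiltonian M \<kappa> \<mu> \<psi>) \<partial>poisson_law M (restrict_to M B))"

definition stable_config ::
  "'a measure \<Rightarrow> ('a \<Rightarrow> 'a measure \<Rightarrow> real) \<Rightarrow> 'a measure \<Rightarrow> bool" where
  "stable_config M \<kappa> \<psi> \<longleftrightarrow>
     (\<forall>B\<in>sets M. partition_fun M \<kappa> B (restrict_to \<psi> (space M - B)) < \<infinity>)"

section \<open>The order and the function \<open>p\<close>\<close>

text \<open>An isomorphism of \<open>M\<close> onto a Borel subset of the real line. The existence of such
  a \<open>\<phi>\<close> is what makes the underlying measurable space a Borel space.\<close>

definition borel_coding :: "'a measure \<Rightarrow> ('a \<Rightarrow> real) \<Rightarrow> bool" where
  "borel_coding M \<phi> \<longleftrightarrow>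
     \<phi> \<in> borel_measurable M \<and> inj_on \<phi> (space M) \<and> \<phi> ` space M \<in> sets borel \<and>
     inv_into (space M) \<phi> \<in> restrict_space borel (\<phi> ` space M) \<rightarrow>\<^sub>M M"

definition above :: "'a measure \<Rightarrow> ('a \<Rightarrow> real) \<Rightarrow> 'a \<Rightarrow> 'a set" where
  "above M \<phi> x = {z \<in> space M. \<phi> x < \<phi> z}"

definition below :: "'a measure \<Rightarrow> ('a \<Rightarrow> real) \<Rightarrow> 'a \<Rightarrow> 'a set" where
  "below M \<phi> x = {z \<in> space M. \<phi> z < \<phi> x}"

text \<open>Division on \<^typ>\<open>ennreal\<close> satisfies \<open>\<infinity> / \<infinity> = 0\<close>, which is the convention needed here.\<close>

definition p_fun ::
  "'a measure \<Rightarrow> ('a \<Rightarrow> real) \<Rightarrow> ('a \<Rightarrow> 'a measure \<Rightarrow> real) \<Rightarrow> 'a \<Rightarrow> 'a measure \<Rightarrow> ennreal" where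
  "p_fun M \<phi> \<kappa> x \<psi> =
     (let \<psi>x = restrict_to \<psi> (below M \<phi> x) in
      ennreal (\<kappa> x \<psi>x) * partition_fun M \<kappa> (above M \<phi> x) (\<psi>x \<oplus>\<^sub>m return M x)
        / partition_fun M \<kappa> (above M \<phi> x) \<psi>x)"

section \<open>The embedding operator\<close>

definition half_line :: "real measure" where
  "half_line = restrict_space lborel {0..}"

text \<open>Counting measures on \<open>\<X> \<times> [0,\<infinity>)\<close> that are finite on each strip \<open>\<X> \<times> [0,n]\<close>. Finiteness on
  \<^emph>\<open>all\<close> sets of finite \<open>M \<otimes> half_line\<close>-measure would be too much to ask of the values of a Poisson
  process: for diffuse \<open>M\<close> every countable set of points is null.\<close>

definition strip_sets :: "'a measure \<Rightarrow> ('a \<times> real) set set" where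
  "strip_sets M = {B \<in> sets (M \<Otimes>\<^sub>M half_line). \<exists>n::nat. B \<subseteq> space M \<times> {0..real n}}"

definition N_loc_alg :: "'a measure \<Rightarrow> ('a \<times> real) measure measure" where
  "N_loc_alg M = counting_algebra (M \<Otimes>\<^sub>M half_line) (strip_sets M)"

text \<open>The next point in the region \<open>A\<close>, given the current points \<open>\<mu>\<close>. The values \<^const>\<open>Minf\<close>
  and \<^const>\<open>Pinf\<close> are \<open>-\<infinity>\<close> and \<open>\<infinity>\<close>. If the integral is finite, then for a Poisson process
  \<open>\<theta>\<close> the second disjunct holds with probability \<open>0\<close>; it is there because the minimum
  need not exist for every \<open>\<theta>\<close> in \<^const>\<open>N_loc_alg\<close>.\<close>

definition next_point ::
  "'a measure \<Rightarrow> ('a \<Rightarrow> real) \<Rightarrow> ('a \<Rightarrow> 'a measure \<Rightarrow> real) \<Rightarrow> ('a \<times> real) measure \<Rightarrow>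
   'a set \<Rightarrow> 'a measure \<Rightarrow> 'a extended" where
  "next_point M \<phi> \<kappa> \<theta> A \<mu> =
     (let p = (\<lambda>x. p_fun M \<phi> \<kappa> x \<mu>);
          X = {x \<in> A. \<exists>t\<ge>0. emeasure \<theta> {(x, t)} > 0 \<and> ennreal t \<le> p x}
      in if (\<integral>\<^sup>+x. indicator A x * p x \<partial>M) = \<infinity>
            \<or> emeasure \<theta> {(x, t). x \<in> A \<and> 0 \<le> t \<and> ennreal t \<le> p x} = \<infinity> then Minf
         else if X = {} then Pinf
         else Fin (arg_min_on \<phi> X))"

definition the_point :: "'a extended \<Rightarrow> 'a" where
  "the_point e = (THE x. e = Fin x)"

text \<open>The list \<open>[x\<^sub>1(\<theta>), \<dots>, x\<^sub>n(\<theta>)]\<close>.\<close>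

primrec embedding_points ::
  "'a measure \<Rightarrow> ('a \<Rightarrow> real) \<Rightarrow> ('a \<Rightarrow> 'a measure \<Rightarrow> real) \<Rightarrow> ('a \<times> real) measure \<Rightarrow>
   nat \<Rightarrow> 'a extended list" where
  "embedding_points M \<phi> \<kappa> \<theta> 0 = []"
| "embedding_points M \<phi> \<kappa> \<theta> (Suc n) =
     (let es = embedding_points M \<phi> \<kappa> \<theta> n in
      es @ [if es = [] then next_point M \<phi> \<kappa> \<theta> (space M) (null_measure M)
            else case last es of
                   Fin x \<Rightarrow> next_point M \<phi> \<kappa> \<theta> (above M \<phi> x) (dirac_sum M (map the_point es))
                 | Minf \<Rightarrow> Minf
                 | Pinf \<Rightarrow> Pinf])"

definition embedding_point ::
  "'a measure \<Rightarrow> ('a \<Rightarrow> real) \<Rightarrow> ('a \<Rightarrow> 'a measure \<Rightarrow> real) \<Rightarrow> ('a \<times> real) measure \<Rightarrow>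
   nat \<Rightarrow> 'a extended" where
  "embedding_point M \<phi> \<kappa> \<theta> n = last (embedding_points M \<phi> \<kappa> \<theta> n)"

definition embedding_tau ::
  "'a measure \<Rightarrow> ('a \<Rightarrow> real) \<Rightarrow> ('a \<Rightarrow> 'a measure \<Rightarrow> real) \<Rightarrow> ('a \<times> real) measure \<Rightarrow> enat" where
  "embedding_tau M \<phi> \<kappa> \<theta> =
     Sup {enat n | n. 1 \<le> n \<and> embedding_point M \<phi> \<kappa> \<theta> n \<in> range Fin}"

definition embedding ::
  "'a measure \<Rightarrow> ('a \<Rightarrow> real) \<Rightarrow> ('a \<Rightarrow> 'a measure \<Rightarrow> real) \<Rightarrow> ('a \<times> real) measure \<Rightarrow>
   'a measure" where
  "embedding M \<phi> \<kappa> \<theta> =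
     (case embedding_tau M \<phi> \<kappa> \<theta> of
        enat k \<Rightarrow> dirac_sum M (map the_point (embedding_points M \<phi> \<kappa> \<theta> k))
      | \<infinity> \<Rightarrow> null_measure M)"

end

theory Submission
  imports Defs
begin

text \<open>
  Integrals of \<open>\<kappa>\<^sub>n(x\<^sub>1,\<dots>,x\<^sub>n,\<psi>)\<close> are iterates of an operator that inserts one random point into a
  configuration. By the cocycle property the order of insertion is irrelevant; hence the Gibbs
  weight satisfies the GNZ equation, and with \<open>W\<^sub>c(\<psi>)\<close> the total weight of configurations in
  \<open>{z. c < \<phi> z}\<close> one has \<open>W\<^sub>c(\<psi>) = 1 + \<integral>\<^bsub>\<phi> x > c\<^esub> \<kappa>(x,\<psi>) W\<^bsub>\<phi> x\<^esub>(\<psi> + \<delta>\<^sub>x) \<lambda>(dx)\<close>. Since \<open>\<lambda>\<close> is diffuse, this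
  gives \<open>\<integral>\<^bsub>c < \<phi> x \<le> b\<^esub> p(x,\<psi>) \<lambda>(dx) = ln (W\<^sub>c(\<psi>) / W\<^sub>b(\<psi>))\<close> for \<open>\<psi>\<close> to the left of \<open>c\<close>. Peeling off the
  first point of the embedding with the Mecke equation for \<open>\<Phi>\<close>, the void probabilities
  \<open>exp (- \<integral> p)\<close> telescope, and the law of \<open>T(\<Phi>)\<close> is at least the Gibbs law with density
  \<open>\<kappa>\<^sub>n(x\<^sub>1,\<dots>,x\<^sub>n,0) / W\<^bsub>-\<infinity>\<^esub>(0)\<close>. Both are probability measures, so they coincide.
\<close>

section \<open>Counting measures\<close>

text \<open>The function \<open>p\<close> is a hazard rate: by the recursion for W, p(x,\<psi>)
  \<lambda>(dx) is -d ln W along the order. An abstract diffuse \<lambda> offers no derivative, so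
  the logarithm comes from the geometric series for 1 / (f - G) and the combinatorial identity (n +
  1) \<integral> w G^n = (\<integral> w)^(n+1), where G(x) is the mass of w before x. A lower bound
  for the law of T(\<Phi>) is proved instead of an equality because it is insensitive to exceptional
  events: infinitely many accepted points, a minimum that does not exist, configurations of infinite
  tail weight. Such events can only lose mass, and comparing two probability measures shows
  afterwards that nothing was lost. Conditioning on the past is replaced as well: the region already
  inspected is carried along as a set that must be void of \<Phi>, so every step is one use of the
  Mecke equation for the same \<Phi>. That equation is derived on strips of bounded height, where
  \<Phi> is a finite Poisson process with an explicit law, and extended by a Dynkin
  argument.\<close>

lemma space_add_measure [simp]: "space (\<mu> \<oplus>\<^sub>m \<nu>) = space \<mu>"
  by (simp add: add_measure_def)

lemma sets_add_measure [simp, measurable_cong]: "sets (\<mu> \<oplus>\<^sub>m \<nu>) = sets \<mu>"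
  by (simp add: add_measure_def)

lemma emeasure_add_measure:
  assumes "sets \<nu> = sets \<mu>"
  shows "emeasure (\<mu> \<oplus>\<^sub>m \<nu>) A = emeasure \<mu> A + emeasure \<nu> A"
proof (cases "A \<in> sets \<mu>")
  case True
  show ?thesis
    unfolding add_measure_def
  proof (rule emeasure_measure_of_sigma)
    show "sigma_algebra (space \<mu>) (sets \<mu>)" ..
    show "positive (sets \<mu>) (\<lambda>A. emeasure \<mu> A + emeasure \<nu> A)"
      by (simp add: positive_def)
    show "countably_additive (sets \<mu>) (\<lambda>A. emeasure \<mu> A + emeasure \<nu> A)"
      unfolding countably_additive_def
      using assms by (auto simp: suminf_add[symmetric] suminf_emeasure)
  qed fact
next
  case False
  then show ?thesis
    using assms by (simp add: emeasure_notin_sets)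
qed

lemma add_measure_assoc:
  assumes "sets \<nu> = sets \<mu>" "sets \<rho> = sets \<mu>"
  shows "\<mu> \<oplus>\<^sub>m \<nu> \<oplus>\<^sub>m \<rho> = \<mu> \<oplus>\<^sub>m (\<nu> \<oplus>\<^sub>m \<rho>)"
  using assms by (intro measure_eqI) (auto simp: emeasure_add_measure ac_simps)

lemma add_measure_commute:
  assumes "sets \<nu> = sets \<mu>"
  shows "\<mu> \<oplus>\<^sub>m \<nu> = \<nu> \<oplus>\<^sub>m \<mu>"
  using assms by (intro measure_eqI) (auto simp: emeasure_add_measure ac_simps)

lemma add_measure_right_commute:
  assumes "sets \<mu> = sets M"
  shows "\<mu> \<oplus>\<^sub>m return M x \<oplus>\<^sub>m return M y = \<mu> \<oplus>\<^sub>m return M y \<oplus>\<^sub>m return M x"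
  using assms by (intro measure_eqI) (auto simp: emeasure_add_measure ac_simps)

lemma add_measure_null_left [simp]: "sets \<mu> = sets M \<Longrightarrow> null_measure M \<oplus>\<^sub>m \<mu> = \<mu>"
  by (intro measure_eqI) (auto simp: emeasure_add_measure)

lemma add_measure_null_right [simp]: "sets \<mu> = sets M \<Longrightarrow> \<mu> \<oplus>\<^sub>m null_measure M = \<mu>"
  by (intro measure_eqI) (auto simp: emeasure_add_measure)

lemma nn_integral_add_measure:
  assumes sets: "sets \<nu> = sets \<mu>" and f: "f \<in> borel_measurable \<mu>"
  shows "(\<integral>\<^sup>+x. f x \<partial>(\<mu> \<oplus>\<^sub>m \<nu>)) = (\<integral>\<^sup>+x. f x \<partial>\<mu>) + (\<integral>\<^sup>+x. f x \<partial>\<nu>)"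
  using f
proof (induct rule: borel_measurable_induct)
  case (cong f g)
  then show ?case
    using sets sets_eq_imp_space_eq[OF sets] by (simp cong: nn_integral_cong_simp)
next
  case (set A)
  then show ?case
    using sets by (simp add: emeasure_add_measure)
next
  case (mult u c)
  then show ?case
    using sets by (simp add: nn_integral_cmult distrib_left cong: measurable_cong_sets)
next
  case (add u v)
  then show ?case
    using sets by (simp add: nn_integral_add ac_simps cong: measurable_cong_sets)
next
  case (seq U)
  have "(\<integral>\<^sup>+x. (SUP i. U i) x \<partial>\<mu>) = (SUP i. \<integral>\<^sup>+x. U i x \<partial>\<mu>)" if "sets \<mu> = sets \<mu>'" "\<And>i. U i \<in> borel_measurable \<mu>'" for \<mu> \<mu>'
    unfolding SUP_apply
    using that seq by (intro nn_integral_monotone_convergence_SUP) (auto cong: measurable_cong_sets)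
  note this[where \<mu>'=\<mu>]
  moreover have "incseq (\<lambda>i. \<integral>\<^sup>+x. U i x \<partial>\<mu>)" for \<mu>
    using seq by (auto intro!: incseq_SucI nn_integral_mono simp: incseq_def le_fun_def)
  ultimately show ?case
    using seq sets by (simp add: ennreal_SUP_add)
qed

section \<open>Restriction of a measure to a set\<close>

lemma space_restrict_to [simp]: "space (restrict_to \<mu> B) = space \<mu>"
  by (simp add: restrict_to_def)

lemma sets_restrict_to [simp, measurable_cong]: "sets (restrict_to \<mu> B) = sets \<mu>"
  by (simp add: restrict_to_def)

lemma emeasure_restrict_to:
  assumes "B \<in> sets \<mu>" "A \<in> sets \<mu>"
  shows "emeasure (restrict_to \<mu> B) A = emeasure \<mu> (A \<inter> B)"
proof -
  have "(\<lambda>x. indicator B x * indicator A x :: ennreal) = indicator (A \<inter> B)"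
    by (auto split: split_indicator)
  then have "emeasure (restrict_to \<mu> B) A = (\<integral>\<^sup>+x. indicator (A \<inter> B) x \<partial>\<mu>)"
    using assms unfolding restrict_to_def by (simp add: emeasure_density)
  then show ?thesis
    using assms by simp
qed

lemma nn_integral_restrict_to:
  assumes "B \<in> sets \<mu>" "f \<in> borel_measurable \<mu>"
  shows "(\<integral>\<^sup>+x. f x \<partial>restrict_to \<mu> B) = (\<integral>\<^sup>+x. indicator B x * f x \<partial>\<mu>)"
  using assms unfolding restrict_to_def by (subst nn_integral_density) auto

text \<open>No measurability of \<open>B\<close> is assumed, so the density need not be measurable.
  The null measure integrates every function to zero, and the defining formula of
  \<open>density\<close> can be evaluated directly.\<close>

lemma restrict_to_null [simp]: "restrict_to (null_measure M) B = null_measure M"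
proof (rule measure_eqI)
  fix A assume "A \<in> sets (restrict_to (null_measure M) B)"
  show "emeasure (restrict_to (null_measure M) B) A = emeasure (null_measure M) A"
    by (simp add: restrict_to_def density_def emeasure_measure_of_conv nn_integral_null_measure)
qed simp

section \<open>Finite sums of point masses\<close>

lemma sets_dirac_sum [simp, measurable_cong]: "sets (dirac_sum M xs) = sets M"
  by (induct xs) auto

lemma space_dirac_sum [simp]: "space (dirac_sum M xs) = space M"
  by (induct xs) auto

lemma emeasure_dirac_sum:
  assumes "A \<in> sets M"
  shows "emeasure (dirac_sum M xs) A = of_nat (length (filter (\<lambda>x. x \<in> A) xs))"
  using assms by (induct xs) (auto simp: emeasure_add_measure)

lemma nn_integral_dirac_sum:
  assumes "f \<in> borel_measurable M" "set xs \<subseteq> space M"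
  shows "(\<integral>\<^sup>+x. f x \<partial>dirac_sum M xs) = (\<Sum>x\<leftarrow>xs. f x)"
  using assms
  by (induct xs) (auto simp: nn_integral_add_measure nn_integral_return nn_integral_null_measure ac_simps cong: measurable_cong_sets)

lemma dirac_sum_append: "dirac_sum M (xs @ ys) = dirac_sum M xs \<oplus>\<^sub>m dirac_sum M ys"
  by (induct xs) (auto intro!: measure_eqI simp: emeasure_add_measure ac_simps)

lemma dirac_sum_snoc [simp]: "dirac_sum M (xs @ [x]) = dirac_sum M xs \<oplus>\<^sub>m return M x"
  by (simp add: dirac_sum_append)

lemma dirac_sum_cong_mset:
  assumes "mset xs = mset ys"
  shows "dirac_sum M xs = dirac_sum M ys"
proof (rule measure_eqI)
  fix A assume "A \<in> sets (dirac_sum M xs)"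
  then have "A \<in> sets M" by simp
  moreover have "mset (filter (\<lambda>x. x \<in> A) xs) = mset (filter (\<lambda>x. x \<in> A) ys)"
    using assms by simp
  then have "length (filter (\<lambda>x. x \<in> A) xs) = length (filter (\<lambda>x. x \<in> A) ys)"
    by (rule mset_eq_length)
  ultimately show "emeasure (dirac_sum M xs) A = emeasure (dirac_sum M ys) A"
    by (simp add: emeasure_dirac_sum)
qed simp

section \<open>The sigma-field generated by the evaluations\<close>

lemma space_counting_algebra [simp]: "space (counting_algebra M \<B>) = counting_measures M \<B>"
  unfolding counting_algebra_def using sets.top[of M] by (auto simp: space_Sup_eq_UN)

lemma measurable_emeasure_counting_algebra [measurable]:
  assumes "B \<in> sets M"
  shows "(\<lambda>\<mu>. emeasure \<mu> B) \<in> borel_measurable (counting_algebra M \<B>)"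
  unfolding counting_algebra_def using assms
  by (intro measurable_SUP1[of B]) (auto intro: measurable_vimage_algebra1)

lemma measurable_counting_algebra:
  assumes "\<And>\<omega>. \<omega> \<in> space \<Omega> \<Longrightarrow> f \<omega> \<in> counting_measures M \<B>"
    and "\<And>B. B \<in> sets M \<Longrightarrow> (\<lambda>\<omega>. emeasure (f \<omega>) B) \<in> borel_measurable \<Omega>"
  shows "f \<in> \<Omega> \<rightarrow>\<^sub>M counting_algebra M \<B>"
  unfolding counting_algebra_def using assms sets.top[of M]
  by (intro measurable_SUP2) (auto intro!: measurable_vimage_algebra2)

text \<open>\<open>of_nat\<close> never takes the value infinity, so integer values on all
  measurable sets already make these measures finite. For finite \<open>M\<close> this space
  coincides with \<open>N_alg M\<close>, and the work on configurations takes place here.\<close>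

abbreviation fin_counting :: "'a measure \<Rightarrow> 'a measure measure" where
  "fin_counting M \<equiv> counting_algebra M (sets M)"

lemma N_alg_finite:
  assumes "finite_measure M"
  shows "N_alg M = fin_counting M"
proof -
  have "finite_measure_sets M = sets M"
    using finite_measure.emeasure_finite[OF assms] by (auto simp: finite_measure_sets_def top.not_eq_extremum)
  then show ?thesis
    by (simp add: N_alg_def)
qed

lemma counting_measuresD:
  assumes "\<mu> \<in> counting_measures M \<B>"
  shows "sets \<mu> = sets M" "B \<in> \<B> \<Longrightarrow> emeasure \<mu> B \<in> range of_nat"
  using assms by (auto simp: counting_measures_def)

lemma fin_counting_finite:
  assumes "\<mu> \<in> counting_measures M (sets M)"
  shows "finite_measure \<mu>"
proof
  have "emeasure \<mu> (space M) \<in> range of_nat" "space \<mu> = space M"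
    using assms sets_eq_imp_space_eq[of \<mu> M] by (auto simp: counting_measures_def)
  then show "emeasure \<mu> (space \<mu>) \<noteq> \<infinity>"
    by auto
qed

lemma null_measure_counting [simp, intro]: "null_measure M \<in> counting_measures M \<B>"
  by (auto simp: counting_measures_def intro!: range_eqI[of _ _ "0::nat"])

lemma add_measure_counting:
  assumes "\<mu> \<in> counting_measures M \<B>" "\<nu> \<in> counting_measures M \<B>"
  shows "\<mu> \<oplus>\<^sub>m \<nu> \<in> counting_measures M \<B>"
proof -
  have "a + b \<in> range of_nat" if "a \<in> range of_nat" "b \<in> range of_nat" for a b :: ennreal
    using that by (auto simp flip: of_nat_add)
  then show ?thesis
    using assms by (auto simp: counting_measures_def emeasure_add_measure)
qed

lemma return_counting [simp, intro]: "\<B> \<subseteq> sets M \<Longrightarrow> return M x \<in> counting_measures M \<B>"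
  by (auto simp: counting_measures_def indicator_def intro: range_eqI[of _ _ "0::nat"] range_eqI[of _ _ "1::nat"])

lemma add_return_counting [simp, intro]:
  "\<mu> \<in> counting_measures M \<B> \<Longrightarrow> \<B> \<subseteq> sets M \<Longrightarrow> \<mu> \<oplus>\<^sub>m return M x \<in> counting_measures M \<B>"
  by (intro add_measure_counting return_counting)

lemma dirac_sum_counting [simp, intro]: "\<B> \<subseteq> sets M \<Longrightarrow> dirac_sum M xs \<in> counting_measures M \<B>"
  by (induct xs) auto

text \<open>Two systems of sets, because restriction can improve finiteness: a measure that is
  integer-valued only inside the strips becomes, after restriction to one strip, integer-valued on
  all measurable sets.\<close>

lemma restrict_to_counting:
  assumes "\<mu> \<in> counting_measures M \<B>" "B \<in> sets M" "\<B> \<subseteq> sets M"  "\<And>A. A \<in> \<B>' \<Longrightarrow> A \<in> sets M \<and> A \<inter> B \<in> \<B>"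
  shows "restrict_to \<mu> B \<in> counting_measures M \<B>'"
  using assms by (auto simp: counting_measures_def emeasure_restrict_to)

lemma measurable_add_measure [measurable]:
  assumes f: "f \<in> \<Omega> \<rightarrow>\<^sub>M counting_algebra M \<B>" and g: "g \<in> \<Omega> \<rightarrow>\<^sub>M counting_algebra M \<B>"
  shows "(\<lambda>\<omega>. f \<omega> \<oplus>\<^sub>m g \<omega>) \<in> \<Omega> \<rightarrow>\<^sub>M counting_algebra M \<B>"
proof (rule measurable_counting_algebra)
  have *: "f \<omega> \<in> counting_measures M \<B>" "g \<omega> \<in> counting_measures M \<B>" if "\<omega> \<in> space \<Omega>" for \<omega>
    using measurable_space[OF f that] measurable_space[OF g that] by auto
  then show "f \<omega> \<oplus>\<^sub>m g \<omega> \<in> counting_measures M \<B>" if "\<omega> \<in> space \<Omega>" for \<omega>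
    using that by (auto intro: add_measure_counting)
  fix B assume B: "B \<in> sets M"
  have "(\<lambda>\<omega>. emeasure (f \<omega>) B + emeasure (g \<omega>) B) \<in> borel_measurable \<Omega>"
    using B f g by (auto intro!: borel_measurable_add measurable_compose[OF _ measurable_emeasure_counting_algebra])
  then show "(\<lambda>\<omega>. emeasure (f \<omega> \<oplus>\<^sub>m g \<omega>) B) \<in> borel_measurable \<Omega>"
    using * by (subst measurable_cong) (auto simp: emeasure_add_measure counting_measures_def)
qed

lemma measurable_return_counting [measurable]:
  assumes "\<B> \<subseteq> sets M"
  shows "return M \<in> M \<rightarrow>\<^sub>M counting_algebra M \<B>"
proof (rule measurable_counting_algebra)
  fix B assume B: "B \<in> sets M"
  then have "(\<lambda>x. indicator B x :: ennreal) \<in> borel_measurable M"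
    by simp
  then show "(\<lambda>x. emeasure (return M x) B) \<in> borel_measurable M"
    using B by (subst measurable_cong[where g="indicator B"]) auto
qed (use assms in auto)

section \<open>Measurability of integrals with respect to kernels\<close>

text \<open>Dynkin argument over rectangles. Finite total mass is what lets a complement be handled
  by subtraction.\<close>

lemma emeasure_kernel_measurable:
  assumes sets: "\<And>\<omega>. \<omega> \<in> space \<Omega> \<Longrightarrow> sets (k \<omega>) = sets M"
    and meas: "\<And>B. B \<in> sets M \<Longrightarrow> (\<lambda>\<omega>. emeasure (k \<omega>) B) \<in> borel_measurable \<Omega>"
    and fin: "\<And>\<omega>. \<omega> \<in> space \<Omega> \<Longrightarrow> emeasure (k \<omega>) (space M) \<noteq> \<infinity>"
    and A: "A \<in> sets (\<Omega> \<Otimes>\<^sub>M M)"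
  shows "(\<lambda>\<omega>. emeasure (k \<omega>) (Pair \<omega> -` A)) \<in> borel_measurable \<Omega>"
  using Int_stable_pair_measure_generator pair_measure_closed A[unfolded sets_pair_measure]
proof (induct rule: sigma_sets_induct_disjoint)
  case (basic A)
  fix A assume "A \<in> {a \<times> b |a b. a \<in> sets \<Omega> \<and> b \<in> sets M}"
  then obtain a b where A: "A = a \<times> b" "a \<in> sets \<Omega>" "b \<in> sets M" by auto
  then have "(\<lambda>\<omega>. emeasure (k \<omega>) (Pair \<omega> -` A)) = (\<lambda>\<omega>. indicator a \<omega> * emeasure (k \<omega>) b)"
    by (auto split: split_indicator)
  then show "(\<lambda>\<omega>. emeasure (k \<omega>) (Pair \<omega> -` A)) \<in> borel_measurable \<Omega>"
    using A meas by auto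
next
  show "(\<lambda>\<omega>. emeasure (k \<omega>) (Pair \<omega> -` {})) \<in> borel_measurable \<Omega>" by simp
next
  fix A assume A: "A \<in> sigma_sets (space \<Omega> \<times> space M) {a \<times> b |a b. a \<in> sets \<Omega> \<and> b \<in> sets M}"
    and IH: "(\<lambda>\<omega>. emeasure (k \<omega>) (Pair \<omega> -` A)) \<in> borel_measurable \<Omega>"
  have A': "A \<in> sets (\<Omega> \<Otimes>\<^sub>M M)" using A by (simp add: sets_pair_measure)
  have "emeasure (k \<omega>) (Pair \<omega> -` (space \<Omega> \<times> space M - A)) =
    emeasure (k \<omega>) (space M) - emeasure (k \<omega>) (Pair \<omega> -` A)" if \<omega>: "\<omega> \<in> space \<Omega>" for \<omega>
  proof -
    have "Pair \<omega> -` A \<in> sets (k \<omega>)" "Pair \<omega> -` A \<subseteq> space M"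
      using sets_Pair1[OF A'] sets.sets_into_space[OF A'] sets[OF \<omega>] by (auto simp: space_pair_measure)
    moreover have "Pair \<omega> -` (space \<Omega> \<times> space M - A) = space M - Pair \<omega> -` A"
      using \<omega> by auto
    ultimately show ?thesis
      using sets[OF \<omega>] fin[OF \<omega>] emeasure_mono[of "Pair \<omega> -` A" "space M" "k \<omega>"]
      by (simp add: emeasure_Diff top.not_eq_extremum)
  qed
  then show "(\<lambda>\<omega>. emeasure (k \<omega>) (Pair \<omega> -` (space \<Omega> \<times> space M - A))) \<in> borel_measurable \<Omega>"
    using IH meas[OF sets.top] by (simp cong: measurable_cong)
next
  fix A :: "nat \<Rightarrow> _"
  assume disj: "disjoint_family A" and A: "range A \<subseteq> sigma_sets (space \<Omega> \<times> space M) {a \<times> b |a b. a \<in> sets \<Omega> \<and> b \<in> sets M}"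
    and IH: "\<And>i. (\<lambda>\<omega>. emeasure (k \<omega>) (Pair \<omega> -` A i)) \<in> borel_measurable \<Omega>"
  have "emeasure (k \<omega>) (Pair \<omega> -` (\<Union>i. A i)) = (\<Sum>i. emeasure (k \<omega>) (Pair \<omega> -` A i))" if \<omega>: "\<omega> \<in> space \<Omega>" for \<omega>
  proof -
    have "Pair \<omega> -` A i \<in> sets (k \<omega>)" for i
      using sets_Pair1[of "A i" \<Omega> M] A sets[OF \<omega>] by (auto simp: sets_pair_measure)
    moreover have "disjoint_family (\<lambda>i. Pair \<omega> -` A i)"
      using disj by (auto simp: disjoint_family_on_def)
    ultimately show ?thesis
      by (subst suminf_emeasure) (auto simp: vimage_UN)
  qed
  then show "(\<lambda>\<omega>. emeasure (k \<omega>) (Pair \<omega> -` (\<Union>i. A i))) \<in> borel_measurable \<Omega>"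
    using IH by (simp cong: measurable_cong)
qed

lemma nn_integral_kernel_measurable_finite:
  assumes sets: "\<And>\<omega>. \<omega> \<in> space \<Omega> \<Longrightarrow> sets (k \<omega>) = sets M"
    and meas: "\<And>B. B \<in> sets M \<Longrightarrow> (\<lambda>\<omega>. emeasure (k \<omega>) B) \<in> borel_measurable \<Omega>"
    and fin: "\<And>\<omega>. \<omega> \<in> space \<Omega> \<Longrightarrow> emeasure (k \<omega>) (space M) \<noteq> \<infinity>"
    and f: "f \<in> borel_measurable (\<Omega> \<Otimes>\<^sub>M M)"
  shows "(\<lambda>\<omega>. \<integral>\<^sup>+x. f (\<omega>, x) \<partial>k \<omega>) \<in> borel_measurable \<Omega>"
  using f
proof (induct rule: borel_measurable_induct)
  case (cong f g)
  have "(\<integral>\<^sup>+x. f (\<omega>, x) \<partial>k \<omega>) = (\<integral>\<^sup>+x. g (\<omega>, x) \<partial>k \<omega>)" if "\<omega> \<in> space \<Omega>" for \<omega>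
    using cong that sets_eq_imp_space_eq[OF sets[OF that]]
    by (intro nn_integral_cong) (auto simp: space_pair_measure)
  then show ?case
    using cong by (simp cong: measurable_cong)
next
  case (set A)
  have "(\<integral>\<^sup>+x. indicator A (\<omega>, x) \<partial>k \<omega>) = emeasure (k \<omega>) (Pair \<omega> -` A)" if "\<omega> \<in> space \<Omega>" for \<omega>
  proof -
    have "(\<integral>\<^sup>+x. indicator A (\<omega>, x) \<partial>k \<omega>) = (\<integral>\<^sup>+x. indicator (Pair \<omega> -` A) x \<partial>k \<omega>)"
      by (intro nn_integral_cong) (auto split: split_indicator)
    then show ?thesis
      using sets_Pair1[OF set] sets[OF that] by simp
  qed
  then show ?case
    using emeasure_kernel_measurable[OF sets meas fin set] by (simp cong: measurable_cong)
next
  case (mult u c)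
  have "(\<integral>\<^sup>+x. c * u (\<omega>, x) \<partial>k \<omega>) = c * (\<integral>\<^sup>+x. u (\<omega>, x) \<partial>k \<omega>)" if "\<omega> \<in> space \<Omega>" for \<omega>
    using mult that sets[OF that] by (intro nn_integral_cmult) (auto cong: measurable_cong_sets)
  then show ?case
    using mult by (simp cong: measurable_cong)
next
  case (add u v)
  have "(\<integral>\<^sup>+x. v (\<omega>, x) + u (\<omega>, x) \<partial>k \<omega>) = (\<integral>\<^sup>+x. v (\<omega>, x) \<partial>k \<omega>) + (\<integral>\<^sup>+x. u (\<omega>, x) \<partial>k \<omega>)" if "\<omega> \<in> space \<Omega>" for \<omega>
    using add that sets[OF that] by (intro nn_integral_add) (auto cong: measurable_cong_sets)
  then show ?case
    using add by (simp cong: measurable_cong)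
next
  case (seq U)
  have "(\<integral>\<^sup>+x. (SUP i. U i) (\<omega>, x) \<partial>k \<omega>) = (SUP i. \<integral>\<^sup>+x. U i (\<omega>, x) \<partial>k \<omega>)" if "\<omega> \<in> space \<Omega>" for \<omega>
    using seq that sets[OF that] unfolding SUP_apply
    by (intro nn_integral_monotone_convergence_SUP) (auto simp: incseq_def le_fun_def cong: measurable_cong_sets)
  then show ?case
    using seq by (simp cong: measurable_cong)
qed

text \<open>For kernels that are finite only along an exhausting sequence, such as elements of
  \<open>N_loc_alg\<close> along the strips: the restrictions to \<open>E i\<close> are finite
  kernels, and monotone convergence removes the restriction.\<close>

lemma nn_integral_kernel_measurable:
  fixes E :: "nat \<Rightarrow> _"
  assumes sets: "\<And>\<omega>. \<omega> \<in> space \<Omega> \<Longrightarrow> sets (k \<omega>) = sets M"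
    and meas: "\<And>B. B \<in> sets M \<Longrightarrow> (\<lambda>\<omega>. emeasure (k \<omega>) B) \<in> borel_measurable \<Omega>"
    and E: "incseq E" "\<And>i. E i \<in> sets M" "(\<Union>i. E i) = space M"
    and fin: "\<And>\<omega> i. \<omega> \<in> space \<Omega> \<Longrightarrow> emeasure (k \<omega>) (E i) \<noteq> \<infinity>"
    and f: "f \<in> borel_measurable (\<Omega> \<Otimes>\<^sub>M M)"
  shows "(\<lambda>\<omega>. \<integral>\<^sup>+x. f (\<omega>, x) \<partial>k \<omega>) \<in> borel_measurable \<Omega>"
proof -
  have "(\<lambda>\<omega>. \<integral>\<^sup>+x. f (\<omega>, x) \<partial>restrict_to (k \<omega>) (E i)) \<in> borel_measurable \<Omega>" for i
  proof (rule nn_integral_kernel_measurable_finite[OF _ _ _ f])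
    show "sets (restrict_to (k \<omega>) (E i)) = sets M" if "\<omega> \<in> space \<Omega>" for \<omega>
      using sets[OF that] by simp
    show "(\<lambda>\<omega>. emeasure (restrict_to (k \<omega>) (E i)) B) \<in> borel_measurable \<Omega>" if "B \<in> sets M" for B
      using meas[of "B \<inter> E i"] that E sets by (subst measurable_cong[OF emeasure_restrict_to]) auto
    show "emeasure (restrict_to (k \<omega>) (E i)) (space M) \<noteq> \<infinity>" if "\<omega> \<in> space \<Omega>" for \<omega>
      using fin[OF that, of i] E(2)[of i] sets[OF that] sets.sets_into_space[OF E(2)[of i]]
      by (simp add: emeasure_restrict_to Int_absorb1)
  qed
  note [measurable] = this
  have "(\<integral>\<^sup>+x. f (\<omega>, x) \<partial>k \<omega>) = (SUP i. \<integral>\<^sup>+x. f (\<omega>, x) \<partial>restrict_to (k \<omega>) (E i))" if \<omega>: "\<omega> \<in> space \<Omega>" for \<omega>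
  proof -
    have [measurable]: "(\<lambda>x. f (\<omega>, x)) \<in> borel_measurable (k \<omega>)" "E i \<in> sets (k \<omega>)" for i
      using f \<omega> sets[OF \<omega>] E by (auto cong: measurable_cong_sets)
    have "(\<integral>\<^sup>+x. f (\<omega>, x) \<partial>k \<omega>) = (\<integral>\<^sup>+x. (SUP i. indicator (E i) x * f (\<omega>, x)) \<partial>k \<omega>)"
    proof (rule nn_integral_cong)
      fix x assume "x \<in> space (k \<omega>)"
      then obtain j where "x \<in> E j"
        using E(3) sets_eq_imp_space_eq[OF sets[OF \<omega>]] by auto
      then have "(SUP i. indicator (E i) x :: ennreal) = 1"
        by (intro antisym SUP_least) (auto intro!: SUP_upper2[of j] split: split_indicator)
      then show "f (\<omega>, x) = (SUP i. indicator (E i) x * f (\<omega>, x))"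
        by (simp flip: SUP_mult_right_ennreal)
    qed
    also have "\<dots> = (SUP i. \<integral>\<^sup>+x. indicator (E i) x * f (\<omega>, x) \<partial>k \<omega>)"
      using E by (intro nn_integral_monotone_convergence_SUP)
        (auto simp: incseq_def le_fun_def split: split_indicator)
    finally show ?thesis
      by (simp add: nn_integral_restrict_to)
  qed
  then show ?thesis
    by (simp cong: measurable_cong)
qed

lemma nn_integral_counting_measurable:
  assumes k: "k \<in> \<Omega> \<rightarrow>\<^sub>M fin_counting M"
    and f: "f \<in> borel_measurable (\<Omega> \<Otimes>\<^sub>M M)"
  shows "(\<lambda>\<omega>. \<integral>\<^sup>+x. f (\<omega>, x) \<partial>k \<omega>) \<in> borel_measurable \<Omega>"
proof (rule nn_integral_kernel_measurable_finite[OF _ _ _ f])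
  have *: "k \<omega> \<in> counting_measures M (sets M)" if "\<omega> \<in> space \<Omega>" for \<omega>
    using measurable_space[OF k that] by simp
  then show "sets (k \<omega>) = sets M" if "\<omega> \<in> space \<Omega>" for \<omega>
    using that counting_measuresD by blast
  show "(\<lambda>\<omega>. emeasure (k \<omega>) B) \<in> borel_measurable \<Omega>" if "B \<in> sets M" for B
    using measurable_compose[OF k measurable_emeasure_counting_algebra[OF that]] .
  show "emeasure (k \<omega>) (space M) \<noteq> \<infinity>" if "\<omega> \<in> space \<Omega>" for \<omega>
    using counting_measuresD(2)[OF *[OF that] sets.top] by auto
qed

text \<open>The set may vary with the parameter, as it does for \<psi>_x, which is cut off at a
  moving point x. The mass of a fixed set is then an integral of a jointly measurable indicator
  against the kernel.\<close>

lemma measurable_restrict_to: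
  assumes k: "k \<in> \<Omega> \<rightarrow>\<^sub>M fin_counting M"
    and A: "{(\<omega>, x) \<in> space \<Omega> \<times> space M. x \<in> B \<omega>} \<in> sets (\<Omega> \<Otimes>\<^sub>M M)"
    and B: "\<And>\<omega>. \<omega> \<in> space \<Omega> \<Longrightarrow> B \<omega> \<in> sets M"
  shows "(\<lambda>\<omega>. restrict_to (k \<omega>) (B \<omega>)) \<in> \<Omega> \<rightarrow>\<^sub>M fin_counting M"
proof (rule measurable_counting_algebra)
  have *: "k \<omega> \<in> counting_measures M (sets M)" if "\<omega> \<in> space \<Omega>" for \<omega>
    using measurable_space[OF k that] by simp
  then show "restrict_to (k \<omega>) (B \<omega>) \<in> counting_measures M (sets M)" if "\<omega> \<in> space \<Omega>" for \<omega>
    using that B by (intro restrict_to_counting) auto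
  fix C assume C[measurable]: "C \<in> sets M"
  note A[measurable]
  have "(\<lambda>\<omega>. \<integral>\<^sup>+x. indicator C (snd (\<omega>, x)) * indicator {(\<omega>, x) \<in> space \<Omega> \<times> space M. x \<in> B \<omega>} (\<omega>, x) \<partial>k \<omega>) \<in> borel_measurable \<Omega>"
    by (intro nn_integral_counting_measurable[OF k]) measurable
  also have "?this \<longleftrightarrow> (\<lambda>\<omega>. emeasure (restrict_to (k \<omega>) (B \<omega>)) C) \<in> borel_measurable \<Omega>"
  proof (rule measurable_cong)
    fix \<omega> assume \<omega>: "\<omega> \<in> space \<Omega>"
    have s: "sets (k \<omega>) = sets M"
      using *[OF \<omega>] counting_measuresD by blast
    have "(\<integral>\<^sup>+x. indicator C (snd (\<omega>, x)) * indicator {(\<omega>, x) \<in> space \<Omega> \<times> space M. x \<in> B \<omega>} (\<omega>, x) \<partial>k \<omega>)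
      = (\<integral>\<^sup>+x. indicator (C \<inter> B \<omega>) x \<partial>k \<omega>)"
      using \<omega> sets_eq_imp_space_eq[OF s] by (intro nn_integral_cong) (auto split: split_indicator)
    then show "(\<integral>\<^sup>+x. indicator C (snd (\<omega>, x)) * indicator {(\<omega>, x) \<in> space \<Omega> \<times> space M. x \<in> B \<omega>} (\<omega>, x) \<partial>k \<omega>)
      = emeasure (restrict_to (k \<omega>) (B \<omega>)) C"
      using s C B[OF \<omega>] by (simp add: emeasure_restrict_to)
  qed
  finally show "(\<lambda>\<omega>. emeasure (restrict_to (k \<omega>) (B \<omega>)) C) \<in> borel_measurable \<Omega>" .
qed

section \<open>Finite counting measures as sums of Dirac measures\<close>

text \<open>A countable family of measurable sets that separates points has two uses: it makes the
  diagonal measurable, and it forces a finite integer-valued measure to be purely atomic.\<close>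

locale separated_space =
  fixes M :: "'a measure"
  assumes separating: "\<exists>U :: nat \<Rightarrow> 'a set. (\<forall>i. U i \<in> sets M) \<and>
    (\<forall>x\<in>space M. \<forall>y\<in>space M. (\<forall>i. x \<in> U i \<longleftrightarrow> y \<in> U i) \<longrightarrow> x = y)"
begin

definition separators :: "nat \<Rightarrow> 'a set" where
  "separators = (SOME U. (\<forall>i. U i \<in> sets M) \<and>
    (\<forall>x\<in>space M. \<forall>y\<in>space M. (\<forall>i. x \<in> U i \<longleftrightarrow> y \<in> U i) \<longrightarrow> x = y))"

lemma separators_sets [measurable]: "separators i \<in> sets M"
  and separators_eq: "x \<in> space M \<Longrightarrow> y \<in> space M \<Longrightarrow> (\<And>i. x \<in> separators i \<longleftrightarrow> y \<in> separators i) \<Longrightarrow> x = y"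
  using someI_ex[OF separating, folded separators_def] by blast+

text \<open>Two points agree iff no separator tells them apart, which is a countable
  conjunction.\<close>

lemma measurable_eq_separated:
  assumes [measurable]: "f \<in> \<Omega> \<rightarrow>\<^sub>M M" "g \<in> \<Omega> \<rightarrow>\<^sub>M M"
  shows "Measurable.pred \<Omega> (\<lambda>\<omega>. f \<omega> = g \<omega>)"
proof -
  have "Measurable.pred \<Omega> (\<lambda>\<omega>. \<forall>i. f \<omega> \<in> separators i \<longleftrightarrow> g \<omega> \<in> separators i)"
    by measurable
  moreover have "(\<forall>i. f \<omega> \<in> separators i \<longleftrightarrow> g \<omega> \<in> separators i) \<longleftrightarrow> f \<omega> = g \<omega>" if "\<omega> \<in> space \<Omega>" for \<omega>
    using separators_eq[OF measurable_space[OF assms(1) that] measurable_space[OF assms(2) that]] by metis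
  ultimately show ?thesis
    using measurable_cong[of \<Omega> "\<lambda>\<omega>. \<forall>i. f \<omega> \<in> separators i \<longleftrightarrow> g \<omega> \<in> separators i" "\<lambda>\<omega>. f \<omega> = g \<omega>"] by blast
qed

lemma singleton_sets [measurable]: 
  assumes "x \<in> space M" shows "{x} \<in> sets M"
proof -
  have "Measurable.pred M (\<lambda>y. y = x)"
    using assms by (intro measurable_eq_separated) auto
  moreover have "{x} = {y\<in>space M. y = x}"
    using assms by auto
  ultimately show ?thesis
    by (simp add: pred_def)
qed

text \<open>Take a set \<open>A\<close> whose measure \<open>k\<close> is the least positive value
  attained. Neither part of a splitting of \<open>A\<close> can have a smaller positive measure, so
  each separator leaves one part of \<open>A\<close> null. Discarding these countably many null
  parts keeps mass \<open>k\<close> and leaves a set that no separator divides, that is, a single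
  point.\<close>

lemma counting_atom:
  assumes \<mu>: "\<mu> \<in> counting_measures M (sets M)" and pos: "emeasure \<mu> (space M) \<noteq> 0"
  obtains x where "x \<in> space M" "emeasure \<mu> {x} \<ge> 1"
proof -
  have s [simp]: "sets \<mu> = sets M" and nat: "B \<in> sets M \<Longrightarrow> emeasure \<mu> B \<in> range of_nat" for B
    using \<mu> by (auto simp: counting_measures_def)
  define P where "P k \<longleftrightarrow> k > 0 \<and> (\<exists>A\<in>sets M. emeasure \<mu> A = of_nat k)" for k :: nat
  obtain n where n: "emeasure \<mu> (space M) = of_nat n"
    using nat[OF sets.top] by auto
  have "P n"
    using pos n by (auto simp: P_def)
  define k where "k = (LEAST k. P k)"
  have "P k" and least: "\<And>j. P j \<Longrightarrow> k \<le> j"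
    unfolding k_def using \<open>P n\<close> by (auto intro: LeastI Least_le)
  then obtain A where A [measurable]: "A \<in> sets M" "emeasure \<mu> A = of_nat k" and "k > 0"
    by (auto simp: P_def)
  have dich: "emeasure \<mu> (A \<inter> C) = 0 \<or> emeasure \<mu> (A - C) = 0" if C: "C \<in> sets M" for C
  proof -
    obtain i j where ij: "emeasure \<mu> (A \<inter> C) = of_nat i" "emeasure \<mu> (A - C) = of_nat j"
      using nat[of "A \<inter> C"] nat[of "A - C"] A C by auto
    have "of_nat (i + j) = (of_nat k :: ennreal)"
      using ij plus_emeasure[of "A \<inter> C" \<mu> "A - C"] A C by (auto simp: Int_Diff_Un)
    then have "i + j = k"
      by (simp only: of_nat_eq_iff)
    moreover have "i = 0 \<or> k \<le> i"
      using least[of i] ij(1) bexI[of "\<lambda>B. emeasure \<mu> B = of_nat i" "A \<inter> C" "sets M"] A(1) C unfolding P_def by (cases "i = 0") auto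
    moreover have "j = 0 \<or> k \<le> j"
      using least[of j] ij(2) bexI[of "\<lambda>B. emeasure \<mu> B = of_nat j" "A - C" "sets M"] A(1) C unfolding P_def by (cases "j = 0") auto
    ultimately have "i = 0 \<or> j = 0" using \<open>k > 0\<close> by linarith
    then show ?thesis using ij by auto
  qed
  \<comment> \<open>Within \<open>A\<close>, \<open>D i\<close> is a side of the i-th separator that
    is null.\<close>
  define D where "D i = (if emeasure \<mu> (A \<inter> separators i) = 0 then separators i else A - separators i)" for i
  have D [measurable]: "D i \<in> sets M" for i
    by (simp add: D_def)
  have "emeasure \<mu> (A \<inter> D i) = 0" for i
  proof (cases "emeasure \<mu> (A \<inter> separators i) = 0")
    case False
    then have "emeasure \<mu> (A - separators i) = 0"
      using dich[of "separators i"] by simp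
    moreover have "A \<inter> (A - separators i) = A - separators i" by auto
    ultimately show ?thesis
      using False by (simp add: D_def)
  qed (simp add: D_def)
  then have null: "(\<Union>i. A \<inter> D i) \<in> null_sets \<mu>"
    by (intro null_sets_UN) auto
  define E where "E = A - (\<Union>i. A \<inter> D i)"
  have "emeasure \<mu> E = of_nat k"
    unfolding E_def using emeasure_Diff_null_set[OF null, of A] A by simp
  with \<open>k > 0\<close> obtain x where x: "x \<in> E"
    by (cases "E = {}") auto
  have xM: "x \<in> space M"
    using x sets.sets_into_space[OF A(1)] by (auto simp: E_def)
  have "y = x" if y: "y \<in> E" for y
  proof (rule separators_eq)
    show "y \<in> space M"
      using y sets.sets_into_space[OF A(1)] by (auto simp: E_def)
    show "y \<in> separators i \<longleftrightarrow> x \<in> separators i" for i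
      using x y by (auto simp: E_def D_def split: if_splits)
  qed fact
  then have "E = {x}"
    using x by blast
  moreover have "(1 :: ennreal) \<le> of_nat k"
    using \<open>k > 0\<close> of_nat_mono[of 1 k, where 'a=ennreal] by simp
  ultimately have "emeasure \<mu> {x} \<ge> 1"
    using \<open>emeasure \<mu> E = of_nat k\<close> by simp
  with xM show ?thesis by (rule that)
qed

text \<open>At an atom of mass c the factor (c - 1) / c takes away exactly one unit; without an atom
  at \<open>x\<close> the density differs from 1 only on a null set, so nothing is removed.\<close>

definition remove_point :: "'a measure \<Rightarrow> 'a \<Rightarrow> 'a measure" where
  "remove_point \<mu> x = density \<mu> (\<lambda>y. if y = x then (emeasure \<mu> {x} - 1) / emeasure \<mu> {x} else 1)"

lemma sets_remove_point [simp]: "sets (remove_point \<mu> x) = sets \<mu>"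
  by (simp add: remove_point_def)

text \<open>Stated as a sum because subtraction in \<open>ennreal\<close> truncates at zero.\<close>

lemma emeasure_remove_point:
  assumes \<mu>: "\<mu> \<in> counting_measures M (sets M)" and x: "x \<in> space M" and ge: "emeasure \<mu> {x} \<ge> 1"
    and A: "A \<in> sets M"
  shows "emeasure (remove_point \<mu> x) A + indicator A x = emeasure \<mu> A"
proof -
  have s: "sets \<mu> = sets M"
    using counting_measuresD[OF \<mu>] by simp
  note [measurable_cong] = s
  have [measurable]: "{x} \<in> sets \<mu>" "A \<in> sets \<mu>"
    using x A s by auto
  let ?c = "emeasure \<mu> {x}"
  obtain n where n: "?c = of_nat n"
    using counting_measuresD(2)[OF \<mu>] singleton_sets[OF x] by auto
  have "emeasure (remove_point \<mu> x) A = (\<integral>\<^sup>+y. (?c - 1) / ?c * indicator (A \<inter> {x}) y + indicator (A - {x}) y \<partial>\<mu>)"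
    unfolding remove_point_def
    by (subst emeasure_density) (auto intro!: nn_integral_cong split: split_indicator)
  also have "\<dots> = (?c - 1) / ?c * emeasure \<mu> (A \<inter> {x}) + emeasure \<mu> (A - {x})"
    by (simp add: nn_integral_add nn_integral_cmult)
  also have "(?c - 1) / ?c * emeasure \<mu> (A \<inter> {x}) = (?c - 1) * indicator A x"
  proof -
    have "?c / ?c = 1"
      using ge n by (intro ennreal_divide_self) (auto simp: of_nat_less_top)
    then have "(?c - 1) / ?c * ?c = ?c - 1"
      by (metis ennreal_divide_times mult.commute mult.right_neutral)
    then show ?thesis
      by (auto split: split_indicator)
  qed
  finally have "emeasure (remove_point \<mu> x) A + indicator A x =
    (?c - 1 + 1) * indicator A x + emeasure \<mu> (A - {x})"
    by (auto split: split_indicator simp: ac_simps)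
  also have "?c - 1 + 1 = ?c"
    using ge by (simp add: diff_add_cancel_ennreal)
  also have "?c * indicator A x = emeasure \<mu> (A \<inter> {x})"
    by (auto split: split_indicator)
  finally show ?thesis
    using plus_emeasure[of "A \<inter> {x}" \<mu> "A - {x}"] by (simp add: Int_Diff_Un Int_Diff_disjoint)
qed

lemma remove_point_null:
  assumes \<mu>: "\<mu> \<in> counting_measures M (sets M)" and x: "x \<in> space M" and null: "emeasure \<mu> {x} = 0"
  shows "remove_point \<mu> x = \<mu>"
proof -
  have s [measurable_cong]: "sets \<mu> = sets M"
    using counting_measuresD[OF \<mu>] by simp
  have [measurable]: "{x} \<in> sets \<mu>"
    using x s by auto
  have "AE y in \<mu>. y \<notin> {x}"
    using null by (intro AE_not_in) auto
  then have "AE y in \<mu>. (if y = x then (emeasure \<mu> {x} - 1) / emeasure \<mu> {x} else 1) = (1 :: ennreal)"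
    by eventually_elim auto
  then have "remove_point \<mu> x = density \<mu> (\<lambda>_. 1)"
    unfolding remove_point_def by (intro density_cong) auto
  then show ?thesis
    by (simp add: density_1)
qed

lemma remove_point_counting:
  assumes \<mu>: "\<mu> \<in> counting_measures M (sets M)" and x: "x \<in> space M"
  shows "remove_point \<mu> x \<in> counting_measures M (sets M)"
proof (cases "emeasure \<mu> {x} \<ge> 1")
  case False
  obtain n where "emeasure \<mu> {x} = of_nat n"
    using counting_measuresD(2)[OF \<mu>] singleton_sets[OF x] by auto
  with False have "emeasure \<mu> {x} = 0"
    by (cases n) auto
  then show ?thesis
    using remove_point_null[OF \<mu> x] \<mu> by simp
next
  case ge: True
  note assms = assms ge
  have "emeasure (remove_point \<mu> x) A \<in> range of_nat" if A: "A \<in> sets M" for A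
  proof -
    obtain n where n: "emeasure \<mu> A = of_nat n"
      using counting_measuresD(2)[OF \<mu> A] by auto
    show ?thesis
    proof (cases "x \<in> A")
      case True
      then have eq: "emeasure (remove_point \<mu> x) A + 1 = of_nat n"
        using emeasure_remove_point[OF assms A] n by simp
      then have "n \<noteq> 0"
        by (intro notI) simp
      then obtain m where "n = Suc m"
        by (cases n) auto
      with eq have "emeasure (remove_point \<mu> x) A = of_nat m"
        by (simp add: add.commute)
      then show ?thesis by auto
    qed (use emeasure_remove_point[OF assms A] n in auto)
  qed
  then show ?thesis
    using counting_measuresD(1)[OF \<mu>] by (auto simp: counting_measures_def)
qed

lemma remove_point_add:
  assumes \<mu>: "\<mu> \<in> counting_measures M (sets M)" and x: "x \<in> space M" and ge: "emeasure \<mu> {x} \<ge> 1"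
  shows "remove_point \<mu> x \<oplus>\<^sub>m return M x = \<mu>"
proof (rule measure_eqI)
  fix A assume "A \<in> sets (remove_point \<mu> x \<oplus>\<^sub>m return M x)"
  then have "A \<in> sets M"
    using counting_measuresD(1)[OF \<mu>] by simp
  then show "emeasure (remove_point \<mu> x \<oplus>\<^sub>m return M x) A = emeasure \<mu> A"
    using emeasure_remove_point[OF assms] counting_measuresD(1)[OF \<mu>] by (simp add: emeasure_add_measure)
qed simp

lemma remove_point_add_return:
  assumes \<mu>: "\<mu> \<in> counting_measures M (sets M)" and x: "x \<in> space M"
  shows "remove_point (\<mu> \<oplus>\<^sub>m return M x) x = \<mu>"
proof (rule measure_eqI)
  have s: "sets \<mu> = sets M"
    using counting_measuresD[OF \<mu>] by simp
  show "sets (remove_point (\<mu> \<oplus>\<^sub>m return M x) x) = sets \<mu>"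
    by simp
  fix A assume "A \<in> sets (remove_point (\<mu> \<oplus>\<^sub>m return M x) x)"
  then have A: "A \<in> sets M"
    using s by simp
  have "emeasure (remove_point (\<mu> \<oplus>\<^sub>m return M x) x) A + indicator A x = emeasure (\<mu> \<oplus>\<^sub>m return M x) A"
    using s x by (intro emeasure_remove_point add_return_counting \<mu> A) (auto simp: emeasure_add_measure)
  also have "\<dots> = emeasure \<mu> A + indicator A x"
    using s A by (simp add: emeasure_add_measure)
  finally show "emeasure (remove_point (\<mu> \<oplus>\<^sub>m return M x) x) A = emeasure \<mu> A"
    by (auto split: split_indicator_asm simp: add.commute[of _ "1::ennreal"])
qed

text \<open>Induction on the total mass: as long as it is positive there is an atom, and removing
  one unit there lowers the mass by one.\<close>

lemma counting_eq_dirac_sum: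
  assumes "\<mu> \<in> counting_measures M (sets M)"
  obtains xs where "set xs \<subseteq> space M" "\<mu> = dirac_sum M xs"
proof -
  have "\<exists>xs. set xs \<subseteq> space M \<and> \<mu> = dirac_sum M xs"
    if "\<mu> \<in> counting_measures M (sets M)" "emeasure \<mu> (space M) = of_nat n" for n \<mu>
    using that
  proof (induct n arbitrary: \<mu>)
    case 0
    have s: "sets \<mu> = sets M"
      using counting_measuresD[OF 0(1)] by simp
    have "emeasure \<mu> A = 0" if "A \<in> sets M" for A
      using 0 emeasure_mono[of A "space M" \<mu>] sets.sets_into_space[OF that] s by simp
    then have "\<mu> = dirac_sum M []"
      using s by (intro measure_eqI) auto
    then show ?case
      by (intro exI[of _ "[]"]) auto
  next
    case (Suc n)
    then obtain x where x: "x \<in> space M" "emeasure \<mu> {x} \<ge> 1"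
      using counting_atom[OF Suc(2)] by auto
    have "emeasure (remove_point \<mu> x) (space M) = of_nat n"
      using emeasure_remove_point[OF Suc(2) x sets.top] Suc(3) x by (simp add: add.commute)
    then obtain xs where "set xs \<subseteq> space M" "remove_point \<mu> x = dirac_sum M xs"
      using Suc(1)[OF remove_point_counting[OF Suc(2) x(1)]] by auto
    then have "set (x # xs) \<subseteq> space M \<and> \<mu> = dirac_sum M (x # xs)"
      using remove_point_add[OF Suc(2) x] x by auto
    then show ?case ..
  qed
  note ex = this
  obtain n where "emeasure \<mu> (space M) = of_nat n"
    using counting_measuresD(2)[OF assms sets.top] by auto
  from ex[OF assms this] show thesis
    by (auto intro: that)
qed

text \<open>The mass of a singleton is the multiplicity of its point in the list. So a configuration
  determines its list up to order, which makes the arbitrary choice of a list in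
  \<open>hamiltonian\<close> harmless for symmetric functions.\<close>

lemma dirac_sum_eq_imp_mset_eq:
  assumes xs: "set xs \<subseteq> space M" and ys: "set ys \<subseteq> space M" and eq: "dirac_sum M xs = dirac_sum M ys"
  shows "mset xs = mset ys"
proof (rule multiset_eqI)
  fix x
  show "count (mset xs) x = count (mset ys) x"
  proof (cases "x \<in> space M")
    case True
    have "(\<lambda>y. y \<in> {x}) = (=) x"
      by (rule ext) blast
    then have "emeasure (dirac_sum M zs) {x} = of_nat (count (mset zs) x)" for zs
      using True by (simp only: emeasure_dirac_sum singleton_sets count_mset count_list_eq_length_filter)
    from this[of xs] this[of ys] show ?thesis
      using eq by simp
  next
    case False
    then have "x \<notin> set xs" "x \<notin> set ys"
      using xs ys by auto
    then show ?thesis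
      by (metis count_mset_0_iff)
  qed
qed

lemma remove_point_dirac_sum:
  assumes "set xs \<subseteq> space M" "x \<in> set xs"
  shows "remove_point (dirac_sum M xs) x = dirac_sum M (remove1 x xs)"
proof -
  have "mset xs = mset (x # remove1 x xs)"
    using assms(2) by simp
  from dirac_sum_cong_mset[OF this] have "dirac_sum M xs = dirac_sum M (remove1 x xs) \<oplus>\<^sub>m return M x"
    by simp
  then show ?thesis
    using assms(1) subsetD[OF assms] remove_point_add_return[of "dirac_sum M (remove1 x xs)" x] by simp
qed

text \<open>The mass of a moving singleton is the integral of the indicator of a graph, and the
  graph is measurable by \<open>measurable_eq_separated\<close>.\<close>

lemma emeasure_atom_measurable:
  assumes k[measurable]: "k \<in> \<Omega> \<rightarrow>\<^sub>M fin_counting M" and x[measurable]: "x \<in> \<Omega> \<rightarrow>\<^sub>M M"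
  shows "(\<lambda>\<omega>. emeasure (k \<omega>) {x \<omega>}) \<in> borel_measurable \<Omega>"
proof -
  have [measurable]: "Measurable.pred (\<Omega> \<Otimes>\<^sub>M M) (\<lambda>z. snd z = x (fst z))"
    by (intro measurable_eq_separated) auto
  have "(\<lambda>\<omega>. \<integral>\<^sup>+y. (if snd (\<omega>, y) = x (fst (\<omega>, y)) then 1 else 0) \<partial>k \<omega>) \<in> borel_measurable \<Omega>"
    by (intro nn_integral_counting_measurable[OF k]) measurable
  moreover have "(\<integral>\<^sup>+y. (if snd (\<omega>, y) = x (fst (\<omega>, y)) then 1 else 0) \<partial>k \<omega>) = emeasure (k \<omega>) {x \<omega>}"
    if \<omega>: "\<omega> \<in> space \<Omega>" for \<omega>
  proof -
    have "{x \<omega>} \<in> sets (k \<omega>)"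
      using measurable_space[OF k \<omega>] measurable_space[OF x \<omega>] by (auto simp: counting_measures_def)
    then have "(\<integral>\<^sup>+y. indicator {x \<omega>} y \<partial>k \<omega>) = emeasure (k \<omega>) {x \<omega>}"
      by simp
    then show ?thesis
      by (simp add: indicator_def of_bool_def)
  qed
  ultimately show ?thesis
    by (simp cong: measurable_cong)
qed

lemma measurable_remove_point:
  assumes k[measurable]: "k \<in> \<Omega> \<rightarrow>\<^sub>M fin_counting M" and x[measurable]: "x \<in> \<Omega> \<rightarrow>\<^sub>M M"
  shows "(\<lambda>\<omega>. remove_point (k \<omega>) (x \<omega>)) \<in> \<Omega> \<rightarrow>\<^sub>M fin_counting M"
proof (rule measurable_counting_algebra)
  have *: "k \<omega> \<in> counting_measures M (sets M)" "x \<omega> \<in> space M" if "\<omega> \<in> space \<Omega>" for \<omega>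
    using measurable_space[OF k that] measurable_space[OF x that] by auto
  show "remove_point (k \<omega>) (x \<omega>) \<in> counting_measures M (sets M)" if "\<omega> \<in> space \<Omega>" for \<omega>
    using that * by (intro remove_point_counting) auto
  fix A assume A[measurable]: "A \<in> sets M"
  have [measurable]: "(\<lambda>\<omega>. emeasure (k \<omega>) {x \<omega>}) \<in> borel_measurable \<Omega>"
    by (intro emeasure_atom_measurable k x)
  \<comment> \<open>An integer-valued measure has mass 0 or at least 1 at a point, so this
    distinction covers all cases; its condition is measurable in the parameter.\<close>
  have eq: "emeasure (remove_point (k \<omega>) (x \<omega>)) A =
    emeasure (k \<omega>) A - (if emeasure (k \<omega>) {x \<omega>} = 0 then 0 else indicator A (x \<omega>))" if \<omega>: "\<omega> \<in> space \<Omega>" for \<omega>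
  proof (cases "emeasure (k \<omega>) {x \<omega>} = 0")
    case True
    then show ?thesis
      using remove_point_null[OF *[OF \<omega>]] by simp
  next
    case False
    obtain n where n: "emeasure (k \<omega>) {x \<omega>} = of_nat n"
      using counting_measuresD(2)[OF *(1)[OF \<omega>]] singleton_sets[OF *(2)[OF \<omega>]] by auto
    then have ge: "emeasure (k \<omega>) {x \<omega>} \<ge> 1"
      using False of_nat_mono[of 1 n, where 'a=ennreal] by (cases n) auto
    have "emeasure (remove_point (k \<omega>) (x \<omega>)) A =
      emeasure (remove_point (k \<omega>) (x \<omega>)) A + indicator A (x \<omega>) - indicator A (x \<omega>)"
      by (rule ennreal_add_diff_cancel_right[symmetric]) (auto split: split_indicator)
    then show ?thesis
      unfolding emeasure_remove_point[OF *[OF \<omega>] ge A] using False by simp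
  qed
  have "(\<lambda>\<omega>. emeasure (k \<omega>) A - (if emeasure (k \<omega>) {x \<omega>} = 0 then 0 else indicator A (x \<omega>))) \<in> borel_measurable \<Omega>"
    by measurable
  then show "(\<lambda>\<omega>. emeasure (remove_point (k \<omega>) (x \<omega>)) A) \<in> borel_measurable \<Omega>"
    using eq by (subst measurable_cong) 
qed

end

section \<open>Point insertion operators and weighted configuration measures\<close>

lemma ennreal_fact_cancel: "ennreal (1 / fact n) * (fact n * a) = a"
proof -
  have "ennreal (1 / fact n) * (fact n :: ennreal) = ennreal (1 / fact n) * ennreal (fact n)"
    by (metis ennreal_of_nat_eq_real_of_nat of_nat_fact)
  also have "\<dots> = 1"
    by (simp flip: ennreal_mult')
  finally show ?thesis
    by (simp flip: mult.assoc)
qed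

text \<open>The \<open>n\<close>-fold integral of \<open>\<kappa>\<^sub>n(x\<^sub>1,\<dots>,x\<^sub>n,\<mu>) g(\<mu> + \<delta>\<^sub>x\<^sub>1 + \<dots> + \<delta>\<^sub>x\<^sub>n)\<close> is the \<open>n\<close>-th power of the
  operator \<open>insert_op\<close> below, applied to \<open>g\<close>; this avoids integrals over product spaces.\<close>

locale weighted_insertion = N: sigma_finite_measure N
  for N :: "'a measure" +
  fixes k :: "'a \<Rightarrow> 'a measure \<Rightarrow> ennreal"
  assumes weight_measurable: "(\<lambda>(x, \<mu>). k x \<mu>) \<in> borel_measurable (N \<Otimes>\<^sub>M fin_counting N)"
    and cocycle: "x \<in> space N \<Longrightarrow> y \<in> space N \<Longrightarrow> \<mu> \<in> counting_measures N (sets N) \<Longrightarrow>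
      k x \<mu> * k y (\<mu> \<oplus>\<^sub>m return N x) = k y \<mu> * k x (\<mu> \<oplus>\<^sub>m return N y)"
begin

abbreviation "NN \<equiv> fin_counting N"

lemma measurable_weight [measurable (raw)]:
  "f \<in> \<Omega> \<rightarrow>\<^sub>M N \<Longrightarrow> g \<in> \<Omega> \<rightarrow>\<^sub>M NN \<Longrightarrow> (\<lambda>\<omega>. k (f \<omega>) (g \<omega>)) \<in> borel_measurable \<Omega>"
  using measurable_compose[OF measurable_Pair weight_measurable, of f \<Omega> g] by simp

lemma measurable_add_return [measurable (raw)]:
  "f \<in> \<Omega> \<rightarrow>\<^sub>M N \<Longrightarrow> g \<in> \<Omega> \<rightarrow>\<^sub>M NN \<Longrightarrow> (\<lambda>\<omega>. g \<omega> \<oplus>\<^sub>m return N (f \<omega>)) \<in> \<Omega> \<rightarrow>\<^sub>M NN"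
  by (intro measurable_add_measure measurable_compose[OF _ measurable_return_counting]) auto

definition insert_op :: "('a measure \<Rightarrow> ennreal) \<Rightarrow> 'a measure \<Rightarrow> ennreal" where
  "insert_op g \<mu> = (\<integral>\<^sup>+x. k x \<mu> * g (\<mu> \<oplus>\<^sub>m return N x) \<partial>N)"

lemma insert_op_measurable [measurable]:
  assumes [measurable]: "g \<in> borel_measurable NN"
  shows "insert_op g \<in> borel_measurable NN"
  unfolding insert_op_def[abs_def] by measurable

lemma insert_op_cong:
  assumes "\<mu> \<in> counting_measures N (sets N)"
    and "\<And>\<nu>. \<nu> \<in> counting_measures N (sets N) \<Longrightarrow> g \<nu> = g' \<nu>"
  shows "insert_op g \<mu> = insert_op g' \<mu>"
  using assms by (auto simp: insert_op_def intro!: nn_integral_cong)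

lemma insert_op_mono:
  assumes "\<mu> \<in> counting_measures N (sets N)"
    and "\<And>\<nu>. \<nu> \<in> counting_measures N (sets N) \<Longrightarrow> g \<nu> \<le> g' \<nu>"
  shows "insert_op g \<mu> \<le> insert_op g' \<mu>"
  using assms by (auto simp: insert_op_def intro!: nn_integral_mono mult_left_mono)

lemma insert_op_add:
  assumes [measurable]: "g \<in> borel_measurable NN" "h \<in> borel_measurable NN" and \<mu>: "\<mu> \<in> counting_measures N (sets N)"
  shows "insert_op (\<lambda>\<mu>. g \<mu> + h \<mu>) \<mu> = insert_op g \<mu> + insert_op h \<mu>"
proof -
  have [measurable]: "\<mu> \<in> space NN" using \<mu> by simp
  show ?thesis
    unfolding insert_op_def distrib_left by (rule nn_integral_add) measurable
qed

lemma insert_op_cmult: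
  assumes [measurable]: "g \<in> borel_measurable NN" and \<mu>: "\<mu> \<in> counting_measures N (sets N)"
  shows "insert_op (\<lambda>\<mu>. c * g \<mu>) \<mu> = c * insert_op g \<mu>"
proof -
  have [measurable]: "\<mu> \<in> space NN" using \<mu> by simp
  show ?thesis
    unfolding insert_op_def mult.left_commute[of _ c] by (rule nn_integral_cmult) measurable
qed

lemma insert_op_SUP:
  fixes g :: "nat \<Rightarrow> 'a measure \<Rightarrow> ennreal"
  assumes [measurable]: "\<And>i. g i \<in> borel_measurable NN" and inc: "incseq g" and \<mu>: "\<mu> \<in> counting_measures N (sets N)"
  shows "insert_op (\<lambda>\<mu>. SUP i. g i \<mu>) \<mu> = (SUP i. insert_op (g i) \<mu>)"
proof -
  have [measurable]: "\<mu> \<in> space NN" using \<mu> by simp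
  show ?thesis
    unfolding insert_op_def SUP_mult_left_ennreal using inc
    by (intro nn_integral_monotone_convergence_SUP) (auto simp: incseq_def le_fun_def intro!: mult_left_mono)
qed

section \<open>Powers of the insertion operator\<close>

abbreviation insert_pow :: "nat \<Rightarrow> ('a measure \<Rightarrow> ennreal) \<Rightarrow> 'a measure \<Rightarrow> ennreal" where
  "insert_pow n \<equiv> insert_op ^^ n"

lemma insert_pow_measurable [measurable]:
  "g \<in> borel_measurable NN \<Longrightarrow> insert_pow n g \<in> borel_measurable NN"
  by (induct n) auto

lemma insert_pow_cong:
  assumes "\<mu> \<in> counting_measures N (sets N)"
    and "\<And>\<nu>. \<nu> \<in> counting_measures N (sets N) \<Longrightarrow> g \<nu> = g' \<nu>"
  shows "insert_pow n g \<mu> = insert_pow n g' \<mu>"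
  using assms(1) by (induct n arbitrary: \<mu>) (auto intro!: insert_op_cong simp: assms)

lemma insert_pow_add:
  assumes [measurable]: "g \<in> borel_measurable NN" "h \<in> borel_measurable NN" and \<mu>: "\<mu> \<in> counting_measures N (sets N)"
  shows "insert_pow n (\<lambda>\<mu>. g \<mu> + h \<mu>) \<mu> = insert_pow n g \<mu> + insert_pow n h \<mu>"
  using \<mu>
proof (induct n arbitrary: \<mu>)
  case (Suc n)
  have "insert_pow (Suc n) (\<lambda>\<mu>. g \<mu> + h \<mu>) \<mu> = insert_op (\<lambda>\<mu>. insert_pow n g \<mu> + insert_pow n h \<mu>) \<mu>"
    using Suc by (auto intro!: insert_op_cong)
  then show ?case
    using Suc by (simp add: insert_op_add)
qed simp

lemma insert_pow_cmult:
  assumes [measurable]: "g \<in> borel_measurable NN" and \<mu>: "\<mu> \<in> counting_measures N (sets N)"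
  shows "insert_pow n (\<lambda>\<mu>. c * g \<mu>) \<mu> = c * insert_pow n g \<mu>"
  using \<mu>
proof (induct n arbitrary: \<mu>)
  case (Suc n)
  have "insert_pow (Suc n) (\<lambda>\<mu>. c * g \<mu>) \<mu> = insert_op (\<lambda>\<mu>. c * insert_pow n g \<mu>) \<mu>"
    using Suc by (auto intro!: insert_op_cong)
  then show ?case
    using Suc by (simp add: insert_op_cmult)
qed simp

lemma insert_pow_mono:
  assumes "\<mu> \<in> counting_measures N (sets N)"
    and "\<And>\<nu>. \<nu> \<in> counting_measures N (sets N) \<Longrightarrow> g \<nu> \<le> g' \<nu>"
  shows "insert_pow n g \<mu> \<le> insert_pow n g' \<mu>"
  using assms(1) by (induct n arbitrary: \<mu>) (auto intro!: insert_op_mono simp: assms)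

lemma insert_pow_SUP:
  fixes g :: "nat \<Rightarrow> 'a measure \<Rightarrow> ennreal"
  assumes [measurable]: "\<And>i. g i \<in> borel_measurable NN" and inc: "incseq g" and \<mu>: "\<mu> \<in> counting_measures N (sets N)"
  shows "insert_pow n (\<lambda>\<mu>. SUP i. g i \<mu>) \<mu> = (SUP i. insert_pow n (g i) \<mu>)"
  using \<mu>
proof (induct n arbitrary: \<mu>)
  case (Suc n)
  \<comment> \<open>\<open>insert_op_SUP\<close> asks for monotonicity at every argument, but
    \<open>insert_pow_mono\<close> gives it on integer-valued measures only, so the functions are
    cut off elsewhere.\<close>
  define h where "h i \<mu> = (if \<mu> \<in> counting_measures N (sets N) then insert_pow n (g i) \<mu> else 0)" for i \<mu>
  have h: "\<mu> \<in> counting_measures N (sets N) \<Longrightarrow> h i \<mu> = insert_pow n (g i) \<mu>" for i \<mu>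
    by (simp add: h_def)
  have [measurable]: "h i \<in> borel_measurable NN" for i
    using insert_pow_measurable[of "g i" n] by (subst measurable_cong[of _ _ "insert_pow n (g i)"]) (simp_all add: h)
  have "incseq h"
    using inc by (auto simp: h_def incseq_def le_fun_def intro!: insert_pow_mono)
  have "insert_pow (Suc n) (\<lambda>\<mu>. SUP i. g i \<mu>) \<mu> = insert_op (\<lambda>\<mu>. SUP i. h i \<mu>) \<mu>"
    using Suc h by (auto intro!: insert_op_cong)
  also have "\<dots> = (SUP i. insert_op (h i) \<mu>)"
    using Suc \<open>incseq h\<close> by (intro insert_op_SUP) auto
  also have "\<dots> = (SUP i. insert_op (insert_pow n (g i)) \<mu>)"
    using Suc h by (intro SUP_cong refl insert_op_cong) auto
  finally show ?case by simp
qed simp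

text \<open>The grand canonical sum: each configuration of n points arises from n! orders of
  insertion, and 1/n! compensates for this.\<close>

definition total_weight :: "('a measure \<Rightarrow> ennreal) \<Rightarrow> ennreal" where
  "total_weight g = (\<Sum>n. ennreal (1 / fact n) * insert_pow n g (null_measure N))"

text \<open>As an integral over the counting measure on the natural numbers, the series inherits
  additivity and monotone convergence from \<open>nn_integral\<close>.\<close>

lemma total_weight_nn_integral:
  "total_weight g = (\<integral>\<^sup>+n. ennreal (1 / fact n) * insert_pow n g (null_measure N) \<partial>count_space UNIV)"
  by (simp add: total_weight_def nn_integral_count_space_nat)

lemma total_weight_cong:
  "(\<And>\<nu>. \<nu> \<in> counting_measures N (sets N) \<Longrightarrow> g \<nu> = g' \<nu>) \<Longrightarrow> total_weight g = total_weight g'"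
  using insert_pow_cong[OF null_measure_counting, of g g'] by (simp add: total_weight_def)

lemma total_weight_add:
  "g \<in> borel_measurable NN \<Longrightarrow> h \<in> borel_measurable NN \<Longrightarrow>
    total_weight (\<lambda>\<mu>. g \<mu> + h \<mu>) = total_weight g + total_weight h"
  unfolding total_weight_nn_integral
  by (simp add: insert_pow_add distrib_left nn_integral_add)

lemma total_weight_cmult:
  "g \<in> borel_measurable NN \<Longrightarrow> total_weight (\<lambda>\<mu>. c * g \<mu>) = c * total_weight g"
  unfolding total_weight_nn_integral
  by (simp add: insert_pow_cmult nn_integral_cmult mult.left_commute[of _ c])

lemma total_weight_zero [simp]: "total_weight (\<lambda>_. 0) = 0"
  using total_weight_cmult[of "\<lambda>_. 0" 0] by simp

lemma total_weight_SUP: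
  fixes g :: "nat \<Rightarrow> 'a measure \<Rightarrow> ennreal"
  assumes "\<And>i. g i \<in> borel_measurable NN" "incseq g"
  shows "total_weight (\<lambda>\<mu>. SUP i. g i \<mu>) = (SUP i. total_weight (g i))"
  unfolding total_weight_nn_integral insert_pow_SUP[OF assms null_measure_counting] SUP_mult_left_ennreal
  using assms
  by (intro nn_integral_monotone_convergence_SUP)
    (auto simp: incseq_def le_fun_def intro!: mult_left_mono insert_pow_mono)

definition weighted_measure :: "'a measure measure" where
  "weighted_measure = measure_of (space NN) (sets NN) (\<lambda>A. total_weight (indicator A))"

lemma space_weighted_measure [simp]: "space weighted_measure = counting_measures N (sets N)"
  using sets.space_closed[of NN] by (simp add: weighted_measure_def space_measure_of)

lemma sets_weighted_measure [simp, measurable_cong]: "sets weighted_measure = sets NN"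
  using sets.sets_measure_of_eq[of NN] by (simp add: weighted_measure_def)

lemma emeasure_weighted_measure:
  assumes "A \<in> sets NN"
  shows "emeasure weighted_measure A = total_weight (indicator A)"
  unfolding weighted_measure_def
proof (rule emeasure_measure_of_sigma)
  show "sigma_algebra (space NN) (sets NN)" ..
  have "(indicator {} :: 'a measure \<Rightarrow> ennreal) = (\<lambda>_. 0)"
    by (simp add: fun_eq_iff)
  then show "positive (sets NN) (\<lambda>A. total_weight (indicator A))"
    by (simp only: positive_def total_weight_zero)
  show "countably_additive (sets NN) (\<lambda>A. total_weight (indicator A))"
  proof (rule countably_additiveI)
    fix A :: "nat \<Rightarrow> _" assume A: "range A \<subseteq> sets NN" "disjoint_family A" "(\<Union>i. A i) \<in> sets NN"
    have A' [measurable]: "A i \<in> sets NN" for i using A by auto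
    define S where "S n \<mu> = (\<Sum>i<n. indicator (A i) \<mu> :: ennreal)" for n \<mu>
    have [measurable]: "S n \<in> borel_measurable NN" for n
      unfolding S_def[abs_def] by measurable
    have "total_weight (S n) = (\<Sum>i<n. total_weight (indicator (A i)))" for n
    proof (induct n)
      case 0
      show ?case
        by (simp add: S_def[abs_def])
    next
      case (Suc n)
      have "total_weight (S (Suc n)) = total_weight (\<lambda>\<mu>. S n \<mu> + indicator (A n) \<mu>)"
        by (simp add: S_def[abs_def])
      then show ?case
        using Suc by (simp add: total_weight_add)
    qed
    moreover have "incseq S"
      by (auto simp: S_def incseq_def le_fun_def intro!: sum_mono2)
    ultimately have "total_weight (\<lambda>\<mu>. SUP n. S n \<mu>) = (SUP n. \<Sum>i<n. total_weight (indicator (A i)))"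
      by (simp add: total_weight_SUP)
    moreover have "(SUP n. S n \<mu>) = indicator (\<Union>i. A i) \<mu>" for \<mu>
      unfolding S_def suminf_eq_SUP[symmetric] using A(2) by (rule suminf_indicator)
    ultimately show "(\<Sum>i. total_weight (indicator (A i))) = total_weight (indicator (\<Union>i. A i))"
      by (simp add: suminf_eq_SUP)
  qed
qed fact

lemma nn_integral_weighted_measure:
  assumes "g \<in> borel_measurable NN"
  shows "(\<integral>\<^sup>+\<mu>. g \<mu> \<partial>weighted_measure) = total_weight g"
  using assms
proof (induct rule: borel_measurable_induct)
  case (cong f g)
  then show ?case
    using total_weight_cong[of f g] nn_integral_cong[of weighted_measure f g] by simp
next
  case (set A)
  then show ?case
    by (simp add: emeasure_weighted_measure)
next
  case (mult u c)
  then show ?case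
    by (simp add: nn_integral_cmult total_weight_cmult)
next
  case (add u v)
  then show ?case
    by (simp add: nn_integral_add total_weight_add)
next
  case (seq U)
  then have "(\<integral>\<^sup>+\<mu>. (SUP i. U i \<mu>) \<partial>weighted_measure) = (SUP i. \<integral>\<^sup>+\<mu>. U i \<mu> \<partial>weighted_measure)"
    by (intro nn_integral_monotone_convergence_SUP) auto
  then show ?case
    using seq by (simp add: total_weight_SUP image_comp)
qed

section \<open>The Georgii-Nguyen-Zessin equation\<close>

definition point_sum :: "('a \<Rightarrow> 'a measure \<Rightarrow> ennreal) \<Rightarrow> 'a measure \<Rightarrow> ennreal" where
  "point_sum f \<mu> = (\<integral>\<^sup>+x. f x \<mu> \<partial>\<mu>)"

definition insert_sum :: "('a \<Rightarrow> 'a measure \<Rightarrow> ennreal) \<Rightarrow> 'a measure \<Rightarrow> ennreal" where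
  "insert_sum f \<mu> = (\<integral>\<^sup>+x. k x \<mu> * f x (\<mu> \<oplus>\<^sub>m return N x) \<partial>N)"

text \<open>\<open>insert_op\<close> acting on the second argument. It is what remains when a new
  point is inserted and the sum over points runs over the old ones.\<close>

definition insert_marked :: "('a \<Rightarrow> 'a measure \<Rightarrow> ennreal) \<Rightarrow> 'a \<Rightarrow> 'a measure \<Rightarrow> ennreal" where
  "insert_marked f x \<mu> = (\<integral>\<^sup>+y. k y \<mu> * f x (\<mu> \<oplus>\<^sub>m return N y) \<partial>N)"

lemma marked_measurable_comp:
  assumes "(\<lambda>(x, \<mu>). f x \<mu>) \<in> borel_measurable (N \<Otimes>\<^sub>M NN)" "a \<in> \<Omega> \<rightarrow>\<^sub>M N" "b \<in> \<Omega> \<rightarrow>\<^sub>M NN"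
  shows "(\<lambda>\<omega>. f (a \<omega>) (b \<omega>) :: ennreal) \<in> borel_measurable \<Omega>"
  using measurable_compose[OF measurable_Pair[OF assms(2,3)] assms(1)] by simp

lemma insert_marked_measurable:
  assumes f: "(\<lambda>(x, \<mu>). f x \<mu>) \<in> borel_measurable (N \<Otimes>\<^sub>M NN)"
  shows "(\<lambda>(x, \<mu>). insert_marked f x \<mu>) \<in> borel_measurable (N \<Otimes>\<^sub>M NN)"
proof -
  note [measurable] = marked_measurable_comp[OF f]
  show ?thesis
    unfolding insert_marked_def by measurable
qed

lemma insert_sum_measurable:
  assumes f: "(\<lambda>(x, \<mu>). f x \<mu>) \<in> borel_measurable (N \<Otimes>\<^sub>M NN)"
  shows "insert_sum f \<in> borel_measurable NN"
proof -
  note [measurable] = marked_measurable_comp[OF f]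
  show ?thesis
    unfolding insert_sum_def[abs_def] by measurable
qed

lemma point_sum_measurable:
  assumes f: "(\<lambda>(x, \<mu>). f x \<mu>) \<in> borel_measurable (N \<Otimes>\<^sub>M NN)"
  shows "point_sum f \<in> borel_measurable NN"
proof -
  note [measurable] = marked_measurable_comp[OF f]
  have "(\<lambda>\<mu>. \<integral>\<^sup>+x. (\<lambda>(\<mu>, x). f x \<mu>) (\<mu>, x) \<partial>\<mu>) \<in> borel_measurable NN"
    by (rule nn_integral_counting_measurable[where M=N]) (auto simp: split_beta')
  then show ?thesis
    unfolding point_sum_def[abs_def] by simp
qed

text \<open>A Leibniz rule: after the insertion of y, the point picked by the sum is either an old
  one, which gives \<open>insert_marked\<close>, or y itself, which gives
  \<open>insert_sum\<close>.\<close>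

lemma insert_op_point_sum:
  assumes f: "(\<lambda>(x, \<mu>). f x \<mu>) \<in> borel_measurable (N \<Otimes>\<^sub>M NN)" and \<mu>: "\<mu> \<in> counting_measures N (sets N)"
  shows "insert_op (point_sum f) \<mu> = point_sum (insert_marked f) \<mu> + insert_sum f \<mu>"
proof -
  note [measurable] = marked_measurable_comp[OF f]
  have [measurable]: "\<mu> \<in> space NN" using \<mu> by simp
  have s [measurable_cong]: "sets \<mu> = sets N"
    using \<mu> by (simp add: counting_measures_def)
  interpret \<mu>: finite_measure \<mu>
    using \<mu> by (rule fin_counting_finite)
  interpret P: pair_sigma_finite N \<mu> ..
  have "insert_op (point_sum f) \<mu> =
    (\<integral>\<^sup>+y. (\<integral>\<^sup>+x. k y \<mu> * f x (\<mu> \<oplus>\<^sub>m return N y) \<partial>\<mu>) + k y \<mu> * f y (\<mu> \<oplus>\<^sub>m return N y) \<partial>N)"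
    unfolding insert_op_def point_sum_def
  proof (rule nn_integral_cong)
    fix y assume y [measurable]: "y \<in> space N"
    have "(\<integral>\<^sup>+x. f x (\<mu> \<oplus>\<^sub>m return N y) \<partial>(\<mu> \<oplus>\<^sub>m return N y)) =
      (\<integral>\<^sup>+x. f x (\<mu> \<oplus>\<^sub>m return N y) \<partial>\<mu>) + f y (\<mu> \<oplus>\<^sub>m return N y)"
      using s y by (simp add: nn_integral_add_measure nn_integral_return)
    then show "k y \<mu> * (\<integral>\<^sup>+x. f x (\<mu> \<oplus>\<^sub>m return N y) \<partial>(\<mu> \<oplus>\<^sub>m return N y)) =
      (\<integral>\<^sup>+x. k y \<mu> * f x (\<mu> \<oplus>\<^sub>m return N y) \<partial>\<mu>) + k y \<mu> * f y (\<mu> \<oplus>\<^sub>m return N y)"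
      by (simp add: distrib_left nn_integral_cmult)
  qed
  also have "\<dots> = (\<integral>\<^sup>+y. (\<integral>\<^sup>+x. k y \<mu> * f x (\<mu> \<oplus>\<^sub>m return N y) \<partial>\<mu>) \<partial>N) + insert_sum f \<mu>"
    unfolding insert_sum_def by (rule nn_integral_add) measurable
  also have "(\<integral>\<^sup>+y. (\<integral>\<^sup>+x. k y \<mu> * f x (\<mu> \<oplus>\<^sub>m return N y) \<partial>\<mu>) \<partial>N) = point_sum (insert_marked f) \<mu>"
    unfolding point_sum_def insert_marked_def by (rule P.Fubini'[symmetric]) measurable
  finally show ?thesis .
qed

text \<open>Both sides insert one marked and one unmarked point. The cocycle property makes the
  weight independent of the order, and Fubini's theorem exchanges the integrals.\<close>

lemma insert_op_insert_sum:
  assumes f: "(\<lambda>(x, \<mu>). f x \<mu>) \<in> borel_measurable (N \<Otimes>\<^sub>M NN)" and \<mu>: "\<mu> \<in> counting_measures N (sets N)"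
  shows "insert_sum (insert_marked f) \<mu> = insert_op (insert_sum f) \<mu>"
proof -
  note [measurable] = marked_measurable_comp[OF f]
  have [measurable]: "\<mu> \<in> space NN" using \<mu> by simp
  have s: "sets \<mu> = sets N"
    using \<mu> by (simp add: counting_measures_def)
  interpret P: pair_sigma_finite N N ..
  have "insert_sum (insert_marked f) \<mu> =
    (\<integral>\<^sup>+x. (\<integral>\<^sup>+y. k x \<mu> * (k y (\<mu> \<oplus>\<^sub>m return N x) * f x (\<mu> \<oplus>\<^sub>m return N x \<oplus>\<^sub>m return N y)) \<partial>N) \<partial>N)"
    unfolding insert_sum_def insert_marked_def
    by (intro nn_integral_cong nn_integral_cmult[symmetric]) measurable
  also have "\<dots> = (\<integral>\<^sup>+x. (\<integral>\<^sup>+y. k y \<mu> * (k x (\<mu> \<oplus>\<^sub>m return N y) * f x (\<mu> \<oplus>\<^sub>m return N y \<oplus>\<^sub>m return N x)) \<partial>N) \<partial>N)"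
    using \<mu> add_measure_right_commute[OF s]
    by (intro nn_integral_cong) (simp add: mult.assoc[symmetric] cocycle)
  also have "\<dots> = (\<integral>\<^sup>+y. (\<integral>\<^sup>+x. k y \<mu> * (k x (\<mu> \<oplus>\<^sub>m return N y) * f x (\<mu> \<oplus>\<^sub>m return N y \<oplus>\<^sub>m return N x)) \<partial>N) \<partial>N)"
    by (rule P.Fubini') measurable
  also have "\<dots> = insert_op (insert_sum f) \<mu>"
    unfolding insert_sum_def insert_op_def
    by (intro nn_integral_cong nn_integral_cmult) measurable
  finally show ?thesis .
qed

text \<open>By iteration of the Leibniz rule, the picked point is an old one or one of the n + 1
  inserted ones. By commutation it may be taken to be inserted last, so these n + 1 cases contribute
  equally. \<open>f\<close> varies in the induction because a step replaces it by
  \<open>insert_marked f\<close>.\<close>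

lemma insert_pow_point_sum:
  assumes f: "(\<lambda>(x, \<mu>). f x \<mu>) \<in> borel_measurable (N \<Otimes>\<^sub>M NN)" and \<mu>: "\<mu> \<in> counting_measures N (sets N)"
  shows "insert_pow (Suc n) (point_sum f) \<mu> =
    point_sum ((insert_marked ^^ Suc n) f) \<mu> + of_nat (Suc n) * insert_pow n (insert_sum f) \<mu>"
  using f
proof (induct n arbitrary: f)
  case 0
  then show ?case
    using insert_op_point_sum[OF _ \<mu>] by simp
next
  case (Suc n)
  have m: "(\<lambda>(x, \<mu>). insert_marked f x \<mu>) \<in> borel_measurable (N \<Otimes>\<^sub>M NN)"
    using Suc(2) by (rule insert_marked_measurable)
  have "insert_pow (Suc (Suc n)) (point_sum f) \<mu> = insert_pow (Suc n) (insert_op (point_sum f)) \<mu>"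
    by (simp only: funpow_Suc_right o_apply)
  also have "\<dots> = insert_pow (Suc n) (\<lambda>\<mu>. point_sum (insert_marked f) \<mu> + insert_sum f \<mu>) \<mu>"
    using Suc(2) by (intro insert_pow_cong \<mu> insert_op_point_sum)
  also have "\<dots> = insert_pow (Suc n) (point_sum (insert_marked f)) \<mu> + insert_pow (Suc n) (insert_sum f) \<mu>"
    by (intro insert_pow_add \<mu> point_sum_measurable insert_sum_measurable m Suc(2))
  also have "insert_pow (Suc n) (point_sum (insert_marked f)) \<mu> =
    point_sum ((insert_marked ^^ Suc (Suc n)) f) \<mu> + of_nat (Suc n) * insert_pow n (insert_sum (insert_marked f)) \<mu>"
    unfolding Suc(1)[OF m] by (simp only: funpow_Suc_right o_apply)
  also have "insert_pow n (insert_sum (insert_marked f)) \<mu> = insert_pow n (insert_op (insert_sum f)) \<mu>"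
    using Suc(2) by (intro insert_pow_cong \<mu> insert_op_insert_sum)
  also have "\<dots> = insert_pow (Suc n) (insert_sum f) \<mu>"
    by (simp only: funpow_Suc_right o_apply)
  finally show ?case
    by (simp add: distrib_right add.assoc add.commute)
qed

text \<open>The null measure has no old points, so only the n + 1 equal contributions remain; the
  factor n + 1 turns 1/(n+1)! into 1/n!.\<close>

theorem total_weight_GNZ:
  assumes f: "(\<lambda>(x, \<mu>). f x \<mu>) \<in> borel_measurable (N \<Otimes>\<^sub>M NN)"
  shows "total_weight (point_sum f) = total_weight (insert_sum f)"
proof -
  have "ennreal (1 / fact (Suc n)) * insert_pow (Suc n) (point_sum f) (null_measure N) =
    ennreal (1 / fact n) * insert_pow n (insert_sum f) (null_measure N)" for n
  proof -
    have "ennreal (1 / fact (Suc n)) * of_nat (Suc n) = ennreal (1 / fact n)"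
      unfolding ennreal_of_nat_eq_real_of_nat by (subst ennreal_mult'[symmetric]) (simp_all add: fact_Suc del: of_nat_Suc)
    then have "ennreal (1 / fact (Suc n)) * (of_nat (Suc n) * insert_pow n (insert_sum f) (null_measure N)) =
      ennreal (1 / fact n) * insert_pow n (insert_sum f) (null_measure N)"
      by (metis mult.assoc)
    moreover have "insert_pow (Suc n) (point_sum f) (null_measure N) =
      of_nat (Suc n) * insert_pow n (insert_sum f) (null_measure N)"
      unfolding insert_pow_point_sum[OF f null_measure_counting] by (simp add: point_sum_def)
    ultimately show ?thesis by simp
  qed
  moreover have "point_sum f (null_measure N) = 0"
    by (simp add: point_sum_def)
  ultimately show ?thesis
    unfolding total_weight_def
    by (subst suminf_offset[of _ 1]) (simp_all del: funpow.simps fact_Suc)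
qed

end

section \<open>Finite Poisson processes\<close>

lemma ennreal_exp_series:
  assumes "0 \<le> a"
  shows "(\<Sum>n. ennreal (1 / fact n) * ennreal a ^ n) = ennreal (exp a)"
proof -
  have "(\<Sum>n. ennreal (1 / fact n) * ennreal a ^ n) = (\<Sum>n. ennreal (a ^ n /\<^sub>R fact n))"
    using assms by (simp add: ennreal_power field_simps flip: ennreal_mult')
  also have "\<dots> = ennreal (\<Sum>n. a ^ n /\<^sub>R fact n)"
    using assms summable_exp_generic[of a] by (intro suminf_ennreal2) auto
  finally show ?thesis
    by (simp add: exp_def)
qed

locale poisson_insertion = N: sigma_finite_measure N
  for N :: "'a measure" +
  fixes B :: "'a set"
  assumes B [measurable]: "B \<in> sets N" and B_finite: "emeasure N B \<noteq> \<infinity>"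
begin

text \<open>A weight that does not depend on the configuration satisfies the cocycle property
  trivially. This one produces the Poisson process whose intensity is \<open>N\<close> restricted to
  \<open>B\<close>, and the Mecke equation becomes a case of
  \<open>total_weight_GNZ\<close>.\<close>

sublocale weighted_insertion N "\<lambda>x \<mu>. indicator B x"
  by unfold_locales (auto simp: mult.commute)

lemma emeasure_B: "C \<in> sets N \<Longrightarrow> emeasure N (B \<inter> C) = ennreal (measure N (B \<inter> C))"
  using B_finite emeasure_mono[of "B \<inter> C" B N]
  by (intro emeasure_eq_ennreal_measure) (auto simp: top_unique)

text \<open>Every inserted point has to avoid \<open>C\<close>, hence to lie in
  \<open>B - C\<close>.\<close>

lemma insert_pow_void:
  assumes C [measurable]: "C \<in> sets N" and \<mu>: "\<mu> \<in> counting_measures N (sets N)"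
  shows "insert_pow n (\<lambda>\<mu>. of_bool (emeasure \<mu> C = 0)) \<mu> = of_bool (emeasure \<mu> C = 0) * emeasure N (B - C) ^ n"
  using \<mu>
proof (induct n arbitrary: \<mu>)
  case (Suc n)
  have s: "sets \<mu> = sets N"
    using Suc(2) by (simp add: counting_measures_def)
  have "insert_pow (Suc n) (\<lambda>\<mu>. of_bool (emeasure \<mu> C = 0)) \<mu> =
    insert_op (\<lambda>\<mu>. of_bool (emeasure \<mu> C = 0) * emeasure N (B - C) ^ n) \<mu>"
    using Suc by (auto intro!: insert_op_cong)
  also have "\<dots> = (\<integral>\<^sup>+x. of_bool (emeasure \<mu> C = 0) * emeasure N (B - C) ^ n * indicator (B - C) x \<partial>N)"
    unfolding insert_op_def using s
    by (intro nn_integral_cong) (auto simp: emeasure_add_measure split: split_indicator)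
  also have "\<dots> = of_bool (emeasure \<mu> C = 0) * emeasure N (B - C) ^ n * (\<integral>\<^sup>+x. indicator (B - C) x \<partial>N)"
    by (rule nn_integral_cmult) measurable
  finally show ?case
    by (simp add: ac_simps)
qed simp

definition poisson_measure :: "'a measure measure" where
  "poisson_measure = scale_measure (ennreal (exp (- measure N B))) weighted_measure"

lemma sets_poisson_measure [simp, measurable_cong]: "sets poisson_measure = sets NN"
  by (simp add: poisson_measure_def)

lemma space_poisson_measure [simp]: "space poisson_measure = counting_measures N (sets N)"
  by (simp add: poisson_measure_def space_scale_measure)

lemma nn_integral_poisson_measure:
  assumes g [measurable]: "g \<in> borel_measurable NN"
  shows "(\<integral>\<^sup>+\<mu>. g \<mu> \<partial>poisson_measure) = ennreal (exp (- measure N B)) * total_weight g"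
proof -
  have "g \<in> borel_measurable weighted_measure"
    by measurable
  then show ?thesis
    unfolding poisson_measure_def by (simp add: nn_integral_scale_measure nn_integral_weighted_measure[OF g])
qed

lemma poisson_void:
  assumes C [measurable]: "C \<in> sets N"
  shows "emeasure poisson_measure {\<mu>\<in>space NN. emeasure \<mu> C = 0} = ennreal (exp (- measure N (B \<inter> C)))"
proof -
  have m [measurable]: "(\<lambda>\<mu>. emeasure \<mu> C) \<in> borel_measurable NN"
    using C by (rule measurable_emeasure_counting_algebra)
  have D: "emeasure N (B - C) = ennreal (measure N (B - C))"
  proof -
    have "B - C = B \<inter> (space N - C)"
      using sets.sets_into_space[OF B] by auto
    then show ?thesis
      using emeasure_B[of "space N - C"] by simp
  qed
  have "emeasure poisson_measure {\<mu>\<in>space NN. emeasure \<mu> C = 0} =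
    (\<integral>\<^sup>+\<mu>. indicator {\<mu>\<in>space NN. emeasure \<mu> C = 0} \<mu> \<partial>poisson_measure)"
    by (rule nn_integral_indicator[symmetric]) measurable
  also have "\<dots> = (\<integral>\<^sup>+\<mu>. of_bool (emeasure \<mu> C = 0) \<partial>poisson_measure)"
    by (intro nn_integral_cong) (auto split: split_indicator)
  also have "\<dots> = ennreal (exp (- measure N B)) * total_weight (\<lambda>\<mu>. of_bool (emeasure \<mu> C = 0))"
    by (rule nn_integral_poisson_measure) measurable
  also have "total_weight (\<lambda>\<mu>. of_bool (emeasure \<mu> C = 0)) = ennreal (exp (measure N (B - C)))"
    unfolding total_weight_def insert_pow_void[OF C null_measure_counting]
    by (simp add: D ennreal_exp_series)
  also have "ennreal (exp (- measure N B)) * \<dots> = ennreal (exp (measure N (B - C) - measure N B))"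
    by (simp add: exp_diff exp_minus field_simps flip: ennreal_mult')
  also have "measure N (B - C) - measure N B = - measure N (B \<inter> C)"
    using B_finite measure_Diff[of N B "B \<inter> C"] by (simp add: Diff_Int)
  finally show ?thesis .
qed

lemma prob_space_poisson_measure: "prob_space poisson_measure"
proof
  have "emeasure poisson_measure {\<mu>\<in>space NN. emeasure \<mu> {} = 0} = 1"
    using poisson_void[of "{}"] by simp
  then show "emeasure poisson_measure (space poisson_measure) = 1"
    by simp
qed

theorem poisson_mecke:
  assumes f: "(\<lambda>(x, \<mu>). f x \<mu>) \<in> borel_measurable (N \<Otimes>\<^sub>M NN)"
  shows "(\<integral>\<^sup>+\<mu>. (\<integral>\<^sup>+x. f x \<mu> \<partial>\<mu>) \<partial>poisson_measure) =
    (\<integral>\<^sup>+\<mu>. (\<integral>\<^sup>+x. indicator B x * f x (\<mu> \<oplus>\<^sub>m return N x) \<partial>N) \<partial>poisson_measure)"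
  unfolding point_sum_def[symmetric] insert_sum_def[symmetric]
  using nn_integral_poisson_measure[OF point_sum_measurable[OF f]]
    nn_integral_poisson_measure[OF insert_sum_measurable[OF f]] total_weight_GNZ[OF f]
  by (simp only:)

text \<open>Induction on the total count. The Mecke equation for the indicator of C_i times that of
  the event gives n_i P(n) = N(B \<inter> C_i) P(n - e_i), the recursion of a product of Poisson
  weights; the case of all counts zero is the void probability of the union.\<close>

lemma poisson_joint:
  assumes J: "finite J" and C: "\<And>j. j \<in> J \<Longrightarrow> C j \<in> sets N" "disjoint_family_on C J"
  shows "emeasure poisson_measure {\<mu>\<in>space NN. \<forall>j\<in>J. emeasure \<mu> (C j) = of_nat (n j)} =
    (\<Prod>j\<in>J. ennreal (measure N (B \<inter> C j) ^ n j / fact (n j) * exp (- measure N (B \<inter> C j))))"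
  (is "?q n = (\<Prod>j\<in>J. ?p j (n j))")
proof (induct "\<Sum>j\<in>J. n j" arbitrary: n)
  note C(1)[measurable] J[measurable]
  have ev [measurable]: "j \<in> J \<Longrightarrow> (\<lambda>\<mu>. emeasure \<mu> (C j)) \<in> borel_measurable NN" for j
    using C(1) by (intro measurable_emeasure_counting_algebra) auto
  case 0
  have UN: "(\<Union>j\<in>J. C j) \<in> sets N"
    using J C(1) by auto
  have "{\<mu>\<in>space NN. \<forall>j\<in>J. emeasure \<mu> (C j) = of_nat (n j)} = {\<mu>\<in>space NN. emeasure \<mu> (\<Union>j\<in>J. C j) = 0}"
  proof -
    have "(\<forall>j\<in>J. emeasure \<mu> (C j) = 0) \<longleftrightarrow> emeasure \<mu> (\<Union>j\<in>J. C j) = 0" if "\<mu> \<in> counting_measures N (sets N)" for \<mu>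
    proof -
      have "sets \<mu> = sets N"
        using that by (simp add: counting_measures_def)
      then have eq: "(\<Sum>j\<in>J. emeasure \<mu> (C j)) = emeasure \<mu> (\<Union>j\<in>J. C j)"
        using J C by (intro sum_emeasure image_subsetI) simp_all
      show ?thesis
        unfolding eq[symmetric] using J by simp
    qed
    moreover have "\<forall>j\<in>J. n j = 0"
      using 0 J by simp
    ultimately show ?thesis
      by (intro Collect_cong conj_cong refl) simp_all
  qed
  then have "?q n = ennreal (exp (- measure N (B \<inter> (\<Union>j\<in>J. C j))))"
    using poisson_void[OF UN] by simp
  also have "measure N (B \<inter> (\<Union>j\<in>J. C j)) = (\<Sum>j\<in>J. measure N (B \<inter> C j))"
    unfolding Int_UN_distrib
  proof (rule measure_finite_Union)
    show "disjoint_family_on (\<lambda>i. B \<inter> C i) J"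
      using C(2) by (auto simp: disjoint_family_on_def)
  qed (use J C(1) emeasure_B in auto)
  also have "ennreal (exp (- \<dots>)) = (\<Prod>j\<in>J. ennreal (exp (- measure N (B \<inter> C j))))"
    using J by (simp add: exp_sum prod_ennreal flip: sum_negf)
  also have "\<dots> = (\<Prod>j\<in>J. ?p j (n j))"
    using 0 J by (intro prod.cong) auto
  finally show ?case .
next
  have ev [measurable]: "j \<in> J \<Longrightarrow> (\<lambda>\<mu>. emeasure \<mu> (C j)) \<in> borel_measurable NN" for j
    using C(1) by (intro measurable_emeasure_counting_algebra) auto
  case (Suc m)
  have "\<exists>i\<in>J. n i \<noteq> 0"
  proof (rule ccontr)
    assume "\<not> (\<exists>i\<in>J. n i \<noteq> 0)"
    then have "(\<Sum>j\<in>J. n j) = 0"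
      by simp
    with Suc(2) show False
      by simp
  qed
  then obtain i where i: "i \<in> J" "n i \<noteq> 0"
    by blast
  define n' where "n' = n(i := n i - 1)"
  have n: "n i = Suc (n' i)" "\<And>j. j \<noteq> i \<Longrightarrow> n j = n' j"
    using i by (auto simp: n'_def)
  have "(\<Sum>j\<in>J. n j) = Suc (\<Sum>j\<in>J. n' j)"
    using J i(1) n by (simp add: sum.remove[of J i])
  then have IH: "?q n' = (\<Prod>j\<in>J. ?p j (n' j))"
    using Suc by simp
  define E where "E n = {\<mu>\<in>space NN. \<forall>j\<in>J. emeasure \<mu> (C j) = of_nat (n j)}" for n :: "_ \<Rightarrow> nat"
  have E [measurable]: "E n \<in> sets NN" for n
    unfolding E_def using J by measurable
  have q: "?q n = emeasure poisson_measure (E n)" for n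
    by (simp add: E_def)
  note [measurable] = C(1)[OF i(1)]
  \<comment> \<open>Summed over the points of a configuration in the event, this gives
    \<open>n i\<close>; after the insertion of a point of \<open>C i\<close> it asks for the counts
    \<open>n'\<close>.\<close>
  let ?f = "\<lambda>x \<mu>. indicator (C i) x * indicator (E n) \<mu> :: ennreal"
  have "(\<integral>\<^sup>+\<mu>. (\<integral>\<^sup>+x. ?f x \<mu> \<partial>\<mu>) \<partial>poisson_measure) = (\<integral>\<^sup>+\<mu>. of_nat (n i) * indicator (E n) \<mu> \<partial>poisson_measure)"
  proof (rule nn_integral_cong)
    fix \<mu> assume "\<mu> \<in> space poisson_measure"
    then have "sets \<mu> = sets N"
      by (simp add: counting_measures_def)
    then show "(\<integral>\<^sup>+x. ?f x \<mu> \<partial>\<mu>) = of_nat (n i) * indicator (E n) \<mu>"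
      using i(1) by (auto simp: nn_integral_multc E_def split: split_indicator)
  qed
  also have "\<dots> = of_nat (n i) * ?q n"
    unfolding q by (rule nn_integral_cmult_indicator) simp
  finally have 1: "(\<integral>\<^sup>+\<mu>. (\<integral>\<^sup>+x. ?f x \<mu> \<partial>\<mu>) \<partial>poisson_measure) = of_nat (n i) * ?q n" .
  have "(\<integral>\<^sup>+\<mu>. (\<integral>\<^sup>+x. indicator B x * ?f x (\<mu> \<oplus>\<^sub>m return N x) \<partial>N) \<partial>poisson_measure) =
    (\<integral>\<^sup>+\<mu>. emeasure N (B \<inter> C i) * indicator (E n') \<mu> \<partial>poisson_measure)"
  proof (rule nn_integral_cong)
    fix \<mu> assume "\<mu> \<in> space poisson_measure"
    then have \<mu>: "\<mu> \<in> counting_measures N (sets N)"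
      by simp
    then have s: "sets \<mu> = sets N"
      by (rule counting_measuresD)
    have "(\<mu> \<oplus>\<^sub>m return N x \<in> E n) \<longleftrightarrow> \<mu> \<in> E n'" if x: "x \<in> C i" for x
    proof -
      have "emeasure (\<mu> \<oplus>\<^sub>m return N x) (C j) = of_nat (n j) \<longleftrightarrow> emeasure \<mu> (C j) = of_nat (n' j)" if j: "j \<in> J" for j
      proof (cases "j = i")
        case True
        then show ?thesis
          using C(1)[OF j] s x n(1) by (simp add: emeasure_add_measure add.commute[of _ "1::ennreal"] ennreal_add_left_cancel)
      next
        case False
        then have "x \<notin> C j"
          using C(2) x i(1) j unfolding disjoint_family_on_def by blast
        then show ?thesis
          using C(1)[OF j] s n(2)[OF False] by (simp add: emeasure_add_measure)
      qed
      then show ?thesis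
        using \<mu> by (auto simp: E_def)
    qed
    then have "(\<integral>\<^sup>+x. indicator B x * ?f x (\<mu> \<oplus>\<^sub>m return N x) \<partial>N) = (\<integral>\<^sup>+x. indicator (B \<inter> C i) x * indicator (E n') \<mu> \<partial>N)"
      by (intro nn_integral_cong) (auto split: split_indicator)
    then show "(\<integral>\<^sup>+x. indicator B x * ?f x (\<mu> \<oplus>\<^sub>m return N x) \<partial>N) = emeasure N (B \<inter> C i) * indicator (E n') \<mu>"
      by (simp add: nn_integral_multc)
  qed
  also have "\<dots> = emeasure N (B \<inter> C i) * ?q n'"
    unfolding q by (rule nn_integral_cmult_indicator) simp
  finally have "of_nat (n i) * ?q n = emeasure N (B \<inter> C i) * ?q n'"
    using poisson_mecke[of ?f] 1 by simp
  also have "\<dots> = ennreal (measure N (B \<inter> C i)) * ?p i (n' i) * (\<Prod>j\<in>J - {i}. ?p j (n' j))"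
    unfolding IH using i J C(1) by (simp add: emeasure_B prod.remove[of J i] mult.assoc)
  also have "(\<Prod>j\<in>J - {i}. ?p j (n' j)) = (\<Prod>j\<in>J - {i}. ?p j (n j))"
    using n(2) by (intro prod.cong) auto
  also have "ennreal (measure N (B \<inter> C i)) * ?p i (n' i) = ennreal (real (n i) * (measure N (B \<inter> C i) ^ n i / fact (n i) * exp (- measure N (B \<inter> C i))))"
    unfolding n(1) by (subst ennreal_mult'[symmetric]) (simp_all add: fact_Suc del: of_nat_Suc)
  also have "\<dots> = of_nat (n i) * ?p i (n i)"
    by (subst ennreal_mult') (simp_all add: ennreal_of_nat_eq_real_of_nat)
  also have "of_nat (n i) * ?p i (n i) * (\<Prod>j\<in>J - {i}. ?p j (n j)) = of_nat (n i) * (\<Prod>j\<in>J. ?p j (n j))"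
    using i J by (simp add: prod.remove[of J i] mult.assoc)
  finally show ?case
    using i(2) by (simp add: ennreal_mult_cancel_left)
qed

end

text \<open>The events that X_i takes a given integer value generate its sigma-field, because there
  are countably many values. Together with the empty set they are closed under intersection, so the
  product formula for them is enough.\<close>

lemma (in prob_space) indep_vars_nat_valued:
  fixes X :: "'i \<Rightarrow> 'a \<Rightarrow> ennreal"
  assumes X [measurable]: "\<And>i. i \<in> I \<Longrightarrow> X i \<in> borel_measurable M"
    and nat: "\<And>i \<omega>. i \<in> I \<Longrightarrow> \<omega> \<in> space M \<Longrightarrow> X i \<omega> \<in> range of_nat"
    and prod: "\<And>J n. J \<subseteq> I \<Longrightarrow> finite J \<Longrightarrow> prob {\<omega>\<in>space M. \<forall>j\<in>J. X j \<omega> = of_nat (n j)} =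
      (\<Prod>j\<in>J. prob {\<omega>\<in>space M. X j \<omega> = of_nat (n j)})"
  shows "indep_vars (\<lambda>_. borel) X I"
proof -
  define E where "E i = insert {} (range (\<lambda>n. {\<omega>\<in>space M. X i \<omega> = of_nat n}))" for i
  have sub: "E i \<subseteq> events" if "i \<in> I" for i
    using X[OF that] by (auto simp: E_def)
  have "indep_sets E I"
  proof (rule indep_setsI[OF sub])
    fix A J assume J: "J \<noteq> {}" "J \<subseteq> I" "finite J" "\<forall>j\<in>J. A j \<in> E j"
    show "prob (\<Inter>j\<in>J. A j) = (\<Prod>j\<in>J. prob (A j))"
    proof (cases "\<exists>j\<in>J. A j = {}")
      case True
      then obtain j where "j \<in> J" "A j = {}" by auto
      then have "(\<Inter>j\<in>J. A j) = {}" "(\<Prod>j\<in>J. prob (A j)) = 0"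
        using J by (auto intro!: bexI[of _ j])
      then show ?thesis by simp
    next
      case False
      then have "\<forall>j\<in>J. \<exists>n. A j = {\<omega>\<in>space M. X j \<omega> = of_nat n}"
        using J(4) unfolding E_def by blast
      then obtain n where n: "\<And>j. j \<in> J \<Longrightarrow> A j = {\<omega>\<in>space M. X j \<omega> = of_nat (n j)}"
        by metis
      then have "(\<Inter>j\<in>J. A j) = {\<omega>\<in>space M. \<forall>j\<in>J. X j \<omega> = of_nat (n j)}"
        using J(1) by auto
      then show ?thesis
        using prod[OF J(2,3), of n] n by simp
    qed
  qed
  moreover have "Int_stable (E i)" for i
    unfolding Int_stable_def
  proof (intro ballI)
    fix a b assume "a \<in> E i" "b \<in> E i"
    then consider "a = {} \<or> b = {}" | n m where "a = {\<omega>\<in>space M. X i \<omega> = of_nat n}" "b = {\<omega>\<in>space M. X i \<omega> = of_nat m}"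
      by (auto simp: E_def)
    then show "a \<inter> b \<in> E i"
    proof cases
      case 2
      then have "a \<inter> b = (if n = m then a else {})"
        by auto
      then show ?thesis
        using \<open>a \<in> E i\<close> by (simp add: E_def)
    qed (auto simp: E_def)
  qed
  ultimately have *: "indep_sets (\<lambda>i. sigma_sets (space M) (E i)) I"
    by (rule indep_sets_sigma)
  have "indep_sets (\<lambda>i. {X i -` A \<inter> space M | A. A \<in> sets borel}) I"
  proof (rule indep_sets_mono_sets[OF *], safe)
    fix i and A :: "ennreal set" assume i: "i \<in> I"
    have "X i -` A \<inter> space M = (\<Union>n\<in>{n::nat. of_nat n \<in> A}. {\<omega>\<in>space M. X i \<omega> = of_nat n})"
      using nat[OF i] by fastforce
    also have "\<dots> \<in> sigma_sets (space M) (E i)"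
    proof -
      interpret S: sigma_algebra "space M" "sigma_sets (space M) (E i)"
        using order_trans[OF sub[OF i] sets.space_closed] by (rule sigma_algebra_sigma_sets)
      show ?thesis
        by (intro S.countable_UN'' countableI_type sigma_sets.Basic) (auto simp: E_def)
    qed
    finally show "X i -` A \<inter> space M \<in> sigma_sets (space M) (E i)" .
  qed
  then show ?thesis
    using X unfolding indep_vars_def2 by auto
qed

lemma emeasure_vimage_nat_valued:
  fixes X :: "'w \<Rightarrow> ennreal"
  assumes [measurable]: "X \<in> borel_measurable P" and nat: "\<And>\<omega>. \<omega> \<in> space P \<Longrightarrow> X \<omega> \<in> range of_nat"
  shows "emeasure P (X -` A \<inter> space P) = (\<Sum>n. indicator A (of_nat n :: ennreal) * emeasure P {\<omega>\<in>space P. X \<omega> = of_nat n})"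
proof -
  let ?E = "\<lambda>n. if of_nat n \<in> A then {\<omega>\<in>space P. X \<omega> = of_nat n} else {}"
  have "X -` A \<inter> space P = (\<Union>n. ?E n)"
  proof (intro equalityI subsetI)
    fix \<omega> assume \<omega>: "\<omega> \<in> X -` A \<inter> space P"
    then obtain n where "X \<omega> = of_nat n"
      using nat by auto
    then show "\<omega> \<in> (\<Union>n. ?E n)"
      using \<omega> by (intro UN_I[of n]) auto
  qed (auto split: if_splits)
  moreover have "disjoint_family ?E"
    by (auto simp: disjoint_family_on_def)
  moreover have "range ?E \<subseteq> sets P"
    by auto
  ultimately have "emeasure P (X -` A \<inter> space P) = (\<Sum>n. emeasure P (?E n))"
    using suminf_emeasure[of ?E P] by simp
  also have "\<dots> = (\<Sum>n. indicator A (of_nat n :: ennreal) * emeasure P {\<omega>\<in>space P. X \<omega> = of_nat n})"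
    by (intro suminf_cong) auto
  finally show ?thesis .
qed

lemma distr_nat_valued_eqI:
  fixes X :: "'w \<Rightarrow> ennreal" and Y :: "'v \<Rightarrow> ennreal"
  assumes X: "X \<in> borel_measurable P" and Y: "Y \<in> borel_measurable Q"
    and nat: "\<And>\<omega>. \<omega> \<in> space P \<Longrightarrow> X \<omega> \<in> range of_nat" "\<And>\<omega>. \<omega> \<in> space Q \<Longrightarrow> Y \<omega> \<in> range of_nat"
    and eq: "\<And>n. emeasure P {\<omega>\<in>space P. X \<omega> = of_nat n} = emeasure Q {\<omega>\<in>space Q. Y \<omega> = of_nat n}"
  shows "distr P borel X = distr Q borel Y"
proof (rule measure_eqI)
  fix A :: "ennreal set" assume "A \<in> sets (distr P borel X)"
  then show "emeasure (distr P borel X) A = emeasure (distr Q borel Y) A"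
    using emeasure_vimage_nat_valued[OF X nat(1), of A] emeasure_vimage_nat_valued[OF Y nat(2), of A] X Y
    by (simp add: emeasure_distr eq)
qed simp

lemma (in poisson_insertion) poisson_process_poisson_measure:
  "poisson_process poisson_measure NN (restrict_to N B) (\<lambda>\<mu>. \<mu>)"
proof -
  interpret P: prob_space poisson_measure
    by (rule prob_space_poisson_measure)
  have m: "measure (restrict_to N B) C = measure N (B \<inter> C)" if "C \<in> sets N" for C
    using that B by (simp add: measure_def emeasure_restrict_to Int_commute)
  have f: "emeasure (restrict_to N B) C \<noteq> \<infinity>" if "C \<in> sets N" for C
    using that B emeasure_B[OF that] by (simp add: emeasure_restrict_to Int_commute)
  have id: "(\<lambda>\<mu>. \<mu>) \<in> poisson_measure \<rightarrow>\<^sub>M NN"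
    by measurable
  have joint: "P.prob {\<mu>\<in>space NN. \<forall>j\<in>J. emeasure \<mu> (C j) = of_nat (n j)} =
    (\<Prod>j\<in>J. measure N (B \<inter> C j) ^ n j / fact (n j) * exp (- measure N (B \<inter> C j)))"
    if "finite J" "\<And>j. j \<in> J \<Longrightarrow> C j \<in> sets N" "disjoint_family_on C J" for J :: "nat set" and C n
    using poisson_joint[of J C n] that by (simp add: P.emeasure_eq_measure prod_ennreal prod_nonneg)
  have single: "P.prob {\<mu>\<in>space NN. emeasure \<mu> C = of_nat n} =
    measure N (B \<inter> C) ^ n / fact n * exp (- measure N (B \<inter> C))" if "C \<in> sets N" for C n
    using joint[of "{0}" "\<lambda>_. C" "\<lambda>_. n"] that by (simp add: disjoint_family_on_def)
  have "P.indep_vars (\<lambda>_. borel) (\<lambda>i \<mu>. emeasure \<mu> (C i)) {..<n}"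
    if C: "\<forall>i<n. C i \<in> sets N" and disj: "disjoint_family_on C {..<n}" for n :: nat and C
  proof (rule P.indep_vars_nat_valued)
    show "(\<lambda>\<mu>. emeasure \<mu> (C i)) \<in> borel_measurable poisson_measure" if "i \<in> {..<n}" for i
      unfolding measurable_cong_sets[OF sets_poisson_measure refl]
      using that C by (intro measurable_emeasure_counting_algebra) auto
    show "emeasure \<mu> (C i) \<in> range of_nat" if "i \<in> {..<n}" "\<mu> \<in> space poisson_measure" for i \<mu>
      using that C by (auto simp: counting_measures_def)
    fix J and m :: "nat \<Rightarrow> nat" assume J: "J \<subseteq> {..<n}" "finite J"
    then have "P.prob {\<mu>\<in>space NN. \<forall>j\<in>J. emeasure \<mu> (C j) = of_nat (m j)} =
      (\<Prod>j\<in>J. measure N (B \<inter> C j) ^ m j / fact (m j) * exp (- measure N (B \<inter> C j)))"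
      using C disjoint_family_on_mono[OF J(1) disj] by (intro joint) auto
    also have "\<dots> = (\<Prod>j\<in>J. P.prob {\<mu>\<in>space NN. emeasure \<mu> (C j) = of_nat (m j)})"
      using J C by (intro prod.cong refl single[symmetric]) auto
    finally show "P.prob {\<mu>\<in>space poisson_measure. \<forall>j\<in>J. emeasure \<mu> (C j) = of_nat (m j)} =
      (\<Prod>j\<in>J. P.prob {\<mu>\<in>space poisson_measure. emeasure \<mu> (C j) = of_nat (m j)})"
      by simp
  qed
  then show ?thesis
    unfolding poisson_process_def using single f id P.prob_space_axioms by (simp add: m)
qed

section \<open>Uniqueness in law of a finite Poisson process\<close>

lemma poisson_process_joint_distr:
  fixes n :: nat
  assumes pp: "poisson_process P (fin_counting M) \<nu> \<xi>" and s: "sets \<nu> = sets M"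
    and D: "\<And>i. i < n \<Longrightarrow> D i \<in> sets M" "disjoint_family_on D {..<n}" and n: "n \<noteq> 0"
  shows "distr P (\<Pi>\<^sub>M i\<in>{..<n}. borel) (\<lambda>\<omega>. \<lambda>i\<in>{..<n}. emeasure (\<xi> \<omega>) (D i)) =
    (\<Pi>\<^sub>M i\<in>{..<n}. distr P borel (\<lambda>\<omega>. emeasure (\<xi> \<omega>) (D i)))"
proof -
  interpret prob_space P
    using pp by (simp add: poisson_process_def)
  have \<xi>: "\<xi> \<in> P \<rightarrow>\<^sub>M fin_counting M"
    using pp by (simp add: poisson_process_def)
  have "indep_vars (\<lambda>_. borel) (\<lambda>i \<omega>. emeasure (\<xi> \<omega>) (D i)) {..<n}"
    using pp[unfolded poisson_process_def, THEN conjunct2, THEN conjunct2, THEN conjunct2, THEN conjunct2,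
      THEN spec[of _ n], THEN spec[of _ D]] s D by simp
  moreover have "(\<lambda>\<omega>. emeasure (\<xi> \<omega>) (D i)) \<in> borel_measurable P" if "i \<in> {..<n}" for i
    using that D(1) by (intro measurable_compose[OF \<xi> measurable_emeasure_counting_algebra]) simp
  ultimately show ?thesis
    using n by (subst indep_vars_iff_distr_eq_PiM'[symmetric]) auto
qed

text \<open>A set of pairs instead of a function: one set may be paired with two different counts,
  so that the intersection of two events is always the event of the union of their index
  sets.\<close>

definition counting_event :: "'a measure \<Rightarrow> ('a set \<times> nat) set \<Rightarrow> 'a measure set" where
  "counting_event M F = {\<mu>\<in>counting_measures M (sets M). \<forall>z\<in>F. emeasure \<mu> (fst z) = of_nat (snd z)}"

lemma counting_event_sets:
  assumes F: "finite F" "fst ` F \<subseteq> sets M"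
  shows "counting_event M F \<in> sets (fin_counting M)"
proof -
  have [measurable]: "z \<in> F \<Longrightarrow> (\<lambda>\<mu>. emeasure \<mu> (fst z)) \<in> borel_measurable (fin_counting M)" for z
    using F by (intro measurable_emeasure_counting_algebra) auto
  have "{\<mu>\<in>space (fin_counting M). \<forall>z\<in>F. emeasure \<mu> (fst z) = of_nat (snd z)} \<in> sets (fin_counting M)"
    using F(1) by measurable
  then show ?thesis
    by (simp add: counting_event_def)
qed

text \<open>Since an evaluation takes integer values, the preimage of any set under it is a
  countable union of events from the generator.\<close>

lemma sets_fin_counting_generated:
  "sets (fin_counting M) =
    sigma_sets (counting_measures M (sets M)) {counting_event M F | F. finite F \<and> fst ` F \<subseteq> sets M}"
  (is "_ = sigma_sets ?\<Omega> ?E")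
proof
  have sub: "?E \<subseteq> Pow ?\<Omega>"
    by (auto simp: counting_event_def)
  show "sigma_sets ?\<Omega> ?E \<subseteq> sets (fin_counting M)"
    using sets.sigma_sets_subset[of ?E "fin_counting M"] counting_event_sets by auto
  let ?S = "sigma ?\<Omega> ?E"
  have S: "space ?S = ?\<Omega>" "sets ?S = sigma_sets ?\<Omega> ?E"
    using sub by (simp_all add: space_measure_of)
  have "(\<lambda>\<mu>. \<mu>) \<in> ?S \<rightarrow>\<^sub>M fin_counting M"
  proof (rule measurable_counting_algebra)
    fix C assume C: "C \<in> sets M"
    show "(\<lambda>\<mu>. emeasure \<mu> C) \<in> borel_measurable ?S"
    proof (rule measurableI)
      fix A :: "ennreal set" assume "A \<in> sets borel"
      have "(\<lambda>\<mu>. emeasure \<mu> C) -` A \<inter> space ?S = (\<Union>n\<in>{n. of_nat n \<in> A}. counting_event M {(C, n)})"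
      proof (intro equalityI subsetI)
        fix \<mu> assume \<mu>: "\<mu> \<in> (\<lambda>\<mu>. emeasure \<mu> C) -` A \<inter> space ?S"
        then have "\<mu> \<in> ?\<Omega>"
          using S(1) by simp
        moreover from this obtain n where "emeasure \<mu> C = of_nat n"
          using counting_measuresD(2)[OF _ C] by blast
        ultimately show "\<mu> \<in> (\<Union>n\<in>{n. of_nat n \<in> A}. counting_event M {(C, n)})"
          using \<mu> by (intro UN_I[of n]) (auto simp: counting_event_def)
      qed (unfold S(1), auto simp: counting_event_def)
      moreover have ev: "counting_event M {(C, n)} \<in> sets ?S" for n
        unfolding S(2) using C by (intro sigma_sets.Basic CollectI exI[of _ "{(C, n)}"]) simp
      ultimately show "(\<lambda>\<mu>. emeasure \<mu> C) -` A \<inter> space ?S \<in> sets ?S"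
        using sets.countable_UN''[OF countableI_type ev] by simp
    qed simp
  qed (simp add: S(1))
  then have m: "(\<lambda>\<mu>. \<mu>) -` A \<inter> space ?S \<in> sets ?S" if "A \<in> sets (fin_counting M)" for A
    using that by (rule measurable_sets)
  show "sets (fin_counting M) \<subseteq> sigma_sets ?\<Omega> ?E"
  proof
    fix A assume A: "A \<in> sets (fin_counting M)"
    have "(\<lambda>\<mu>. \<mu>) -` A \<inter> space ?S = A"
      unfolding S(1) using sets.sets_into_space[OF A] by auto
    with m[OF A] show "A \<in> sigma_sets ?\<Omega> ?E"
      unfolding S(2) by simp
  qed
qed

text \<open>The \<open>D i\<close> are the atoms of the finite algebra generated by the sets occurring in \<open>F\<close>.\<close>

lemma counting_event_disjoint:
  assumes F: "finite F" "fst ` F \<subseteq> sets M"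
  obtains n :: nat and D W where "n \<noteq> 0" "\<And>i. D i \<in> sets M" "disjoint_family_on D {..<n}"
    "W \<in> sets (\<Pi>\<^sub>M i\<in>{..<n}. (borel :: ennreal measure))"
    "\<And>\<mu>. \<mu> \<in> counting_measures M (sets M) \<Longrightarrow>
      \<mu> \<in> counting_event M F \<longleftrightarrow> (\<lambda>i\<in>{..<n}. emeasure \<mu> (D i)) \<in> W"
proof -
  define \<A> where "\<A> = fst ` F"
  have \<A>: "finite \<A>" "\<A> \<subseteq> sets M"
    using F by (auto simp: \<A>_def)
  define n where "n = card (Pow \<A>)"
  have n: "n \<noteq> 0"
    using \<A>(1) by (simp add: n_def card_Pow)
  obtain e where e: "bij_betw e {..<n} (Pow \<A>)"
    using ex_bij_betw_nat_finite[of "Pow \<A>"] \<A>(1) by (auto simp: n_def lessThan_atLeast0)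
  define D where "D i = {x\<in>space M. \<forall>A\<in>\<A>. x \<in> A \<longleftrightarrow> A \<in> e i}" for i
  have D_sets: "D i \<in> sets M" for i
  proof -
    have [measurable]: "A \<in> \<A> \<Longrightarrow> A \<in> sets M" for A
      using \<A> by auto
    show ?thesis
      unfolding D_def using \<A>(1) by measurable
  qed
  have disj: "disjoint_family_on D {..<n}"
    unfolding disjoint_family_on_def
  proof (intro ballI impI)
    fix i j assume ij: "i \<in> {..<n}" "j \<in> {..<n}" "i \<noteq> j"
    have "e i \<in> Pow \<A>" "e j \<in> Pow \<A>"
      using bij_betwE[OF e] ij by blast+
    moreover have "e i \<noteq> e j"
      using bij_betw_imp_inj_on[OF e] ij by (meson inj_onD)
    ultimately show "D i \<inter> D j = {}"
      unfolding D_def by blast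
  qed
  have decomp: "emeasure \<mu> A = (\<Sum>i\<in>{i\<in>{..<n}. A \<in> e i}. emeasure \<mu> (D i))"
    if A: "A \<in> \<A>" and \<mu>: "sets \<mu> = sets M" for A \<mu>
  proof -
    have "A = (\<Union>i\<in>{i\<in>{..<n}. A \<in> e i}. D i)"
    proof (intro equalityI subsetI)
      fix x assume x: "x \<in> A"
      have "{A\<in>\<A>. x \<in> A} \<in> e ` {..<n}"
        using bij_betw_imp_surj_on[OF e] by blast
      then obtain i where i: "i < n" "e i = {A\<in>\<A>. x \<in> A}"
        by auto
      moreover have "x \<in> space M"
        using x A \<A>(2) sets.sets_into_space by blast
      ultimately show "x \<in> (\<Union>i\<in>{i\<in>{..<n}. A \<in> e i}. D i)"
        using x A by (intro UN_I[of i]) (simp_all add: D_def)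
    next
      fix x assume "x \<in> (\<Union>i\<in>{i\<in>{..<n}. A \<in> e i}. D i)"
      then show "x \<in> A"
        using A unfolding D_def by blast
    qed
    moreover have "(\<Sum>i\<in>{i\<in>{..<n}. A \<in> e i}. emeasure \<mu> (D i)) = emeasure \<mu> (\<Union>i\<in>{i\<in>{..<n}. A \<in> e i}. D i)"
    proof (rule sum_emeasure)
      show "disjoint_family_on D {i\<in>{..<n}. A \<in> e i}"
        by (rule disjoint_family_on_mono[OF _ disj]) auto
    qed (use D_sets \<mu> in auto)
    ultimately show ?thesis by simp
  qed
  define W where "W = {x\<in>space (\<Pi>\<^sub>M i\<in>{..<n}. (borel :: ennreal measure)).
    \<forall>z\<in>F. (\<Sum>i\<in>{i\<in>{..<n}. fst z \<in> e i}. x i) = of_nat (snd z)}"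
  have "W \<in> sets (\<Pi>\<^sub>M i\<in>{..<n}. borel)"
  proof -
    have "(\<lambda>x. \<Sum>i\<in>{i\<in>{..<n}. A \<in> e i}. x i :: ennreal) \<in> borel_measurable (\<Pi>\<^sub>M i\<in>{..<n}. borel)" for A
      by (intro borel_measurable_sum measurable_component_singleton) auto
    note this[measurable]
    show ?thesis
      unfolding W_def using F(1) by measurable
  qed
  moreover have "\<mu> \<in> counting_event M F \<longleftrightarrow> (\<lambda>i\<in>{..<n}. emeasure \<mu> (D i)) \<in> W"
    if c: "\<mu> \<in> counting_measures M (sets M)" for \<mu>
  proof -
    have "(\<Sum>i\<in>{i\<in>{..<n}. fst z \<in> e i}. (\<lambda>i\<in>{..<n}. emeasure \<mu> (D i)) i) = emeasure \<mu> (fst z)"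
      if "z \<in> F" for z
    proof -
      have "fst z \<in> \<A>"
        using that by (simp add: \<A>_def)
      from decomp[OF this counting_measuresD(1)[OF c]] show ?thesis
        by (simp only:) (rule sum.cong, auto)
    qed
    then show ?thesis
      using c by (simp add: counting_event_def W_def space_PiM PiE_def)
  qed
  ultimately show thesis
    using that[OF n D_sets disj] by blast
qed

lemma emeasure_distr_counting_event:
  assumes \<xi> [measurable]: "\<xi> \<in> P \<rightarrow>\<^sub>M fin_counting M"
    and D: "\<And>i. D i \<in> sets M" and W: "W \<in> sets (\<Pi>\<^sub>M i\<in>{..<n}. (borel :: ennreal measure))"
    and F: "finite F" "fst ` F \<subseteq> sets M"
    and iff: "\<And>\<mu>. \<mu> \<in> counting_measures M (sets M) \<Longrightarrow>
      \<mu> \<in> counting_event M F \<longleftrightarrow> (\<lambda>i\<in>{..<n::nat}. emeasure \<mu> (D i)) \<in> W"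
  shows "emeasure (distr P (fin_counting M) \<xi>) (counting_event M F) =
    emeasure (distr P (\<Pi>\<^sub>M i\<in>{..<n}. borel) (\<lambda>\<omega>. \<lambda>i\<in>{..<n}. emeasure (\<xi> \<omega>) (D i))) W"
proof -
  have "\<xi> -` counting_event M F \<inter> space P = (\<lambda>\<omega>. \<lambda>i\<in>{..<n}. emeasure (\<xi> \<omega>) (D i)) -` W \<inter> space P"
    using iff measurable_space[OF \<xi>] by auto
  moreover have "(\<lambda>\<omega>. \<lambda>i\<in>{..<n}. emeasure (\<xi> \<omega>) (D i)) \<in> P \<rightarrow>\<^sub>M (\<Pi>\<^sub>M i\<in>{..<n}. borel)"
    using D by (intro measurable_restrict measurable_compose[OF \<xi> measurable_emeasure_counting_algebra]) auto
  ultimately show ?thesis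
    using W counting_event_sets[OF F] by (simp add: emeasure_distr)
qed

lemma poisson_process_marginal_eq:
  assumes pp: "poisson_process P (fin_counting M) \<nu> \<xi>" "poisson_process Q (fin_counting M) \<nu> \<eta>"
    and s: "sets \<nu> = sets M" and fin: "finite_measure \<nu>" and C: "C \<in> sets M"
  shows "distr P borel (\<lambda>\<omega>. emeasure (\<xi> \<omega>) C) = distr Q borel (\<lambda>\<omega>. emeasure (\<eta> \<omega>) C)"
proof (rule distr_nat_valued_eqI)
  interpret P: prob_space P
    using pp by (simp add: poisson_process_def)
  interpret Q: prob_space Q
    using pp by (simp add: poisson_process_def)
  have \<xi>: "\<xi> \<in> P \<rightarrow>\<^sub>M fin_counting M" and \<eta>: "\<eta> \<in> Q \<rightarrow>\<^sub>M fin_counting M"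
    using pp by (auto simp: poisson_process_def)
  have "emeasure \<nu> C < \<infinity>"
    using finite_measure.emeasure_finite[OF fin] by (simp add: top.not_eq_extremum)
  then show "emeasure P {\<omega>\<in>space P. emeasure (\<xi> \<omega>) C = of_nat n} = emeasure Q {\<omega>\<in>space Q. emeasure (\<eta> \<omega>) C = of_nat n}" for n
    using pp C s unfolding P.emeasure_eq_measure Q.emeasure_eq_measure poisson_process_def by simp
  show "(\<lambda>\<omega>. emeasure (\<xi> \<omega>) C) \<in> borel_measurable P" "(\<lambda>\<omega>. emeasure (\<eta> \<omega>) C) \<in> borel_measurable Q"
    by (rule measurable_compose[OF \<xi> measurable_emeasure_counting_algebra[OF C]],
      rule measurable_compose[OF \<eta> measurable_emeasure_counting_algebra[OF C]])
  show "emeasure (\<xi> \<omega>) C \<in> range of_nat" if "\<omega> \<in> space P" for \<omega>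
    using measurable_space[OF \<xi> that] counting_measuresD(2)[OF _ C] by simp
  show "emeasure (\<eta> \<omega>) C \<in> range of_nat" if "\<omega> \<in> space Q" for \<omega>
    using measurable_space[OF \<eta> that] counting_measuresD(2)[OF _ C] by simp
qed

text \<open>The definition controls joint counts on disjoint sets only. Events about overlapping
  sets are rewritten over the atoms that these sets generate, where independence and the Poisson
  marginals fix the joint law; such events form an intersection-stable generator.\<close>

theorem poisson_process_distr_eq:
  fixes M :: "'a measure"
  assumes pp: "poisson_process P (fin_counting M) \<nu> \<xi>" "poisson_process Q (fin_counting M) \<nu> \<eta>"
    and s: "sets \<nu> = sets M" and fin: "finite_measure \<nu>"
  shows "distr P (fin_counting M) \<xi> = distr Q (fin_counting M) \<eta>"
proof -
  interpret P: prob_space P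
    using pp by (simp add: poisson_process_def)
  have \<xi>: "\<xi> \<in> P \<rightarrow>\<^sub>M fin_counting M" and \<eta>: "\<eta> \<in> Q \<rightarrow>\<^sub>M fin_counting M"
    using pp by (auto simp: poisson_process_def)
  have eq: "emeasure (distr P (fin_counting M) \<xi>) (counting_event M F) =
    emeasure (distr Q (fin_counting M) \<eta>) (counting_event M F)"
    if F: "finite F" "fst ` F \<subseteq> sets M" for F
  proof -
    obtain n D W where *: "n \<noteq> 0" "\<And>i. D i \<in> sets M" "disjoint_family_on D {..<n}"
      "W \<in> sets (\<Pi>\<^sub>M i\<in>{..<n}. (borel :: ennreal measure))"
      "\<And>\<mu>. \<mu> \<in> counting_measures M (sets M) \<Longrightarrow>
        \<mu> \<in> counting_event M F \<longleftrightarrow> (\<lambda>i\<in>{..<n::nat}. emeasure \<mu> (D i)) \<in> W"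
      using counting_event_disjoint[OF F] by metis
    have "distr P (\<Pi>\<^sub>M i\<in>{..<n}. borel) (\<lambda>\<omega>. \<lambda>i\<in>{..<n}. emeasure (\<xi> \<omega>) (D i)) =
      distr Q (\<Pi>\<^sub>M i\<in>{..<n}. borel) (\<lambda>\<omega>. \<lambda>i\<in>{..<n}. emeasure (\<eta> \<omega>) (D i))"
      unfolding poisson_process_joint_distr[OF pp(1) s *(2,3,1)] poisson_process_joint_distr[OF pp(2) s *(2,3,1)]
      by (intro PiM_cong refl poisson_process_marginal_eq[OF pp s fin] *(2))
    moreover have "emeasure (distr P (fin_counting M) \<xi>) (counting_event M F) =
      emeasure (distr P (\<Pi>\<^sub>M i\<in>{..<n}. borel) (\<lambda>\<omega>. \<lambda>i\<in>{..<n}. emeasure (\<xi> \<omega>) (D i))) W"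
      by (rule emeasure_distr_counting_event[OF \<xi> *(2,4) F *(5)])
    moreover have "emeasure (distr Q (fin_counting M) \<eta>) (counting_event M F) =
      emeasure (distr Q (\<Pi>\<^sub>M i\<in>{..<n}. borel) (\<lambda>\<omega>. \<lambda>i\<in>{..<n}. emeasure (\<eta> \<omega>) (D i))) W"
      by (rule emeasure_distr_counting_event[OF \<eta> *(2,4) F *(5)])
    ultimately show ?thesis
      by (simp only:)
  qed
  let ?E = "{counting_event M F | F. finite F \<and> fst ` F \<subseteq> sets M}"
  show ?thesis
  proof (rule measure_eqI_generator_eq[where E="?E" and \<Omega>="counting_measures M (sets M)" and A="\<lambda>_. counting_event M {}"])
    show "Int_stable ?E"
      unfolding Int_stable_def
    proof (intro ballI, safe)
      fix F G :: "('a set \<times> nat) set" assume "finite F" "finite G" "fst ` F \<subseteq> sets M" "fst ` G \<subseteq> sets M"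
      then show "\<exists>H. counting_event M F \<inter> counting_event M G = counting_event M H \<and> finite H \<and> fst ` H \<subseteq> sets M"
        by (intro exI[of _ "F \<union> G"]) (auto simp: counting_event_def)
    qed
    show "range (\<lambda>_. counting_event M {}) \<subseteq> ?E"
      by (intro image_subsetI CollectI exI[of _ "{}"]) simp
    show "emeasure (distr P (fin_counting M) \<xi>) (counting_event M {}) \<noteq> \<infinity>"
    proof -
      interpret D: prob_space "distr P (fin_counting M) \<xi>"
        by (rule P.prob_space_distr[OF \<xi>])
      show ?thesis
        using D.emeasure_finite by simp
    qed
    show "?E \<subseteq> Pow (counting_measures M (sets M))" "(\<Union>i::nat. counting_event M {}) = counting_measures M (sets M)"
      by (auto simp: counting_event_def)
    show "emeasure (distr P (fin_counting M) \<xi>) X = emeasure (distr Q (fin_counting M) \<eta>) X" if "X \<in> ?E" for X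
      using that eq by auto
  qed (simp_all add: sets_fin_counting_generated)
qed

text \<open>The definite description in \<open>poisson_law\<close> calls for existence, which the
  explicit construction supplies, and for uniqueness, which is
  \<open>poisson_process_distr_eq\<close>.\<close>

lemma (in poisson_insertion) poisson_law_eq:
  assumes fin: "finite_measure N"
  shows "poisson_law N (restrict_to N B) = poisson_measure"
  unfolding poisson_law_def N_alg_finite[OF fin]
proof (rule the_equality)
  show "sets poisson_measure = sets NN \<and> poisson_process poisson_measure NN (restrict_to N B) (\<lambda>\<mu>. \<mu>)"
    using poisson_process_poisson_measure by simp
next
  fix Q assume Q: "sets Q = sets NN \<and> poisson_process Q NN (restrict_to N B) (\<lambda>\<mu>. \<mu>)"
  have "finite_measure (restrict_to N B)"
    using B_finite sets.sets_into_space[OF B] by (intro finite_measureI) (simp add: emeasure_restrict_to Int_absorb1)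
  then have "distr Q NN (\<lambda>\<mu>. \<mu>) = distr poisson_measure NN (\<lambda>\<mu>. \<mu>)"
    using Q poisson_process_poisson_measure by (intro poisson_process_distr_eq[where \<nu>="restrict_to N B"]) auto
  then show "Q = poisson_measure"
    using Q by (simp add: distr_id2)
qed

section \<open>Inserting points in increasing order\<close>

text \<open>The level sets of \<open>\<phi>\<close> are null, so almost everywhere n inserted points
  have distinct positions and come in exactly one of the n! orders. For \<open>M\<close> this is
  where diffuseness enters.\<close>

locale ordered_insertion = weighted_insertion N k
  for N :: "'a measure" and k :: "'a \<Rightarrow> 'a measure \<Rightarrow> ennreal" +
  fixes \<phi> :: "'a \<Rightarrow> real"
  assumes coding_measurable [measurable]: "\<phi> \<in> borel_measurable N"
    and no_ties: "emeasure N {x\<in>space N. \<phi> x = a} = 0"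
begin

definition insert_above :: "ereal \<Rightarrow> ('a measure \<Rightarrow> ennreal) \<Rightarrow> 'a measure \<Rightarrow> ennreal" where
  "insert_above c g \<mu> = (\<integral>\<^sup>+x. of_bool (c < ereal (\<phi> x)) * k x \<mu> * g (\<mu> \<oplus>\<^sub>m return N x) \<partial>N)"

text \<open>Integrates over increasing chains of points beyond \<open>c\<close>. The threshold is an
  \<open>ereal\<close>, so that starting from minus infinity imposes no restriction.\<close>

primrec insert_increasing :: "nat \<Rightarrow> ('a measure \<Rightarrow> ennreal) \<Rightarrow> ereal \<Rightarrow> 'a measure \<Rightarrow> ennreal" where
  "insert_increasing 0 g c \<mu> = g \<mu>"
| "insert_increasing (Suc n) g c \<mu> =
    (\<integral>\<^sup>+x. of_bool (c < ereal (\<phi> x)) * k x \<mu> * insert_increasing n g (ereal (\<phi> x)) (\<mu> \<oplus>\<^sub>m return N x) \<partial>N)"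

lemma insert_increasing_measurable:
  assumes g [measurable]: "g \<in> borel_measurable NN"
  shows "(\<lambda>(c, \<mu>). insert_increasing n g c \<mu>) \<in> borel_measurable (borel \<Otimes>\<^sub>M NN)"
proof (induct n)
  case (Suc n)
  have [measurable]: "(\<lambda>\<omega>. insert_increasing n g (a \<omega>) (b \<omega>)) \<in> borel_measurable \<Omega>"
    if "a \<in> \<Omega> \<rightarrow>\<^sub>M borel" "b \<in> \<Omega> \<rightarrow>\<^sub>M NN" for a b and \<Omega> :: "((ereal \<times> 'a measure) \<times> 'a) measure"
    using measurable_compose[OF measurable_Pair[OF that] Suc] by simp
  show ?case
    by simp measurable
qed simp

lemma insert_increasing_measurable_comp:
  assumes "g \<in> borel_measurable NN" "a \<in> \<Omega> \<rightarrow>\<^sub>M borel" "b \<in> \<Omega> \<rightarrow>\<^sub>M NN"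
  shows "(\<lambda>\<omega>. insert_increasing n g (a \<omega>) (b \<omega>)) \<in> borel_measurable \<Omega>"
  using measurable_compose[OF measurable_Pair[OF assms(2,3)] insert_increasing_measurable[OF assms(1)]] by simp

text \<open>Splitting the integral over two further points according to which of them comes first
  reduces the unordered insertion of one more point to the ordered one.\<close>

lemma insert_above_increasing:
  assumes g [measurable]: "g \<in> borel_measurable NN" and \<mu>: "\<mu> \<in> counting_measures N (sets N)"
  shows "insert_above c (insert_increasing n g c) \<mu> = of_nat (Suc n) * insert_increasing (Suc n) g c \<mu>"
  using \<mu>
proof (induct n arbitrary: c \<mu>)
  case 0
  then show ?case
    by (simp add: insert_above_def)
next
  case (Suc n)
  note [measurable] = insert_increasing_measurable_comp[OF g]
  have [measurable]: "\<mu> \<in> space NN" using Suc(2) by simp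
  have s: "sets \<mu> = sets N"
    using counting_measuresD(1)[OF Suc(2)] .
  interpret P: pair_sigma_finite N N ..
  let ?o = "\<lambda>P. of_bool P :: ennreal"
  let ?G = "\<lambda>x y. insert_increasing n g (ereal (\<phi> y)) (\<mu> \<oplus>\<^sub>m return N x \<oplus>\<^sub>m return N y)"
  have "insert_above c (insert_increasing (Suc n) g c) \<mu> =
    (\<integral>\<^sup>+x. (\<integral>\<^sup>+y. ?o (c < ereal (\<phi> x)) * k x \<mu> * (?o (c < ereal (\<phi> y)) * k y (\<mu> \<oplus>\<^sub>m return N x) * ?G x y) \<partial>N) \<partial>N)"
    unfolding insert_above_def insert_increasing.simps
    by (intro nn_integral_cong nn_integral_cmult[symmetric]) measurable
  also have "\<dots> = (\<integral>\<^sup>+x. (\<integral>\<^sup>+y.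
      ?o (c < ereal (\<phi> x)) * k x \<mu> * (?o (\<phi> x < \<phi> y) * k y (\<mu> \<oplus>\<^sub>m return N x) * ?G x y)
      + ?o (c < ereal (\<phi> y)) * k x \<mu> * (?o (\<phi> y < \<phi> x) * k y (\<mu> \<oplus>\<^sub>m return N x) * ?G x y) \<partial>N) \<partial>N)"
  proof (rule nn_integral_cong, rule nn_integral_cong_AE)
    fix x assume "x \<in> space N"
    have "{y\<in>space N. \<phi> y = \<phi> x} \<in> null_sets N"
      using no_ties by (auto intro!: null_setsI)
    then have "AE y in N. \<phi> y \<noteq> \<phi> x"
      by (rule AE_I') auto
    have "?o (c < ereal (\<phi> x)) * k x \<mu> * (?o (c < ereal (\<phi> y)) * k y (\<mu> \<oplus>\<^sub>m return N x) * ?G x y) =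
      ?o (c < ereal (\<phi> x)) * k x \<mu> * (?o (\<phi> x < \<phi> y) * k y (\<mu> \<oplus>\<^sub>m return N x) * ?G x y)
      + ?o (c < ereal (\<phi> y)) * k x \<mu> * (?o (\<phi> y < \<phi> x) * k y (\<mu> \<oplus>\<^sub>m return N x) * ?G x y)"
      if "\<phi> y \<noteq> \<phi> x" for y
    proof (cases "\<phi> x < \<phi> y")
      case True
      moreover have "c < ereal (\<phi> x) \<Longrightarrow> c < ereal (\<phi> y)"
        using True by (meson ereal_less_eq(3) less_imp_le less_le_trans)
      ultimately show ?thesis
        by (auto simp: of_bool_def)
    next
      case False
      with that have lt: "\<phi> y < \<phi> x" by simp
      moreover have "c < ereal (\<phi> y) \<Longrightarrow> c < ereal (\<phi> x)"
        using lt by (meson ereal_less_eq(3) less_imp_le less_le_trans)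
      ultimately show ?thesis
        by (auto simp: of_bool_def)
    qed
    note split = this
    from \<open>AE y in N. \<phi> y \<noteq> \<phi> x\<close> show "AE y in N. ?o (c < ereal (\<phi> x)) * k x \<mu> * (?o (c < ereal (\<phi> y)) * k y (\<mu> \<oplus>\<^sub>m return N x) * ?G x y) =
      ?o (c < ereal (\<phi> x)) * k x \<mu> * (?o (\<phi> x < \<phi> y) * k y (\<mu> \<oplus>\<^sub>m return N x) * ?G x y)
      + ?o (c < ereal (\<phi> y)) * k x \<mu> * (?o (\<phi> y < \<phi> x) * k y (\<mu> \<oplus>\<^sub>m return N x) * ?G x y)"
      by eventually_elim (rule split)
  qed
  also have "\<dots> = (\<integral>\<^sup>+x. (\<integral>\<^sup>+y. ?o (c < ereal (\<phi> x)) * k x \<mu> * (?o (\<phi> x < \<phi> y) * k y (\<mu> \<oplus>\<^sub>m return N x) * ?G x y) \<partial>N)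
      + (\<integral>\<^sup>+y. ?o (c < ereal (\<phi> y)) * k x \<mu> * (?o (\<phi> y < \<phi> x) * k y (\<mu> \<oplus>\<^sub>m return N x) * ?G x y) \<partial>N) \<partial>N)"
    by (intro nn_integral_cong nn_integral_add) measurable
  also have "\<dots> = (\<integral>\<^sup>+x. (\<integral>\<^sup>+y. ?o (c < ereal (\<phi> x)) * k x \<mu> * (?o (\<phi> x < \<phi> y) * k y (\<mu> \<oplus>\<^sub>m return N x) * ?G x y) \<partial>N) \<partial>N)
      + (\<integral>\<^sup>+x. (\<integral>\<^sup>+y. ?o (c < ereal (\<phi> y)) * k x \<mu> * (?o (\<phi> y < \<phi> x) * k y (\<mu> \<oplus>\<^sub>m return N x) * ?G x y) \<partial>N) \<partial>N)"
    by (rule nn_integral_add) measurable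
  also have "(\<integral>\<^sup>+x. (\<integral>\<^sup>+y. ?o (c < ereal (\<phi> x)) * k x \<mu> * (?o (\<phi> x < \<phi> y) * k y (\<mu> \<oplus>\<^sub>m return N x) * ?G x y) \<partial>N) \<partial>N) =
    insert_increasing (Suc (Suc n)) g c \<mu>"
    unfolding insert_increasing.simps ereal_less(1)
    by (subst nn_integral_cmult) (auto intro!: nn_integral_cong)
  also have "(\<integral>\<^sup>+x. (\<integral>\<^sup>+y. ?o (c < ereal (\<phi> y)) * k x \<mu> * (?o (\<phi> y < \<phi> x) * k y (\<mu> \<oplus>\<^sub>m return N x) * ?G x y) \<partial>N) \<partial>N) =
    (\<integral>\<^sup>+y. (\<integral>\<^sup>+x. ?o (c < ereal (\<phi> y)) * k x \<mu> * (?o (\<phi> y < \<phi> x) * k y (\<mu> \<oplus>\<^sub>m return N x) * ?G x y) \<partial>N) \<partial>N)"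
    by (rule P.Fubini') measurable
  \<comment> \<open>Exchanging the order of insertion by the cocycle property puts the smaller point
    \<open>y\<close> first, so that the induction hypothesis applies beyond
    \<open>y\<close>.\<close>
  also have "\<dots> = (\<integral>\<^sup>+y. (\<integral>\<^sup>+x. ?o (c < ereal (\<phi> y)) * k y \<mu> * (?o (ereal (\<phi> y) < ereal (\<phi> x)) * k x (\<mu> \<oplus>\<^sub>m return N y) *
      insert_increasing n g (ereal (\<phi> y)) (\<mu> \<oplus>\<^sub>m return N y \<oplus>\<^sub>m return N x)) \<partial>N) \<partial>N)"
  proof (intro nn_integral_cong)
    fix x y assume xy: "x \<in> space N" "y \<in> space N"
    have "?o (c < ereal (\<phi> y)) * k x \<mu> * (?o (\<phi> y < \<phi> x) * k y (\<mu> \<oplus>\<^sub>m return N x) * ?G x y) =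
      ?o (c < ereal (\<phi> y)) * ?o (\<phi> y < \<phi> x) * (k x \<mu> * k y (\<mu> \<oplus>\<^sub>m return N x)) * ?G x y"
      by (simp only: ac_simps)
    also have "\<dots> = ?o (c < ereal (\<phi> y)) * ?o (\<phi> y < \<phi> x) * (k y \<mu> * k x (\<mu> \<oplus>\<^sub>m return N y)) *
      insert_increasing n g (ereal (\<phi> y)) (\<mu> \<oplus>\<^sub>m return N y \<oplus>\<^sub>m return N x)"
      using xy Suc(2) add_measure_right_commute[OF s, of x y] by (simp only: cocycle)
    finally show "?o (c < ereal (\<phi> y)) * k x \<mu> * (?o (\<phi> y < \<phi> x) * k y (\<mu> \<oplus>\<^sub>m return N x) * ?G x y) =
      ?o (c < ereal (\<phi> y)) * k y \<mu> * (?o (ereal (\<phi> y) < ereal (\<phi> x)) * k x (\<mu> \<oplus>\<^sub>m return N y) *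
      insert_increasing n g (ereal (\<phi> y)) (\<mu> \<oplus>\<^sub>m return N y \<oplus>\<^sub>m return N x))"
      by (simp add: ac_simps)
  qed
  also have "\<dots> = (\<integral>\<^sup>+y. ?o (c < ereal (\<phi> y)) * k y \<mu> *
      insert_above (ereal (\<phi> y)) (insert_increasing n g (ereal (\<phi> y))) (\<mu> \<oplus>\<^sub>m return N y) \<partial>N)"
    unfolding insert_above_def by (intro nn_integral_cong nn_integral_cmult) measurable
  also have "\<dots> = (\<integral>\<^sup>+y. of_nat (Suc n) * (?o (c < ereal (\<phi> y)) * k y \<mu> *
      insert_increasing (Suc n) g (ereal (\<phi> y)) (\<mu> \<oplus>\<^sub>m return N y)) \<partial>N)"
    using Suc by (intro nn_integral_cong) (simp only: add_return_counting subset_refl mult.left_commute)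
  also have "\<dots> = of_nat (Suc n) * insert_increasing (Suc (Suc n)) g c \<mu>"
    unfolding insert_increasing.simps(2)[of "Suc n"] by (rule nn_integral_cmult) measurable
  finally show ?case
    by (simp only: of_nat_Suc[of "Suc n"] distrib_right mult_1_left)
qed

text \<open>By the cocycle property all n! orders of the inserted points carry the same weight, and
  up to ties exactly one of them is increasing.\<close>

lemma insert_above_pow:
  assumes g [measurable]: "g \<in> borel_measurable NN" and \<mu>: "\<mu> \<in> counting_measures N (sets N)"
  shows "(insert_above c ^^ n) g \<mu> = fact n * insert_increasing n g c \<mu>"
  using \<mu>
proof (induct n arbitrary: \<mu>)
  case (Suc n)
  note [measurable] = insert_increasing_measurable_comp[OF g]
  have [measurable]: "\<mu> \<in> space NN" using Suc(2) by simp
  have "(insert_above c ^^ Suc n) g \<mu> = (\<integral>\<^sup>+x. fact n * (of_bool (c < ereal (\<phi> x)) * k x \<mu> *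
    insert_increasing n g c (\<mu> \<oplus>\<^sub>m return N x)) \<partial>N)"
    unfolding funpow.simps o_apply insert_above_def[of c "(insert_above c ^^ n) g"]
    using Suc by (intro nn_integral_cong) (simp only: add_return_counting subset_refl mult.left_commute)
  also have "\<dots> = fact n * insert_above c (insert_increasing n g c) \<mu>"
    unfolding insert_above_def by (rule nn_integral_cmult) measurable
  also have "\<dots> = fact (Suc n) * insert_increasing (Suc n) g c \<mu>"
    unfolding insert_above_increasing[OF g Suc(2)] fact_Suc by (simp only: of_nat_mult of_nat_fact mult.assoc mult.left_commute)
  finally show ?case .
qed simp

definition weight_above :: "('a measure \<Rightarrow> ennreal) \<Rightarrow> ereal \<Rightarrow> 'a measure \<Rightarrow> ennreal" where
  "weight_above g c \<mu> = (\<Sum>n. insert_increasing n g c \<mu>)"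

lemma weight_above_measurable:
  assumes g: "g \<in> borel_measurable NN" "a \<in> \<Omega> \<rightarrow>\<^sub>M borel" "b \<in> \<Omega> \<rightarrow>\<^sub>M NN"
  shows "(\<lambda>\<omega>. weight_above g (a \<omega>) (b \<omega>)) \<in> borel_measurable \<Omega>"
proof -
  note [measurable] = insert_increasing_measurable_comp[OF assms]
  show ?thesis
    unfolding weight_above_def by measurable
qed

text \<open>Either no point is added, or there is a leftmost one \<open>x\<close> and all further
  points lie beyond it.\<close>

lemma weight_above_step:
  assumes g [measurable]: "g \<in> borel_measurable NN" and \<mu>: "\<mu> \<in> counting_measures N (sets N)"
  shows "weight_above g c \<mu> =
    g \<mu> + (\<integral>\<^sup>+x. of_bool (c < ereal (\<phi> x)) * k x \<mu> * weight_above g (ereal (\<phi> x)) (\<mu> \<oplus>\<^sub>m return N x) \<partial>N)"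
proof -
  note [measurable] = insert_increasing_measurable_comp[OF g]
  have [measurable]: "\<mu> \<in> space NN" using \<mu> by simp
  have "weight_above g c \<mu> = (\<Sum>n. insert_increasing (Suc n) g c \<mu>) + g \<mu>"
    unfolding weight_above_def by (subst suminf_offset[of _ 1]) simp_all
  also have "(\<Sum>n. insert_increasing (Suc n) g c \<mu>) = (\<integral>\<^sup>+x. (\<Sum>n. of_bool (c < ereal (\<phi> x)) * k x \<mu> *
      insert_increasing n g (ereal (\<phi> x)) (\<mu> \<oplus>\<^sub>m return N x)) \<partial>N)"
    unfolding insert_increasing.simps by (rule nn_integral_suminf[symmetric]) measurable
  finally show ?thesis
    by (simp add: weight_above_def add.commute)
qed

lemma insert_op_eq_insert_above: "insert_op = insert_above (-\<infinity>)"
  by (simp add: fun_eq_iff insert_op_def insert_above_def)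

lemma total_weight_eq:
  assumes g: "g \<in> borel_measurable NN"
  shows "total_weight g = weight_above g (-\<infinity>) (null_measure N)"
  unfolding total_weight_def weight_above_def insert_op_eq_insert_above insert_above_pow[OF g null_measure_counting]
    ennreal_fact_cancel ..

end

section \<open>The partition function\<close>

text \<open>Sublevel sets at rational levels serve as separators, with the two functions interleaved
  over even and odd indices. Two functions are taken because the product with the half line needs
  both coordinates.\<close>

lemma separated_spaceI:
  fixes f g :: "'a \<Rightarrow> real"
  assumes [measurable]: "f \<in> borel_measurable M" "g \<in> borel_measurable M"
    and inj: "\<And>x y. x \<in> space M \<Longrightarrow> y \<in> space M \<Longrightarrow> f x = f y \<Longrightarrow> g x = g y \<Longrightarrow> x = y"
  shows "separated_space M"
proof
  define U where "U i = {x\<in>space M. (if even i then f x else g x) < of_rat (nat_to_rat_surj (i div 2))}" for i :: nat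
  have "U i \<in> sets M" for i
    unfolding U_def by measurable
  moreover have "x = y" if xy: "x \<in> space M" "y \<in> space M" and U: "\<And>i. x \<in> U i \<longleftrightarrow> y \<in> U i" for x y
  proof -
    have eq: "a = b" if "\<And>q :: rat. a < of_rat q \<longleftrightarrow> b < of_rat q" for a b :: real
    proof (rule antisym)
      have le: "a \<le> b" if "\<And>q :: rat. b < of_rat q \<Longrightarrow> a < of_rat q" for a b :: real
      proof (rule ccontr)
        assume "\<not> a \<le> b"
        then obtain q where "b < of_rat q" "of_rat q < a"
          using of_rat_dense[of b a] by auto
        with that[of q] show False by simp
      qed
      show "a \<le> b" "b \<le> a"
        using that by (auto intro!: le)
    qed
    have "f x = f y"
    proof (rule eq)
      fix q :: rat
      obtain i where "q = nat_to_rat_surj i"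
        using surj_nat_to_rat_surj by (metis surjD)
      then show "f x < of_rat q \<longleftrightarrow> f y < of_rat q"
        using U[of "2 * i"] xy by (simp add: U_def)
    qed
    moreover have "g x = g y"
    proof (rule eq)
      fix q :: rat
      obtain i where "q = nat_to_rat_surj i"
        using surj_nat_to_rat_surj by (metis surjD)
      then show "g x < of_rat q \<longleftrightarrow> g y < of_rat q"
        using U[of "2 * i + 1"] xy by (simp add: U_def)
    qed
    ultimately show "x = y"
      using inj xy by blast
  qed
  ultimately show "\<exists>U :: nat \<Rightarrow> 'a set. (\<forall>i. U i \<in> sets M) \<and>
    (\<forall>x\<in>space M. \<forall>y\<in>space M. (\<forall>i. x \<in> U i \<longleftrightarrow> y \<in> U i) \<longrightarrow> x = y)"
    by blast
qed

locale gibbs_setting = finite_measure M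
  for M :: "'a measure" +
  fixes \<phi> :: "'a \<Rightarrow> real" and \<kappa> :: "'a \<Rightarrow> 'a measure \<Rightarrow> real"
  assumes coding: "borel_coding M \<phi>"
    and diffuse: "diffuse M"
    and kappa_measurable: "(\<lambda>(x, \<mu>). \<kappa> x \<mu>) \<in> borel_measurable (M \<Otimes>\<^sub>M N_alg M)"
    and kappa_nonneg: "\<forall>x\<in>space M. \<forall>\<mu>\<in>space (N_alg M). 0 \<le> \<kappa> x \<mu>"
    and kappa_cocycle: "\<forall>x\<in>space M. \<forall>y\<in>space M. \<forall>\<mu>\<in>space (N_alg M).
           \<kappa> x \<mu> * \<kappa> y (\<mu> \<oplus>\<^sub>m return M x) = \<kappa> y \<mu> * \<kappa> x (\<mu> \<oplus>\<^sub>m return M y)"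
begin

lemma phi_measurable [measurable]: "\<phi> \<in> borel_measurable M"
  and phi_inj: "inj_on \<phi> (space M)"
  using coding by (auto simp: borel_coding_def)

lemma N_alg_eq: "N_alg M = fin_counting M"
  by (rule N_alg_finite) unfold_locales

lemma kappa_nonneg': "x \<in> space M \<Longrightarrow> \<mu> \<in> counting_measures M (sets M) \<Longrightarrow> 0 \<le> \<kappa> x \<mu>"
  using kappa_nonneg by (simp add: N_alg_eq)

lemma kappa_cocycle':
  "x \<in> space M \<Longrightarrow> y \<in> space M \<Longrightarrow> \<mu> \<in> counting_measures M (sets M) \<Longrightarrow>
    \<kappa> x \<mu> * \<kappa> y (\<mu> \<oplus>\<^sub>m return M x) = \<kappa> y \<mu> * \<kappa> x (\<mu> \<oplus>\<^sub>m return M y)"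
  using kappa_cocycle by (simp add: N_alg_eq)

sublocale separated_space M
  by (rule separated_spaceI[of \<phi> M \<phi>]) (use phi_inj in \<open>auto dest: inj_onD\<close>)

sublocale ordered_insertion M "\<lambda>x \<mu>. ennreal (\<kappa> x \<mu>)" \<phi>
proof
  show "(\<lambda>(x, \<mu>). ennreal (\<kappa> x \<mu>)) \<in> borel_measurable (M \<Otimes>\<^sub>M fin_counting M)"
    using measurable_compose[OF kappa_measurable measurable_ennreal] by (simp add: N_alg_eq split_beta')
  show "ennreal (\<kappa> x \<mu>) * ennreal (\<kappa> y (\<mu> \<oplus>\<^sub>m return M x)) = ennreal (\<kappa> y \<mu>) * ennreal (\<kappa> x (\<mu> \<oplus>\<^sub>m return M y))"
    if "x \<in> space M" "y \<in> space M" "\<mu> \<in> counting_measures M (sets M)" for x y \<mu>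
    using that kappa_cocycle'[OF that] by (simp add: kappa_nonneg' flip: ennreal_mult)
  show "emeasure M {x\<in>space M. \<phi> x = a} = 0" for a
  proof (cases "\<exists>x\<in>space M. \<phi> x = a")
    case True
    then obtain x where "x \<in> space M" "\<phi> x = a" by blast
    then have "{x\<in>space M. \<phi> x = a} = {x}"
      using phi_inj by (auto dest: inj_onD)
    then show ?thesis
      using diffuse \<open>x \<in> space M\<close> by (simp add: diffuse_def)
  next
    case False
    then have eq: "{x\<in>space M. \<phi> x = a} = {}" by blast
    show ?thesis unfolding eq by simp
  qed
qed simp

section \<open>Invariance of the products of Papangelou factors under permutations\<close>

lemma kappa_list_nonneg:
  "set xs \<subseteq> space M \<Longrightarrow> \<psi> \<in> counting_measures M (sets M) \<Longrightarrow> 0 \<le> kappa_list M \<kappa> xs \<psi>"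
  by (induct xs arbitrary: \<psi>) (auto intro!: mult_nonneg_nonneg kappa_nonneg')

text \<open>By induction \<open>x\<close> can be moved next to the head, and the cocycle property
  exchanges it with the head.\<close>

lemma kappa_list_remove1:
  assumes "set xs \<subseteq> space M" "\<psi> \<in> counting_measures M (sets M)" "x \<in> set xs"
  shows "kappa_list M \<kappa> xs \<psi> = \<kappa> x \<psi> * kappa_list M \<kappa> (remove1 x xs) (\<psi> \<oplus>\<^sub>m return M x)"
  using assms
proof (induct xs arbitrary: \<psi>)
  case (Cons y xs)
  show ?case
  proof (cases "x = y")
    case False
    then have x: "x \<in> set xs" "x \<in> space M" "y \<in> space M"
      using Cons(2,4) by auto
    have "kappa_list M \<kappa> (y # xs) \<psi> =
      \<kappa> y \<psi> * (\<kappa> x (\<psi> \<oplus>\<^sub>m return M y) * kappa_list M \<kappa> (remove1 x xs) (\<psi> \<oplus>\<^sub>m return M y \<oplus>\<^sub>m return M x))"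
      using Cons(1)[of "\<psi> \<oplus>\<^sub>m return M y"] Cons(2,3) x by simp
    also have "\<dots> = \<kappa> x \<psi> * (\<kappa> y (\<psi> \<oplus>\<^sub>m return M x) * kappa_list M \<kappa> (remove1 x xs) (\<psi> \<oplus>\<^sub>m return M x \<oplus>\<^sub>m return M y))"
      using kappa_cocycle'[OF x(2,3) Cons(3)] add_measure_right_commute[OF counting_measuresD(1)[OF Cons(3)], of x y]
      by (simp add: mult.assoc[symmetric])
    finally show ?thesis
      using False by simp
  qed simp
qed simp

lemma kappa_list_cong_mset:
  assumes "mset xs = mset ys" "set xs \<subseteq> space M" "\<psi> \<in> counting_measures M (sets M)"
  shows "kappa_list M \<kappa> xs \<psi> = kappa_list M \<kappa> ys \<psi>"
  using assms
proof (induct xs arbitrary: ys \<psi>)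
  case (Cons x xs)
  have set: "set ys = set (x # xs)"
    using Cons(2) by (metis mset_eq_setD)
  have "mset xs = mset (remove1 x ys)"
    using Cons(2) by (simp flip: Cons(2))
  then have "kappa_list M \<kappa> xs (\<psi> \<oplus>\<^sub>m return M x) = kappa_list M \<kappa> (remove1 x ys) (\<psi> \<oplus>\<^sub>m return M x)"
    using Cons(3,4) by (intro Cons(1)) auto
  then show ?case
    using kappa_list_remove1[of ys \<psi> x] Cons(3,4) set by simp
qed simp

text \<open>All permuted products agree, so the symmetrization is a mean of equal terms.\<close>

lemma kappa_sym_eq:
  assumes "set xs \<subseteq> space M" "\<psi> \<in> counting_measures M (sets M)"
  shows "kappa_sym M \<kappa> xs \<psi> = kappa_list M \<kappa> xs \<psi>"
proof -
  have "kappa_list M \<kappa> (permute_list \<sigma> xs) \<psi> = kappa_list M \<kappa> xs \<psi>" if "\<sigma> permutes {..<length xs}" for \<sigma>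
    using assms that by (intro kappa_list_cong_mset) auto
  then show ?thesis
    by (simp add: kappa_sym_def card_permutations)
qed

text \<open>Splits off the last point instead of the first. Thus adding a point to a configuration
  multiplies its weight by one Papangelou factor.\<close>

lemma kappa_list_snoc:
  assumes "\<psi> \<in> counting_measures M (sets M)"
  shows "kappa_list M \<kappa> (xs @ [x]) \<psi> = kappa_list M \<kappa> xs \<psi> * \<kappa> x (\<psi> \<oplus>\<^sub>m dirac_sum M xs)"
  using assms
proof (induct xs arbitrary: \<psi>)
  case Nil
  then show ?case
    using counting_measuresD(1)[OF Nil] by simp
next
  case (Cons y xs)
  have s: "sets \<psi> = sets M"
    using counting_measuresD(1)[OF Cons(2)] .
  have "\<psi> \<oplus>\<^sub>m return M y \<oplus>\<^sub>m dirac_sum M xs = \<psi> \<oplus>\<^sub>m (return M y \<oplus>\<^sub>m dirac_sum M xs)"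
    using s by (intro add_measure_assoc) auto
  also have "return M y \<oplus>\<^sub>m dirac_sum M xs = dirac_sum M (y # xs)"
    by (simp add: add_measure_commute)
  finally show ?case
    using Cons by simp
qed

section \<open>The Boltzmann weight exp(-H) and its measurability\<close>

definition boltzmann :: "'a measure \<Rightarrow> 'a measure \<Rightarrow> ennreal" where
  "boltzmann \<psi> \<mu> = exp_minus (hamiltonian M \<kappa> \<mu> \<psi>)"

lemma boltzmann_dirac_sum:
  assumes xs: "set xs \<subseteq> space M" and \<psi>: "\<psi> \<in> counting_measures M (sets M)"
  shows "boltzmann \<psi> (dirac_sum M xs) = ennreal (kappa_list M \<kappa> xs \<psi>)"
proof (cases "xs = []")
  case True
  then show ?thesis
    by (simp add: boltzmann_def hamiltonian_def exp_minus_def zero_ereal_def)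
next
  case False
  have all: "filter (\<lambda>x. x \<in> space M) xs = xs"
    using xs by (auto simp: filter_id_conv)
  have e: "emeasure (dirac_sum M xs) (space M) = of_nat (length xs)"
    by (simp add: emeasure_dirac_sum all)
  then have e': "emeasure (dirac_sum M xs) (space M) \<noteq> 0" "emeasure (dirac_sum M xs) (space M) \<noteq> \<infinity>"
    using False by auto
  \<comment> \<open>The list chosen in \<open>hamiltonian\<close>; it need not be \<open>xs\<close>,
    but it has the same multiset.\<close>
  define ys where "ys = (SOME ys. set ys \<subseteq> space M \<and> dirac_sum M xs = dirac_sum M ys)"
  have ys: "set ys \<subseteq> space M \<and> dirac_sum M xs = dirac_sum M ys"
    unfolding ys_def by (rule someI[of _ xs]) (use xs in simp)
  then have "mset ys = mset xs"
    using dirac_sum_eq_imp_mset_eq[OF xs] by auto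
  then have k: "kappa_sym M \<kappa> ys \<psi> = kappa_list M \<kappa> xs \<psi>"
    using ys \<psi> by (simp add: kappa_sym_eq kappa_list_cong_mset)
  have "hamiltonian M \<kappa> (dirac_sum M xs) \<psi> =
    (if kappa_list M \<kappa> xs \<psi> = 0 then \<infinity> else ereal (- ln (kappa_list M \<kappa> xs \<psi>)))"
    unfolding hamiltonian_def ys_def[symmetric] using e' by (simp add: Let_def k)
  then show ?thesis
    using kappa_list_nonneg[OF xs \<psi>] by (simp add: boltzmann_def exp_minus_def)
qed

text \<open>The Papangelou intensity as a ratio of weights, written without division so that weights
  equal to zero are covered.\<close>

lemma boltzmann_add_return:
  assumes \<mu>: "\<mu> \<in> counting_measures M (sets M)" and \<psi>: "\<psi> \<in> counting_measures M (sets M)" and x: "x \<in> space M"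
  shows "boltzmann \<psi> (\<mu> \<oplus>\<^sub>m return M x) = boltzmann \<psi> \<mu> * ennreal (\<kappa> x (\<psi> \<oplus>\<^sub>m \<mu>))"
proof -
  obtain xs where xs: "set xs \<subseteq> space M" "\<mu> = dirac_sum M xs"
    using counting_eq_dirac_sum[OF \<mu>] .
  then show ?thesis
    using boltzmann_dirac_sum[of "xs @ [x]" \<psi>] boltzmann_dirac_sum[of xs \<psi>] x \<psi>
    by (simp add: kappa_list_snoc ennreal_mult' kappa_list_nonneg)
qed

text \<open>Writing the weight with integrals makes its measurability visible.\<close>

primrec boltzmann_n :: "nat \<Rightarrow> 'a measure \<Rightarrow> 'a measure \<Rightarrow> ennreal" where
  "boltzmann_n 0 \<psi> \<mu> = of_bool (emeasure \<mu> (space M) = 0)"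
| "boltzmann_n (Suc n) \<psi> \<mu> =
    ennreal (1 / real (Suc n)) * (\<integral>\<^sup>+x. ennreal (\<kappa> x \<psi>) * boltzmann_n n (\<psi> \<oplus>\<^sub>m return M x) (remove_point \<mu> x) \<partial>\<mu>)"

lemma boltzmann_n_measurable: "(\<lambda>(\<psi>, \<mu>). boltzmann_n n \<psi> \<mu>) \<in> borel_measurable (NN \<Otimes>\<^sub>M NN)"
proof (induct n)
  case 0
  have [measurable]: "(\<lambda>\<mu>. emeasure \<mu> (space M)) \<in> borel_measurable NN"
    by (rule measurable_emeasure_counting_algebra) simp
  show ?case
    by simp measurable
next
  case (Suc n)
  have [measurable]: "(\<lambda>\<omega>. boltzmann_n n (a \<omega>) (b \<omega>)) \<in> borel_measurable \<Omega>"
    if "a \<in> \<Omega> \<rightarrow>\<^sub>M NN" "b \<in> \<Omega> \<rightarrow>\<^sub>M NN" for a b and \<Omega> :: "(('a measure \<times> 'a measure) \<times> 'a) measure"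
    using measurable_compose[OF measurable_Pair[OF that] Suc] by simp
  note measurable_remove_point[measurable]
  have "(\<lambda>z. \<integral>\<^sup>+x. (\<lambda>w. ennreal (\<kappa> (snd w) (fst (fst w))) *
      boltzmann_n n (fst (fst w) \<oplus>\<^sub>m return M (snd w)) (remove_point (snd (fst w)) (snd w))) (z, x) \<partial>snd z)
    \<in> borel_measurable (NN \<Otimes>\<^sub>M NN)"
    by (rule nn_integral_counting_measurable[where M=M]) measurable
  then show ?case
    by (simp add: split_beta')
qed

text \<open>Each point of the list may serve as the first one and leaves the same total product, so
  the integral over points is a sum of equal terms, which the factor 1/(n+1) averages. Lists of
  another length are discarded at the base case.\<close>

lemma boltzmann_n_dirac_sum:
  assumes "set xs \<subseteq> space M" "\<psi> \<in> counting_measures M (sets M)"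
  shows "boltzmann_n n \<psi> (dirac_sum M xs) = of_bool (length xs = n) * ennreal (kappa_list M \<kappa> xs \<psi>)"
  using assms
proof (induct n arbitrary: xs \<psi>)
  case 0
  have "filter (\<lambda>x. x \<in> space M) xs = xs"
    using 0 by (auto simp: filter_id_conv)
  then show ?case
    by (simp add: emeasure_dirac_sum)
next
  case (Suc n)
  have [measurable]: "\<psi> \<in> space NN" "dirac_sum M xs \<in> space NN"
    using Suc(3) by auto
  have [measurable]: "(\<lambda>\<omega>. boltzmann_n n (a \<omega>) (b \<omega>)) \<in> borel_measurable M"
    if "a \<in> M \<rightarrow>\<^sub>M NN" "b \<in> M \<rightarrow>\<^sub>M NN" for a b
    using measurable_compose[OF measurable_Pair[OF that] boltzmann_n_measurable] by simp
  note measurable_remove_point[measurable]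
  have "(\<integral>\<^sup>+x. ennreal (\<kappa> x \<psi>) * boltzmann_n n (\<psi> \<oplus>\<^sub>m return M x) (remove_point (dirac_sum M xs) x) \<partial>dirac_sum M xs)
    = (\<Sum>x\<leftarrow>xs. ennreal (\<kappa> x \<psi>) * boltzmann_n n (\<psi> \<oplus>\<^sub>m return M x) (remove_point (dirac_sum M xs) x))"
    using Suc(2) by (intro nn_integral_dirac_sum) measurable
  also have "\<dots> = (\<Sum>x\<leftarrow>xs. of_bool (length xs = Suc n) * ennreal (kappa_list M \<kappa> xs \<psi>))"
  proof (intro arg_cong[where f=sum_list] map_cong refl)
    fix x assume x: "x \<in> set xs"
    have sub: "set (remove1 x xs) \<subseteq> space M"
      using Suc(2) set_remove1_subset[of x xs] by auto
    have "boltzmann_n n (\<psi> \<oplus>\<^sub>m return M x) (remove_point (dirac_sum M xs) x) =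
      of_bool (length (remove1 x xs) = n) * ennreal (kappa_list M \<kappa> (remove1 x xs) (\<psi> \<oplus>\<^sub>m return M x))"
      unfolding remove_point_dirac_sum[OF Suc(2) x] using sub Suc(3) by (intro Suc(1)) auto
    moreover have "length (remove1 x xs) = n \<longleftrightarrow> length xs = Suc n"
    proof -
      have "length xs \<noteq> 0" using x by auto
      moreover have "length (remove1 x xs) = length xs - 1"
        using x by (simp add: length_remove1)
      ultimately show ?thesis by linarith
    qed
    moreover have "ennreal (kappa_list M \<kappa> xs \<psi>) = ennreal (\<kappa> x \<psi>) * ennreal (kappa_list M \<kappa> (remove1 x xs) (\<psi> \<oplus>\<^sub>m return M x))"
      unfolding kappa_list_remove1[OF Suc(2,3) x] using sub Suc(3) by (intro ennreal_mult'' kappa_list_nonneg) auto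
    ultimately show "ennreal (\<kappa> x \<psi>) * boltzmann_n n (\<psi> \<oplus>\<^sub>m return M x) (remove_point (dirac_sum M xs) x) =
      of_bool (length xs = Suc n) * ennreal (kappa_list M \<kappa> xs \<psi>)"
      by (simp add: ac_simps)
  qed
  also have "\<dots> = of_nat (length xs) * (of_bool (length xs = Suc n) * ennreal (kappa_list M \<kappa> xs \<psi>))"
    by (simp add: map_replicate_const sum_list_replicate)
  finally have "boltzmann_n (Suc n) \<psi> (dirac_sum M xs) =
    ennreal (1 / real (Suc n)) * of_nat (length xs) * (of_bool (length xs = Suc n) * ennreal (kappa_list M \<kappa> xs \<psi>))"
    by (simp add: mult.assoc)
  moreover have "ennreal (1 / real (Suc n)) * of_nat (Suc n) = 1"
    unfolding ennreal_of_nat_eq_real_of_nat by (subst ennreal_mult'[symmetric]) (simp_all del: of_nat_Suc)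
  ultimately show ?case
    by (cases "length xs = Suc n") (simp_all del: of_nat_Suc)
qed

lemma boltzmann_measurable:
  assumes \<psi>: "\<psi> \<in> counting_measures M (sets M)"
  shows "boltzmann \<psi> \<in> borel_measurable NN"
proof -
  have [measurable]: "\<psi> \<in> space NN" using \<psi> by simp
  have [measurable]: "(\<lambda>\<mu>. boltzmann_n n \<psi> \<mu>) \<in> borel_measurable NN" for n
    using \<psi> measurable_compose[OF measurable_Pair1'[of \<psi> NN NN] boltzmann_n_measurable[of n]] by simp
  have "boltzmann \<psi> \<mu> = (\<Sum>n. boltzmann_n n \<psi> \<mu>)" if \<mu>: "\<mu> \<in> counting_measures M (sets M)" for \<mu>
  proof -
    obtain xs where xs: "set xs \<subseteq> space M" "\<mu> = dirac_sum M xs"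
      using counting_eq_dirac_sum[OF \<mu>] .
    have "(\<Sum>n. boltzmann_n n \<psi> \<mu>) = (\<Sum>n\<in>{length xs}. boltzmann_n n \<psi> \<mu>)"
      using xs boltzmann_n_dirac_sum[OF xs(1) \<psi>] by (intro suminf_finite) auto
    then show ?thesis
      using xs boltzmann_n_dirac_sum[OF xs(1) \<psi>] boltzmann_dirac_sum[OF xs(1) \<psi>] by simp
  qed
  then show ?thesis
    by (subst measurable_cong[of _ _ "\<lambda>\<mu>. \<Sum>n. boltzmann_n n \<psi> \<mu>"]) simp_all
qed

section \<open>Partition functions of the tails of the order\<close>

definition tail_set :: "ereal \<Rightarrow> 'a set" where
  "tail_set c = {x\<in>space M. c < ereal (\<phi> x)}"

lemma tail_set_sets [measurable]: "tail_set c \<in> sets M"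
  unfolding tail_set_def by measurable

text \<open>Integrating exp(-H) over the Poisson law means inserting points of constant weight, and
  each insertion multiplies exp(-H) by a factor \<kappa>. Hence it amounts to inserting points with
  weight \<kappa> on top of \<psi>; the exponential is the normalization of the Poisson law.\<close>

theorem partition_fun_tail_set:
  assumes \<psi>: "\<psi> \<in> counting_measures M (sets M)"
  shows "partition_fun M \<kappa> (tail_set c) \<psi> =
    ennreal (exp (- measure M (tail_set c))) * weight_above (\<lambda>_. 1) c \<psi>"
proof -
  interpret J: poisson_insertion M "tail_set c"
    by unfold_locales simp_all
  have s: "sets \<psi> = sets M"
    using counting_measuresD(1)[OF \<psi>] .
  \<comment> \<open>The identity has to hold at every \<mu>, since the induction moves from \<mu> to
    \<mu> + \<delta>_x; it is then used at the null measure.\<close>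
  have pow: "J.insert_pow n (boltzmann \<psi>) \<mu> = boltzmann \<psi> \<mu> * (insert_above c ^^ n) (\<lambda>_. 1) (\<psi> \<oplus>\<^sub>m \<mu>)"
    if "\<mu> \<in> counting_measures M (sets M)" for n \<mu>
    using that
  proof (induct n arbitrary: \<mu>)
    case (Suc n)
    have [measurable]: "(\<lambda>\<nu>. (insert_above c ^^ n) (\<lambda>_. 1) \<nu>) \<in> borel_measurable NN"
    proof -
      have "(\<lambda>\<nu>. fact n * insert_increasing n (\<lambda>_. 1) c \<nu>) \<in> borel_measurable NN"
        using insert_increasing_measurable_comp[of "\<lambda>_. 1" "\<lambda>_. c" NN "\<lambda>\<nu>. \<nu>" n] by simp
      then show ?thesis
        by (subst measurable_cong[of _ _ "\<lambda>\<nu>. fact n * insert_increasing n (\<lambda>_. 1) c \<nu>"])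
          (simp_all add: insert_above_pow)
    qed
    have sum: "\<psi> \<oplus>\<^sub>m \<mu> \<in> counting_measures M (sets M)"
      using \<psi> Suc(2) by (rule add_measure_counting)
    then have [measurable]: "\<psi> \<oplus>\<^sub>m \<mu> \<in> space NN" by simp
    have "J.insert_pow (Suc n) (boltzmann \<psi>) \<mu> =
      J.insert_op (\<lambda>\<mu>. boltzmann \<psi> \<mu> * (insert_above c ^^ n) (\<lambda>_. 1) (\<psi> \<oplus>\<^sub>m \<mu>)) \<mu>"
      using Suc by (auto intro!: J.insert_op_cong)
    also have "\<dots> = (\<integral>\<^sup>+x. boltzmann \<psi> \<mu> * (of_bool (c < ereal (\<phi> x)) * ennreal (\<kappa> x (\<psi> \<oplus>\<^sub>m \<mu>)) *
      (insert_above c ^^ n) (\<lambda>_. 1) (\<psi> \<oplus>\<^sub>m \<mu> \<oplus>\<^sub>m return M x)) \<partial>M)"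
      unfolding J.insert_op_def
    proof (rule nn_integral_cong)
      fix x assume x: "x \<in> space M"
      have "\<psi> \<oplus>\<^sub>m (\<mu> \<oplus>\<^sub>m return M x) = \<psi> \<oplus>\<^sub>m \<mu> \<oplus>\<^sub>m return M x"
        using s counting_measuresD(1)[OF Suc(2)] by (intro add_measure_assoc[symmetric]) auto
      moreover have "indicator (tail_set c) x = (of_bool (c < ereal (\<phi> x)) :: ennreal)"
        using x by (simp add: tail_set_def indicator_def)
      ultimately show "indicator (tail_set c) x * (boltzmann \<psi> (\<mu> \<oplus>\<^sub>m return M x) *
          (insert_above c ^^ n) (\<lambda>_. 1) (\<psi> \<oplus>\<^sub>m (\<mu> \<oplus>\<^sub>m return M x))) =
        boltzmann \<psi> \<mu> * (of_bool (c < ereal (\<phi> x)) * ennreal (\<kappa> x (\<psi> \<oplus>\<^sub>m \<mu>)) *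
          (insert_above c ^^ n) (\<lambda>_. 1) (\<psi> \<oplus>\<^sub>m \<mu> \<oplus>\<^sub>m return M x))"
        using boltzmann_add_return[OF Suc(2) \<psi> x] by (simp only: ac_simps)
    qed
    also have "\<dots> = boltzmann \<psi> \<mu> * insert_above c ((insert_above c ^^ n) (\<lambda>_. 1)) (\<psi> \<oplus>\<^sub>m \<mu>)"
      unfolding insert_above_def[of c "(insert_above c ^^ n) (\<lambda>_. 1)"] by (rule nn_integral_cmult) measurable
    finally show ?case by simp
  qed simp
  have "boltzmann \<psi> (null_measure M) = 1"
    using boltzmann_dirac_sum[of "[]" \<psi>] \<psi> by simp
  then have *: "J.insert_pow n (boltzmann \<psi>) (null_measure M) = fact n * insert_increasing n (\<lambda>_. 1) c \<psi>" for n
    using pow[OF null_measure_counting, of n] s insert_above_pow[where g="\<lambda>_. 1" and c=c and n=n, OF _ \<psi>] by simp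
  have "partition_fun M \<kappa> (tail_set c) \<psi> = (\<integral>\<^sup>+\<mu>. boltzmann \<psi> \<mu> \<partial>J.poisson_measure)"
    unfolding partition_fun_def boltzmann_def by (simp only: J.poisson_law_eq[OF finite_measure_axioms])
  also have "\<dots> = ennreal (exp (- measure M (tail_set c))) * J.total_weight (boltzmann \<psi>)"
    by (rule J.nn_integral_poisson_measure[OF boltzmann_measurable[OF \<psi>]])
  also have "J.total_weight (boltzmann \<psi>) = weight_above (\<lambda>_. 1) c \<psi>"
    unfolding J.total_weight_def weight_above_def * ennreal_fact_cancel ..
  finally show ?thesis .
qed

end

section \<open>The compensator of the embedding\<close>

text \<open>The right-hand side integrates a product of \<open>w\<close> over n + 1 points. Up to
  ties exactly one of them is the largest, and the factor n + 1 counts which.\<close>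

lemma ordered_power_integral:
  fixes \<phi> :: "'a \<Rightarrow> real"
  assumes "sigma_finite_measure N" and \<phi> [measurable]: "\<phi> \<in> borel_measurable N"
    and ties: "\<And>a. emeasure N {x\<in>space N. \<phi> x = a} = 0" and w [measurable]: "w \<in> borel_measurable N"
  shows "of_nat (Suc n) * (\<integral>\<^sup>+x. w x * (\<integral>\<^sup>+y. of_bool (\<phi> y < \<phi> x) * w y \<partial>N) ^ n \<partial>N) = (\<integral>\<^sup>+x. w x \<partial>N) ^ Suc n"
proof -
  interpret N: sigma_finite_measure N by fact
  \<comment> \<open>Ordered insertion starts with the smallest point; the sign of
    \<open>\<phi>\<close> is reversed because here the largest point is integrated
    outermost.\<close>
  interpret O: ordered_insertion N "\<lambda>x \<mu>. w x" "\<lambda>x. - \<phi> x"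
  proof
    have "{x\<in>space N. - \<phi> x = a} = {x\<in>space N. \<phi> x = - a}" for a
      by auto
    then show "emeasure N {x\<in>space N. - \<phi> x = a} = 0" for a
      using ties[of "- a"] by simp
  qed (auto simp: mult.commute)
  have "(O.insert_above c ^^ n) (\<lambda>_. 1) \<mu> = (\<integral>\<^sup>+x. of_bool (c < ereal (- \<phi> x)) * w x \<partial>N) ^ n" for c n \<mu>
  proof (induct n arbitrary: \<mu>)
    case (Suc n)
    then have "(O.insert_above c ^^ Suc n) (\<lambda>_. 1) \<mu> =
      (\<integral>\<^sup>+x. of_bool (c < ereal (- \<phi> x)) * w x * (\<integral>\<^sup>+x. of_bool (c < ereal (- \<phi> x)) * w x \<partial>N) ^ n \<partial>N)"
      unfolding funpow.simps o_apply O.insert_above_def[of c "(O.insert_above c ^^ n) (\<lambda>_. 1)"] by simp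
    also have "\<dots> = (\<integral>\<^sup>+x. of_bool (c < ereal (- \<phi> x)) * w x \<partial>N) * (\<integral>\<^sup>+x. of_bool (c < ereal (- \<phi> x)) * w x \<partial>N) ^ n"
      by (rule nn_integral_multc) measurable
    finally show ?case by simp
  qed simp
  then have inc: "fact n * O.insert_increasing n (\<lambda>_. 1) c \<mu> = (\<integral>\<^sup>+x. of_bool (c < ereal (- \<phi> x)) * w x \<partial>N) ^ n"
    if "\<mu> \<in> counting_measures N (sets N)" for c n \<mu>
    using O.insert_above_pow[where g="\<lambda>_. 1" and c=c and n=n, OF _ that] by simp
  have [measurable]: "(\<lambda>x. O.insert_increasing n (\<lambda>_. 1) (ereal (- \<phi> x)) (null_measure N \<oplus>\<^sub>m return N x)) \<in> borel_measurable N"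
    by (rule O.insert_increasing_measurable_comp) measurable
  have "(\<integral>\<^sup>+x. w x \<partial>N) ^ Suc n = fact (Suc n) * O.insert_increasing (Suc n) (\<lambda>_. 1) (-\<infinity>) (null_measure N)"
    using inc[OF null_measure_counting, of "Suc n" "-\<infinity>"] by (simp del: O.insert_increasing.simps fact_Suc)
  also have "\<dots> = of_nat (Suc n) * (fact n * (\<integral>\<^sup>+x. w x * O.insert_increasing n (\<lambda>_. 1) (ereal (- \<phi> x)) (null_measure N \<oplus>\<^sub>m return N x) \<partial>N))"
    by (simp add: mult.assoc)
  also have "fact n * (\<integral>\<^sup>+x. w x * O.insert_increasing n (\<lambda>_. 1) (ereal (- \<phi> x)) (null_measure N \<oplus>\<^sub>m return N x) \<partial>N) =
    (\<integral>\<^sup>+x. fact n * (w x * O.insert_increasing n (\<lambda>_. 1) (ereal (- \<phi> x)) (null_measure N \<oplus>\<^sub>m return N x)) \<partial>N)"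
    by (rule nn_integral_cmult[symmetric]) measurable
  also have "\<dots> = (\<integral>\<^sup>+x. w x * (\<integral>\<^sup>+y. of_bool (\<phi> y < \<phi> x) * w y \<partial>N) ^ n \<partial>N)"
    by (intro nn_integral_cong) (simp only: mult.left_commute[of "fact n"] inc add_return_counting null_measure_counting subset_refl
      ereal_less neg_less_iff_less less_ereal.simps)
  finally show ?thesis ..
qed

text \<open>Formally the integral of dG / (f - G), where G(x) is the mass of \<open>w\<close> before
  \<open>x\<close>. The geometric series is integrated term by term with
  \<open>ordered_power_integral\<close> and sums to -ln (1 - a / f); it converges because a <
  f.\<close>

lemma log_integral:
  fixes \<phi> :: "'a \<Rightarrow> real"
  assumes "sigma_finite_measure N" and \<phi> [measurable]: "\<phi> \<in> borel_measurable N"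
    and ties: "\<And>a. emeasure N {x\<in>space N. \<phi> x = a} = 0" and w [measurable]: "w \<in> borel_measurable N"
    and total: "(\<integral>\<^sup>+x. w x \<partial>N) = ennreal a" and a: "0 \<le> a" "a < f"
    and h: "\<And>x. x \<in> space N \<Longrightarrow> w x \<noteq> 0 \<Longrightarrow> h x + (\<integral>\<^sup>+y. of_bool (\<phi> y < \<phi> x) * w y \<partial>N) = ennreal f"
  shows "(\<integral>\<^sup>+x. w x / h x \<partial>N) = ennreal (ln (f / (f - a)))"
proof -
  interpret N: sigma_finite_measure N by fact
  define G where "G x = (\<integral>\<^sup>+y. of_bool (\<phi> y < \<phi> x) * w y \<partial>N)" for x
  have [measurable]: "G \<in> borel_measurable N"
    unfolding G_def by measurable
  have f: "0 < f" using a by simp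
  have exp: "w x / h x = (\<Sum>n. ennreal (1 / f ^ Suc n) * (w x * G x ^ n))" if x: "x \<in> space N" for x
  proof (cases "w x = 0")
    case False
    have "G x \<le> (\<integral>\<^sup>+y. w y \<partial>N)"
      unfolding G_def by (intro nn_integral_mono) (auto simp: of_bool_def)
    then have "G x \<le> ennreal a"
      using total by simp
    then obtain g where g: "G x = ennreal g" "0 \<le> g" "g \<le> a"
      using a by (cases "G x") (auto simp: ennreal_le_iff top_unique)
    have "h x + ennreal g = ennreal (f - g) + ennreal g"
      using h[OF x False] g a by (simp add: G_def[symmetric] flip: ennreal_plus)
    then have hx: "h x = ennreal (f - g)"
      by (simp add: add.commute[of _ "ennreal g"] ennreal_add_left_cancel)
    have r: "norm (g / f) < 1"
      using g a f by simp
    have "(\<Sum>n. ennreal (1 / f ^ Suc n) * ennreal g ^ n) = (\<Sum>n. ennreal (1 / f * (g / f) ^ n))"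
      using g f by (intro suminf_cong) (simp add: ennreal_power power_divide flip: ennreal_mult')
    also have "\<dots> = ennreal (\<Sum>n. 1 / f * (g / f) ^ n)"
      using g f summable_mult[OF summable_geometric[OF r]] by (intro suminf_ennreal2) auto
    also have "(\<Sum>n. 1 / f * (g / f) ^ n) = 1 / (f - g)"
      unfolding suminf_mult[OF summable_geometric[OF r]] suminf_geometric[OF r]
      using f g a by (simp add: field_simps)
    finally have "w x * (\<Sum>n. ennreal (1 / f ^ Suc n) * G x ^ n) = w x / h x"
      using g a unfolding hx by (simp add: divide_ennreal_def inverse_ennreal inverse_eq_divide)
    then show ?thesis
      by (simp add: ac_simps flip: ennreal_suminf_cmult)
  qed simp
  have int: "(\<integral>\<^sup>+x. w x * G x ^ n \<partial>N) = ennreal (a ^ Suc n / real (Suc n))" for n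
  proof -
    have "of_nat (Suc n) * (\<integral>\<^sup>+x. w x * G x ^ n \<partial>N) = ennreal a ^ Suc n"
      using ordered_power_integral[OF assms(1) \<phi> ties w, of n] total unfolding G_def by simp
    also have "\<dots> = of_nat (Suc n) * ennreal (a ^ Suc n / real (Suc n))"
      unfolding ennreal_of_nat_eq_real_of_nat using a by (simp add: ennreal_power flip: ennreal_mult' del: of_nat_Suc power_Suc)
    finally show ?thesis
      by (simp add: ennreal_mult_cancel_left del: of_nat_Suc)
  qed
  have "(\<integral>\<^sup>+x. w x / h x \<partial>N) = (\<integral>\<^sup>+x. (\<Sum>n. ennreal (1 / f ^ Suc n) * (w x * G x ^ n)) \<partial>N)"
    using exp by (intro nn_integral_cong) auto
  also have "\<dots> = (\<Sum>n. \<integral>\<^sup>+x. ennreal (1 / f ^ Suc n) * (w x * G x ^ n) \<partial>N)"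
    by (rule nn_integral_suminf) measurable
  also have "\<dots> = (\<Sum>n. ennreal ((a / f) ^ Suc n / real (Suc n)))"
  proof (rule suminf_cong)
    fix n
    have "(\<integral>\<^sup>+x. ennreal (1 / f ^ Suc n) * (w x * G x ^ n) \<partial>N) = ennreal (1 / f ^ Suc n) * ennreal (a ^ Suc n / real (Suc n))"
      unfolding int[symmetric] by (rule nn_integral_cmult) measurable
    then show "(\<integral>\<^sup>+x. ennreal (1 / f ^ Suc n) * (w x * G x ^ n) \<partial>N) = ennreal ((a / f) ^ Suc n / real (Suc n))"
      using a f by (simp add: power_divide mult.commute flip: ennreal_mult' del: of_nat_Suc power_Suc)
  qed
  also have "\<dots> = ennreal (ln (f / (f - a)))"
  proof -
    have "(\<lambda>n. - ((a / f) ^ n) / real n) sums ln (1 - a / f)"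
      using ln_series'[of "- (a / f)"] a f by simp
    then have "(\<lambda>n. (a / f) ^ n / real n) sums - ln (1 - a / f)"
      using sums_minus by fastforce
    \<comment> \<open>In the logarithmic series the term for n = 0 is a division by zero, hence 0,
      and dropping it does not change the sum.\<close>
    then have "(\<lambda>n. (a / f) ^ Suc n / real (Suc n)) sums - ln (1 - a / f)"
      by (subst sums_Suc_iff) simp
    moreover have "- ln (1 - a / f) = ln (f / (f - a))"
    proof -
      have "1 - a / f = (f - a) / f"
        using f by (simp add: field_simps)
      then show ?thesis
        using a f by (simp add: ln_div)
    qed
    ultimately show ?thesis
      using a f by (subst suminf_ennreal2) (auto simp: sums_iff simp del: power_Suc of_nat_Suc)
  qed
  finally show ?thesis .
qed

context gibbs_setting
begin

abbreviation tail_weight :: "ereal \<Rightarrow> 'a measure \<Rightarrow> ennreal" where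
  "tail_weight \<equiv> weight_above (\<lambda>_. 1)"

lemma tail_weight_step:
  "\<mu> \<in> counting_measures M (sets M) \<Longrightarrow> tail_weight c \<mu> =
    1 + (\<integral>\<^sup>+x. of_bool (c < ereal (\<phi> x)) * (ennreal (\<kappa> x \<mu>) * tail_weight (ereal (\<phi> x)) (\<mu> \<oplus>\<^sub>m return M x)) \<partial>M)"
  using weight_above_step[of "\<lambda>_. 1" \<mu> c] by (simp add: mult.assoc)

lemma tail_weight_ge_1: "\<mu> \<in> counting_measures M (sets M) \<Longrightarrow> 1 \<le> tail_weight c \<mu>"
  by (subst tail_weight_step) auto

lemma tail_weight_antimono:
  assumes "\<mu> \<in> counting_measures M (sets M)" "c \<le> b"
  shows "tail_weight b \<mu> \<le> tail_weight c \<mu>"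
  unfolding tail_weight_step[OF assms(1)] using assms(2)
  by (intro add_left_mono nn_integral_mono mult_right_mono) (auto simp: of_bool_def)

lemma tail_weight_measurable [measurable (raw)]:
  "a \<in> \<Omega> \<rightarrow>\<^sub>M borel \<Longrightarrow> b \<in> \<Omega> \<rightarrow>\<^sub>M NN \<Longrightarrow> (\<lambda>\<omega>. tail_weight (a \<omega>) (b \<omega>)) \<in> borel_measurable \<Omega>"
  by (rule weight_above_measurable) simp_all

text \<open>When the configuration has no mass beyond \<open>c\<close>, cutting it off at a later
  \<open>x\<close> loses nothing. The embedding evaluates \<open>p\<close> in this situation, so the
  truncation in the definition of \<open>p\<close> is invisible to it.\<close>

lemma restrict_to_below:
  assumes \<mu>: "\<mu> \<in> counting_measures M (sets M)" and null: "emeasure \<mu> (tail_set c) = 0" and c: "c < ereal (\<phi> x)"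
  shows "restrict_to \<mu> (below M \<phi> x) = \<mu>"
proof (rule measure_eqI)
  have s: "sets \<mu> = sets M"
    using counting_measuresD(1)[OF \<mu>] .
  fix A assume "A \<in> sets (restrict_to \<mu> (below M \<phi> x))"
  then have A: "A \<in> sets M" using s by simp
  have b: "below M \<phi> x \<in> sets M"
    unfolding below_def by measurable
  have "emeasure \<mu> (A - below M \<phi> x) \<le> emeasure \<mu> (tail_set c)"
  proof (rule emeasure_mono)
    show "A - below M \<phi> x \<subseteq> tail_set c"
    proof
      fix y assume y: "y \<in> A - below M \<phi> x"
      then have "y \<in> space M" "\<phi> x \<le> \<phi> y"
        using sets.sets_into_space[OF A] by (auto simp: below_def)
      with c show "y \<in> tail_set c"
        by (auto simp: tail_set_def intro: less_le_trans)
    qed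
  qed (simp add: s)
  with null have "emeasure \<mu> (A - below M \<phi> x) = 0" by simp
  moreover have "emeasure \<mu> (A \<inter> below M \<phi> x) + emeasure \<mu> (A - below M \<phi> x) = emeasure \<mu> A"
    using A b s by (subst plus_emeasure) (auto simp: Int_Diff_Un)
  ultimately show "emeasure (restrict_to \<mu> (below M \<phi> x)) A = emeasure \<mu> A"
    using A b s by (simp add: emeasure_restrict_to)
qed simp

lemma above_eq: "above M \<phi> x = tail_set (ereal (\<phi> x))"
  by (simp add: above_def tail_set_def)

text \<open>Numerator and denominator refer to the same tail, so the normalizing exponentials of the
  two partition functions cancel; being positive and finite, they cancel in \<open>ennreal\<close>
  even against infinite tail weights.\<close>

lemma p_fun_eq_restricted:
  fixes x :: 'a
  assumes \<psi>: "\<psi> \<in> counting_measures M (sets M)"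
  defines "\<psi>' \<equiv> restrict_to \<psi> (below M \<phi> x)"
  shows "p_fun M \<phi> \<kappa> x \<psi> = ennreal (\<kappa> x \<psi>') * tail_weight (ereal (\<phi> x)) (\<psi>' \<oplus>\<^sub>m return M x) / tail_weight (ereal (\<phi> x)) \<psi>'"
proof -
  have b: "below M \<phi> x \<in> sets M"
    unfolding below_def by measurable
  have \<psi>': "\<psi>' \<in> counting_measures M (sets M)"
    unfolding \<psi>'_def using \<psi> b by (intro restrict_to_counting) auto
  define e where "e = ennreal (exp (- measure M (tail_set (ereal (\<phi> x)))))"
  have e: "e \<noteq> 0" "e \<noteq> \<top>" "0 < e" "e < \<top>"
    by (auto simp: e_def)
  have "a * (e * b) / (e * c) = a * b / c" for a b c
  proof -
    have "inverse (e * c) = inverse e * inverse c"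
      by (rule ennreal_inverse_mult') (use e in auto)
    then have "a * (e * b) / (e * c) = a * b * inverse c * (e * inverse e)"
      by (simp add: divide_ennreal_def ac_simps)
    also have "e * inverse e = 1"
      using e ennreal_divide_self[of e] by (simp add: divide_ennreal_def)
    finally show ?thesis
      by (simp add: divide_ennreal_def)
  qed
  then show ?thesis
    using \<psi>' unfolding p_fun_def Let_def above_eq \<psi>'_def[symmetric]
    by (simp add: partition_fun_tail_set e_def[symmetric])
qed

lemma p_fun_eq:
  assumes \<mu>: "\<mu> \<in> counting_measures M (sets M)" and "emeasure \<mu> (tail_set c) = 0" "c < ereal (\<phi> x)"
  shows "p_fun M \<phi> \<kappa> x \<mu> = ennreal (\<kappa> x \<mu>) * tail_weight (ereal (\<phi> x)) (\<mu> \<oplus>\<^sub>m return M x) / tail_weight (ereal (\<phi> x)) \<mu>"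
  using p_fun_eq_restricted[OF \<mu>, of x] restrict_to_below[OF assms] by simp

text \<open>The definition of \<open>p\<close> runs through a definite description and a choice of
  lists, whereas the formula in tail weights consists of measurable operations.\<close>

lemma p_fun_measurable:
  assumes a [measurable]: "a \<in> \<Omega> \<rightarrow>\<^sub>M M" and b [measurable]: "b \<in> \<Omega> \<rightarrow>\<^sub>M NN"
  shows "(\<lambda>\<omega>. p_fun M \<phi> \<kappa> (a \<omega>) (b \<omega>)) \<in> borel_measurable \<Omega>"
proof -
  have [measurable]: "(\<lambda>\<omega>. restrict_to (b \<omega>) (below M \<phi> (a \<omega>))) \<in> \<Omega> \<rightarrow>\<^sub>M NN"
  proof (rule measurable_restrict_to[OF b])
    have "{z\<in>space (\<Omega> \<Otimes>\<^sub>M M). \<phi> (snd z) < \<phi> (a (fst z))} \<in> sets (\<Omega> \<Otimes>\<^sub>M M)"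
      by measurable
    also have "{z\<in>space (\<Omega> \<Otimes>\<^sub>M M). \<phi> (snd z) < \<phi> (a (fst z))} = {(\<omega>, x) \<in> space \<Omega> \<times> space M. x \<in> below M \<phi> (a \<omega>)}"
      by (auto simp: space_pair_measure below_def)
    finally show "{(\<omega>, x) \<in> space \<Omega> \<times> space M. x \<in> below M \<phi> (a \<omega>)} \<in> sets (\<Omega> \<Otimes>\<^sub>M M)" .
    show "below M \<phi> (a \<omega>) \<in> sets M" for \<omega>
      unfolding below_def by measurable
  qed
  have "(\<lambda>\<omega>. let \<psi>' = restrict_to (b \<omega>) (below M \<phi> (a \<omega>)) in
      ennreal (\<kappa> (a \<omega>) \<psi>') * tail_weight (ereal (\<phi> (a \<omega>))) (\<psi>' \<oplus>\<^sub>m return M (a \<omega>)) / tail_weight (ereal (\<phi> (a \<omega>))) \<psi>')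
    \<in> borel_measurable \<Omega>"
    unfolding Let_def by measurable
  then show ?thesis
    using measurable_space[OF b] by (subst measurable_cong[OF p_fun_eq_restricted]) (auto simp: Let_def)
qed

text \<open>\<open>log_integral\<close> with \<open>w\<close> the integrand of the recursion on (c,
  b] and \<open>h\<close> the tail weight at \<open>x\<close>: the mass of \<open>w\<close> between
  \<open>c\<close> and \<open>x\<close> is exactly what the tail weight loses on the way, so the two
  add up to the tail weight at \<open>c\<close>.\<close>

lemma p_fun_integral:
  assumes \<mu>: "\<mu> \<in> counting_measures M (sets M)" and null: "emeasure \<mu> (tail_set c) = 0"
    and fin: "tail_weight c \<mu> < \<infinity>" and cb: "c \<le> b"
  shows "(\<integral>\<^sup>+x. of_bool (c < ereal (\<phi> x) \<and> ereal (\<phi> x) \<le> b) * p_fun M \<phi> \<kappa> x \<mu> \<partial>M) =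
    ennreal (ln (enn2real (tail_weight c \<mu>) / enn2real (tail_weight b \<mu>)))"
proof -
  have [measurable]: "\<mu> \<in> space NN" using \<mu> by simp
  define v where "v x = ennreal (\<kappa> x \<mu>) * tail_weight (ereal (\<phi> x)) (\<mu> \<oplus>\<^sub>m return M x)" for x
  have [measurable]: "v \<in> borel_measurable M"
    unfolding v_def by measurable
  have step: "tail_weight a \<mu> = 1 + (\<integral>\<^sup>+x. of_bool (a < ereal (\<phi> x)) * v x \<partial>M)" for a
    unfolding v_def using \<mu> by (rule tail_weight_step)
  have split: "tail_weight a \<mu> = tail_weight a' \<mu> + (\<integral>\<^sup>+x. of_bool (a < ereal (\<phi> x) \<and> ereal (\<phi> x) \<le> a') * v x \<partial>M)"
    if aa': "a \<le> a'" for a a'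
  proof -
    have "(\<integral>\<^sup>+x. of_bool (a < ereal (\<phi> x)) * v x \<partial>M) =
      (\<integral>\<^sup>+x. of_bool (a' < ereal (\<phi> x)) * v x + of_bool (a < ereal (\<phi> x) \<and> ereal (\<phi> x) \<le> a') * v x \<partial>M)"
      using aa' by (intro nn_integral_cong) (auto simp: of_bool_def)
    also have "\<dots> = (\<integral>\<^sup>+x. of_bool (a' < ereal (\<phi> x)) * v x \<partial>M) + (\<integral>\<^sup>+x. of_bool (a < ereal (\<phi> x) \<and> ereal (\<phi> x) \<le> a') * v x \<partial>M)"
      by (rule nn_integral_add) measurable
    finally show ?thesis
      by (simp add: step add.assoc)
  qed
  define w where "w x = of_bool (c < ereal (\<phi> x) \<and> ereal (\<phi> x) \<le> b) * v x" for x
  have [measurable]: "w \<in> borel_measurable M"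
    unfolding w_def by measurable
  obtain f where f: "tail_weight c \<mu> = ennreal f" "0 \<le> f"
    using fin by (cases "tail_weight c \<mu>") auto
  obtain f' where f': "tail_weight b \<mu> = ennreal f'" "0 \<le> f'"
    using tail_weight_antimono[OF \<mu> cb] f by (cases "tail_weight b \<mu>") (auto simp: top_unique)
  \<comment> \<open>Inserting no point contributes 1 to every tail weight. This gives f - f' < f,
    the strict inequality that \<open>log_integral\<close> asks for.\<close>
  have "1 \<le> f'"
    using tail_weight_ge_1[OF \<mu>, of b] f' by simp
  have ff': "f' \<le> f"
    using tail_weight_antimono[OF \<mu> cb] f f' by simp
  have "ennreal f' + (\<integral>\<^sup>+x. w x \<partial>M) = ennreal f' + ennreal (f - f')"
    using split[OF cb] ff' f f' by (simp add: w_def flip: ennreal_plus)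
  then have total: "(\<integral>\<^sup>+x. w x \<partial>M) = ennreal (f - f')"
    by (simp add: ennreal_add_left_cancel)
  have "(\<integral>\<^sup>+x. w x / tail_weight (ereal (\<phi> x)) \<mu> \<partial>M) = ennreal (ln (f / (f - (f - f'))))"
  proof (rule log_integral[OF _ phi_measurable no_ties _ total])
    fix x assume x: "x \<in> space M" "w x \<noteq> 0"
    then have cx: "c < ereal (\<phi> x)" "ereal (\<phi> x) \<le> b"
      by (auto simp: w_def split: if_splits)
    have "AE y in M. \<phi> y \<noteq> \<phi> x"
      using no_ties[of "\<phi> x"] by (intro AE_I[of _ _ "{y\<in>space M. \<phi> y = \<phi> x}"]) auto
    then have "AE y in M. of_bool (c < ereal (\<phi> y) \<and> ereal (\<phi> y) \<le> ereal (\<phi> x)) * v y = of_bool (\<phi> y < \<phi> x) * w y"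
    proof eventually_elim
      fix y assume "\<phi> y \<noteq> \<phi> x"
      moreover have "ereal (\<phi> y) \<le> b" if "\<phi> y < \<phi> x"
        using that cx(2) by (meson ereal_less_eq(3) less_imp_le order_trans)
      ultimately show "of_bool (c < ereal (\<phi> y) \<and> ereal (\<phi> y) \<le> ereal (\<phi> x)) * v y = of_bool (\<phi> y < \<phi> x) * w y"
        by (auto simp: w_def of_bool_def)
    qed
    then have "(\<integral>\<^sup>+y. of_bool (c < ereal (\<phi> y) \<and> ereal (\<phi> y) \<le> ereal (\<phi> x)) * v y \<partial>M) = (\<integral>\<^sup>+y. of_bool (\<phi> y < \<phi> x) * w y \<partial>M)"
      by (rule nn_integral_cong_AE)
    then show "tail_weight (ereal (\<phi> x)) \<mu> + (\<integral>\<^sup>+y. of_bool (\<phi> y < \<phi> x) * w y \<partial>M) = ennreal f"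
      using split[of c "ereal (\<phi> x)"] cx f by simp
  qed (use ff' \<open>1 \<le> f'\<close> sigma_finite_measure_axioms in auto)
  moreover have "(\<integral>\<^sup>+x. of_bool (c < ereal (\<phi> x) \<and> ereal (\<phi> x) \<le> b) * p_fun M \<phi> \<kappa> x \<mu> \<partial>M) =
    (\<integral>\<^sup>+x. w x / tail_weight (ereal (\<phi> x)) \<mu> \<partial>M)"
    using p_fun_eq[OF \<mu> null] by (intro nn_integral_cong) (auto simp: w_def v_def)
  ultimately show ?thesis
    using f f' by simp
qed

end

section \<open>The Mecke equation on the product space\<close>

lemma space_half_line [simp]: "space half_line = {0..}"
  by (simp add: half_line_def space_restrict_space)

lemma measurable_half_line_borel [measurable]: "(\<lambda>t. t) \<in> borel_measurable half_line"
  unfolding half_line_def by (intro measurable_restrict_space1) simp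

lemma emeasure_half_line_Icc: "emeasure half_line {0..a} = ennreal a"
proof (cases "0 \<le> a")
  case True
  then show ?thesis
    unfolding half_line_def by (subst emeasure_restrict_space) auto
next
  case False
  then show ?thesis
    by (simp add: ennreal_neg)
qed

lemma emeasure_lborel_atLeast: "emeasure lborel {0 :: real..} = \<top>"
proof (rule ccontr)
  assume "emeasure lborel {0 :: real..} \<noteq> \<top>"
  then obtain r where r: "emeasure lborel {0 :: real..} = ennreal r" "0 \<le> r"
    by (cases "emeasure lborel {0 :: real..}") auto
  have "emeasure lborel {0..r + 1} \<le> emeasure lborel {0 :: real..}"
    by (intro emeasure_mono) auto
  with r show False by simp
qed

lemma emeasure_half_line_le: "emeasure half_line {t. 0 \<le> t \<and> ennreal t \<le> a} = a"
proof (cases a)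
  case (real r)
  then have "{t. 0 \<le> t \<and> ennreal t \<le> a} = {0..r}"
    by auto
  then show ?thesis
    using real by (simp add: emeasure_half_line_Icc)
next
  case top
  then have "{t. 0 \<le> t \<and> ennreal t \<le> a} = {0..}"
    by auto
  then show ?thesis
    using top unfolding half_line_def by (simp add: emeasure_restrict_space emeasure_lborel_atLeast)
qed

lemma sigma_finite_half_line: "sigma_finite_measure half_line"
  unfolding half_line_def by (rule sigma_finite_measure_restrict_space) (auto intro: lborel.sigma_finite_measure_axioms)

locale marked_space = finite_measure M for M :: "'a measure"
begin

sublocale L: sigma_finite_measure half_line
  by (rule sigma_finite_half_line)

sublocale pair_sigma_finite M half_line ..

abbreviation "MR \<equiv> M \<Otimes>\<^sub>M half_line"
abbreviation "LL \<equiv> counting_algebra MR (strip_sets M)"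

sublocale MR: sigma_finite_measure MR ..

text \<open>The strips exhaust the space and have finite intensity because \<open>M\<close> is
  finite, so a Poisson process restricted to one of them has finitely many points.\<close>

definition strip :: "nat \<Rightarrow> ('a \<times> real) set" where
  "strip m = space M \<times> {0..real m}"

lemma strip_sets_MR [measurable]: "strip m \<in> sets MR"
proof -
  have "{0..real m} \<in> sets half_line"
    by (auto simp: half_line_def sets_restrict_space)
  then show ?thesis
    unfolding strip_def by (intro pair_measureI) auto
qed

lemma space_MR: "space MR = space M \<times> {0..}"
  by (simp add: space_pair_measure)

lemma UN_strip: "(\<Union>m. strip m) = space MR"
  by (auto simp: strip_def space_MR intro: real_arch_simple)

lemma strip_mono: "m \<le> n \<Longrightarrow> strip m \<subseteq> strip n"
  by (auto simp: strip_def)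

lemma incseq_strip: "incseq strip"
  using strip_mono by (auto simp: incseq_def)

lemma strip_in_strip_sets: "A \<in> sets MR \<Longrightarrow> A \<inter> strip m \<in> strip_sets M"
proof -
  assume "A \<in> sets MR"
  then have "A \<inter> strip m \<in> sets MR"
    by (intro sets.Int strip_sets_MR)
  moreover have "A \<inter> strip m \<subseteq> space M \<times> {0..real m}"
    by (auto simp: strip_def)
  ultimately show ?thesis
    unfolding strip_sets_def by blast
qed

lemma ex_strip: "x \<in> space M \<Longrightarrow> 0 \<le> t \<Longrightarrow> \<exists>m. (x, t) \<in> strip m"
  by (auto simp: strip_def intro: real_arch_simple)

lemma strip_sets_sub: "strip_sets M \<subseteq> sets MR"
  by (auto simp: strip_sets_def)

lemma emeasure_strip: "emeasure MR (strip m) \<noteq> \<infinity>"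
proof -
  have "{0..real m} \<in> sets half_line"
    by (auto simp: half_line_def sets_restrict_space)
  then have "emeasure MR (strip m) = emeasure M (space M) * ennreal (real m)"
    unfolding strip_def by (subst L.emeasure_pair_measure_Times) (simp_all add: emeasure_half_line_Icc)
  then show ?thesis
    by (simp add: ennreal_mult_eq_top_iff)
qed

lemma LL_sets: "\<theta> \<in> counting_measures MR (strip_sets M) \<Longrightarrow> sets \<theta> = sets MR"
  by (rule counting_measuresD)

lemma LL_strip_finite: "\<theta> \<in> counting_measures MR (strip_sets M) \<Longrightarrow> emeasure \<theta> (strip m) \<noteq> \<infinity>"
  using counting_measuresD(2)[of \<theta> MR "strip_sets M" "strip m"] strip_in_strip_sets[OF strip_sets_MR, of m m] by auto

lemma N_loc_alg_eq: "N_loc_alg M = LL"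
  by (simp add: N_loc_alg_def)

lemma nn_integral_LL_measurable:
  assumes k: "k \<in> \<Omega> \<rightarrow>\<^sub>M LL" and f: "f \<in> borel_measurable (\<Omega> \<Otimes>\<^sub>M MR)"
  shows "(\<lambda>\<omega>. \<integral>\<^sup>+z. f (\<omega>, z) \<partial>k \<omega>) \<in> borel_measurable \<Omega>"
proof (rule nn_integral_kernel_measurable[OF _ _ incseq_strip strip_sets_MR UN_strip _ f])
  have *: "k \<omega> \<in> counting_measures MR (strip_sets M)" if "\<omega> \<in> space \<Omega>" for \<omega>
    using measurable_space[OF k that] by simp
  show "sets (k \<omega>) = sets MR" if "\<omega> \<in> space \<Omega>" for \<omega>
    using LL_sets[OF *[OF that]] .
  show "(\<lambda>\<omega>. emeasure (k \<omega>) B) \<in> borel_measurable \<Omega>" if "B \<in> sets MR" for B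
    using measurable_compose[OF k measurable_emeasure_counting_algebra[OF that]] .
  show "emeasure (k \<omega>) (strip i) \<noteq> \<infinity>" if "\<omega> \<in> space \<Omega>" for \<omega> i
    using LL_strip_finite[OF *[OF that]] .
qed

lemma emeasure_LL_measurable:
  assumes k [measurable]: "k \<in> \<Omega> \<rightarrow>\<^sub>M LL" and A: "{z\<in>space (\<Omega> \<Otimes>\<^sub>M MR). snd z \<in> A (fst z)} \<in> sets (\<Omega> \<Otimes>\<^sub>M MR)"
    and sub: "\<And>\<omega>. \<omega> \<in> space \<Omega> \<Longrightarrow> A \<omega> \<subseteq> space MR"
  shows "(\<lambda>\<omega>. emeasure (k \<omega>) (A \<omega>)) \<in> borel_measurable \<Omega>"
proof -
  let ?A = "{z\<in>space (\<Omega> \<Otimes>\<^sub>M MR). snd z \<in> A (fst z)}"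
  have "(\<lambda>\<omega>. \<integral>\<^sup>+z. indicator ?A (\<omega>, z) \<partial>k \<omega>) \<in> borel_measurable \<Omega>"
    using A by (intro nn_integral_LL_measurable k) simp
  moreover have "(\<integral>\<^sup>+z. indicator ?A (\<omega>, z) \<partial>k \<omega>) = emeasure (k \<omega>) (A \<omega>)" if \<omega>: "\<omega> \<in> space \<Omega>" for \<omega>
  proof -
    have "Pair \<omega> -` ?A = A \<omega>"
      using \<omega> sub[OF \<omega>] by (auto simp: space_pair_measure)
    then have "A \<omega> \<in> sets (k \<omega>)"
      using sets_Pair1[OF A, of \<omega>] LL_sets measurable_space[OF k \<omega>] by simp
    moreover have "indicator ?A (\<omega>, z) = (indicator (A \<omega>) z :: ennreal)" for z
      using \<omega> sub[OF \<omega>] by (auto simp: space_pair_measure split: split_indicator)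
    ultimately show ?thesis
      by simp
  qed
  ultimately show ?thesis
    by (simp cong: measurable_cong)
qed

lemma restrict_strip_measurable [measurable]: "(\<lambda>\<theta>. restrict_to \<theta> (strip m)) \<in> LL \<rightarrow>\<^sub>M fin_counting MR"
proof (rule measurable_counting_algebra)
  fix \<theta> assume "\<theta> \<in> space LL"
  then show "restrict_to \<theta> (strip m) \<in> counting_measures MR (sets MR)"
    using strip_in_strip_sets strip_sets_sub by (intro restrict_to_counting[of _ _ "strip_sets M"]) auto
next
  fix B assume B: "B \<in> sets MR"
  then have "(\<lambda>\<theta>. emeasure \<theta> (B \<inter> strip m)) \<in> borel_measurable LL"
    by (intro measurable_emeasure_counting_algebra) auto
  moreover have "emeasure (restrict_to \<theta> (strip m)) B = emeasure \<theta> (B \<inter> strip m)" if "\<theta> \<in> space LL" for \<theta>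
    using that B by (simp add: emeasure_restrict_to LL_sets)
  ultimately show "(\<lambda>\<theta>. emeasure (restrict_to \<theta> (strip m)) B) \<in> borel_measurable LL"
    by (subst measurable_cong)
qed

lemma restrict_strip_add_return:
  assumes \<theta>: "\<theta> \<in> counting_measures MR (strip_sets M)" and z: "z \<in> strip m"
  shows "restrict_to (\<theta> \<oplus>\<^sub>m return MR z) (strip m) = restrict_to \<theta> (strip m) \<oplus>\<^sub>m return MR z"
  using LL_sets[OF \<theta>] z
  by (intro measure_eqI) (auto simp: emeasure_restrict_to emeasure_add_measure split: split_indicator)

text \<open>Events that depend on the configuration through one strip only. There the finite theory
  applies, and these events generate the product sigma-field.\<close>

definition local_sets :: "(('a \<times> real) \<times> ('a \<times> real) measure) set set" where
  "local_sets = {{(z, \<theta>). z \<in> strip m \<and> \<theta> \<in> space LL \<and> (z, restrict_to \<theta> (strip m)) \<in> D} | m D.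
    D \<in> sets (MR \<Otimes>\<^sub>M fin_counting MR)}"

lemma local_setsI:
  "D \<in> sets (MR \<Otimes>\<^sub>M fin_counting MR) \<Longrightarrow>
    {(z, \<theta>). z \<in> strip m \<and> \<theta> \<in> space LL \<and> (z, restrict_to \<theta> (strip m)) \<in> D} \<in> local_sets"
  by (auto simp: local_sets_def)

text \<open>Two local sets over different strips have to be compared over the larger one; this is
  what closes \<open>local_sets\<close> under intersection.\<close>

lemma local_sets_mono:
  assumes D: "D \<in> sets (MR \<Otimes>\<^sub>M fin_counting MR)" and mn: "m \<le> n"
  obtains D' where "D' \<in> sets (MR \<Otimes>\<^sub>M fin_counting MR)"
    "{(z, \<theta>). z \<in> strip m \<and> \<theta> \<in> space LL \<and> (z, restrict_to \<theta> (strip m)) \<in> D} =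
     {(z, \<theta>). z \<in> strip n \<and> \<theta> \<in> space LL \<and> (z, restrict_to \<theta> (strip n)) \<in> D'}"
proof
  have [measurable]: "(\<lambda>\<eta>. restrict_to \<eta> (strip m)) \<in> fin_counting MR \<rightarrow>\<^sub>M fin_counting MR"
  proof (rule measurable_restrict_to[where B="\<lambda>_. strip m" and \<Omega>="fin_counting MR"])
    have "{(\<omega>, x) \<in> space (fin_counting MR) \<times> space MR. x \<in> strip m} = space (fin_counting MR) \<times> strip m"
      using sets.sets_into_space[OF strip_sets_MR] by auto
    then show "{(\<omega>, x) \<in> space (fin_counting MR) \<times> space MR. x \<in> strip m} \<in> sets (fin_counting MR \<Otimes>\<^sub>M MR)"
      by (simp only: pair_measureI sets.top strip_sets_MR)
  qed auto
  note D[measurable]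
  let ?D' = "{w\<in>space (MR \<Otimes>\<^sub>M fin_counting MR). fst w \<in> strip m \<and> (fst w, restrict_to (snd w) (strip m)) \<in> D}"
  show "?D' \<in> sets (MR \<Otimes>\<^sub>M fin_counting MR)"
    by measurable
  have eq: "restrict_to (restrict_to \<theta> (strip n)) (strip m) = restrict_to \<theta> (strip m)" if "\<theta> \<in> space LL" for \<theta>
  proof (rule measure_eqI)
    have s: "sets \<theta> = sets MR" using that LL_sets by simp
    fix A assume "A \<in> sets (restrict_to (restrict_to \<theta> (strip n)) (strip m))"
    moreover have "A \<inter> strip m \<inter> strip n = A \<inter> strip m"
      using strip_mono[OF mn] by auto
    ultimately show "emeasure (restrict_to (restrict_to \<theta> (strip n)) (strip m)) A = emeasure (restrict_to \<theta> (strip m)) A"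
      using s by (simp add: emeasure_restrict_to)
  qed simp
  have sp: "restrict_to \<theta> (strip n) \<in> space (fin_counting MR)" if "\<theta> \<in> space LL" for \<theta>
    using measurable_space[OF restrict_strip_measurable that] .
  show "{(z, \<theta>). z \<in> strip m \<and> \<theta> \<in> space LL \<and> (z, restrict_to \<theta> (strip m)) \<in> D} =
     {(z, \<theta>). z \<in> strip n \<and> \<theta> \<in> space LL \<and> (z, restrict_to \<theta> (strip n)) \<in> ?D'}"
    using strip_mono[OF mn] eq sp sets.sets_into_space[OF strip_sets_MR, of m]
    by (auto simp: space_pair_measure simp del: space_counting_algebra)
qed

lemma Int_stable_local_sets: "Int_stable local_sets"
  unfolding Int_stable_def
proof (intro ballI)
  fix A A' assume "A \<in> local_sets" "A' \<in> local_sets"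
  then obtain m D m' D' where D: "D \<in> sets (MR \<Otimes>\<^sub>M fin_counting MR)" "D' \<in> sets (MR \<Otimes>\<^sub>M fin_counting MR)"
    and A: "A = {(z, \<theta>). z \<in> strip m \<and> \<theta> \<in> space LL \<and> (z, restrict_to \<theta> (strip m)) \<in> D}"
    and A': "A' = {(z, \<theta>). z \<in> strip m' \<and> \<theta> \<in> space LL \<and> (z, restrict_to \<theta> (strip m')) \<in> D'}"
    by (auto simp: local_sets_def)
  define n where "n = max m m'"
  obtain E where E: "E \<in> sets (MR \<Otimes>\<^sub>M fin_counting MR)"
    "A = {(z, \<theta>). z \<in> strip n \<and> \<theta> \<in> space LL \<and> (z, restrict_to \<theta> (strip n)) \<in> E}"
    using local_sets_mono[OF D(1), of m n] A by (auto simp: n_def)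
  obtain E' where E': "E' \<in> sets (MR \<Otimes>\<^sub>M fin_counting MR)"
    "A' = {(z, \<theta>). z \<in> strip n \<and> \<theta> \<in> space LL \<and> (z, restrict_to \<theta> (strip n)) \<in> E'}"
    using local_sets_mono[OF D(2), of m' n] A' by (auto simp: n_def)
  have "A \<inter> A' = {(z, \<theta>). z \<in> strip n \<and> \<theta> \<in> space LL \<and> (z, restrict_to \<theta> (strip n)) \<in> E \<inter> E'}"
    unfolding E(2) E'(2) by auto
  then show "A \<inter> A' \<in> local_sets"
    using E(1) E'(1) by (simp only:) (intro local_setsI sets.Int)
qed

lemma local_sets_sub: "local_sets \<subseteq> Pow (space MR \<times> space LL)"
  using sets.sets_into_space[OF strip_sets_MR] by (auto simp: local_sets_def)

text \<open>The mass of any set is the supremum of its masses in the strips, so evaluations are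
  limits of local ones.\<close>

lemma sets_local: "sets (MR \<Otimes>\<^sub>M LL) = sigma_sets (space MR \<times> space LL) local_sets"
proof
  have "A \<in> sets (MR \<Otimes>\<^sub>M LL)" if "A \<in> local_sets" for A
  proof -
    obtain m D where [measurable]: "D \<in> sets (MR \<Otimes>\<^sub>M fin_counting MR)"
      and A: "A = {(z, \<theta>). z \<in> strip m \<and> \<theta> \<in> space LL \<and> (z, restrict_to \<theta> (strip m)) \<in> D}"
      using \<open>A \<in> local_sets\<close> by (auto simp: local_sets_def)
    have "{w\<in>space (MR \<Otimes>\<^sub>M LL). fst w \<in> strip m \<and> (fst w, restrict_to (snd w) (strip m)) \<in> D} \<in> sets (MR \<Otimes>\<^sub>M LL)"
      by measurable
    also have "{w\<in>space (MR \<Otimes>\<^sub>M LL). fst w \<in> strip m \<and> (fst w, restrict_to (snd w) (strip m)) \<in> D} = A"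
      unfolding A using sets.sets_into_space[OF strip_sets_MR] by (auto simp: space_pair_measure)
    finally show ?thesis .
  qed
  then show "sigma_sets (space MR \<times> space LL) local_sets \<subseteq> sets (MR \<Otimes>\<^sub>M LL)"
    using sets.sigma_sets_subset[of local_sets "MR \<Otimes>\<^sub>M LL"] by (auto simp: space_pair_measure)
  let ?S = "sigma (space MR \<times> space LL) local_sets"
  have S: "space ?S = space MR \<times> space LL" "sets ?S = sigma_sets (space MR \<times> space LL) local_sets"
    using local_sets_sub by (simp_all add: space_measure_of del: space_counting_algebra)
  have inS: "A \<in> sets ?S" if "A \<in> local_sets" for A
    unfolding S(2) using that by (rule sigma_sets.Basic)
  have f: "fst \<in> ?S \<rightarrow>\<^sub>M MR"
  proof (rule measurableI)
    show "fst w \<in> space MR" if "w \<in> space ?S" for w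
      using that unfolding S(1) by auto
    fix B assume B [measurable]: "B \<in> sets MR"
    let ?D = "{w\<in>space (MR \<Otimes>\<^sub>M fin_counting MR). fst w \<in> B}"
    have "fst -` B \<inter> space ?S = (\<Union>m. {(z, \<theta>). z \<in> strip m \<and> \<theta> \<in> space LL \<and> (z, restrict_to \<theta> (strip m)) \<in> ?D})"
      unfolding S(1) using sets.sets_into_space[OF B] measurable_space[OF restrict_strip_measurable]
      by (auto intro!: ex_strip simp: space_pair_measure simp del: space_counting_algebra)
    also have "\<dots> \<in> sets ?S"
      by (intro sets.countable_UN'' inS local_setsI) auto
    finally show "fst -` B \<inter> space ?S \<in> sets ?S" .
  qed
  have g: "snd \<in> ?S \<rightarrow>\<^sub>M LL"
  proof (rule measurable_counting_algebra)
    show "snd w \<in> counting_measures MR (strip_sets M)" if "w \<in> space ?S" for w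
      using that unfolding S(1) by auto
    fix B assume B [measurable]: "B \<in> sets MR"
    have m: "(\<lambda>w. emeasure (snd w) (B \<inter> strip m)) \<in> borel_measurable ?S" for m
    proof (rule measurableI)
      fix A :: "ennreal set" assume [measurable]: "A \<in> sets borel"
      have [measurable]: "(\<lambda>\<mu>. emeasure \<mu> (B \<inter> strip m)) \<in> borel_measurable (fin_counting MR)"
        by (rule measurable_emeasure_counting_algebra) measurable
      let ?D = "{w\<in>space (MR \<Otimes>\<^sub>M fin_counting MR). emeasure (snd w) (B \<inter> strip m) \<in> A}"
      have eq: "emeasure (restrict_to \<theta> (strip (m + n))) (B \<inter> strip m) = emeasure \<theta> (B \<inter> strip m)"
        if "\<theta> \<in> space LL" for \<theta> n
      proof -
        have "B \<inter> strip m \<inter> strip (m + n) = B \<inter> strip m"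
          using strip_mono[of m "m + n"] by auto
        then show ?thesis
          using that LL_sets by (simp add: emeasure_restrict_to)
      qed
      \<comment> \<open>The strip must contain both \<open>strip m\<close>, where the count is
        taken, and the first component of \<open>w\<close>; hence the union over m + n.\<close>
      have "(\<lambda>w. emeasure (snd w) (B \<inter> strip m)) -` A \<inter> space ?S =
        (\<Union>n. {(z, \<theta>). z \<in> strip (m + n) \<and> \<theta> \<in> space LL \<and> (z, restrict_to \<theta> (strip (m + n))) \<in> ?D})"
      proof (intro equalityI subsetI)
        fix w assume w: "w \<in> (\<lambda>w. emeasure (snd w) (B \<inter> strip m)) -` A \<inter> space ?S"
        then have "fst w \<in> space MR" "snd w \<in> space LL"
          unfolding S(1) by auto
        moreover from this obtain n where "fst w \<in> strip n"
          using UN_strip by blast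
        then have "fst w \<in> strip (m + n)"
          using strip_mono[of n "m + n"] by auto
        ultimately show "w \<in> (\<Union>n. {(z, \<theta>). z \<in> strip (m + n) \<and> \<theta> \<in> space LL \<and> (z, restrict_to \<theta> (strip (m + n))) \<in> ?D})"
          using w eq measurable_space[OF restrict_strip_measurable]
          by (intro UN_I[of n]) (auto simp: space_pair_measure split_beta' simp del: space_counting_algebra)
      next
        fix w assume "w \<in> (\<Union>n. {(z, \<theta>). z \<in> strip (m + n) \<and> \<theta> \<in> space LL \<and> (z, restrict_to \<theta> (strip (m + n))) \<in> ?D})"
        then show "w \<in> (\<lambda>w. emeasure (snd w) (B \<inter> strip m)) -` A \<inter> space ?S"
          unfolding S(1) using eq by (auto simp: space_pair_measure simp del: space_counting_algebra)
      qed
      also have "\<dots> \<in> sets ?S"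
        by (intro sets.countable_UN'' inS local_setsI) auto
      finally show "(\<lambda>w. emeasure (snd w) (B \<inter> strip m)) -` A \<inter> space ?S \<in> sets ?S" .
    qed simp
    have "(\<lambda>w. SUP m. emeasure (snd w) (B \<inter> strip m)) \<in> borel_measurable ?S"
      using m by (intro borel_measurable_SUP) auto
    moreover have "(SUP m. emeasure (snd w) (B \<inter> strip m)) = emeasure (snd w) B" if "w \<in> space ?S" for w
    proof -
      have "snd w \<in> counting_measures MR (strip_sets M)"
        using that unfolding S(1) by auto
      then have s: "sets (snd w) = sets MR"
        by (rule LL_sets)
      have "(SUP m. emeasure (snd w) (B \<inter> strip m)) = emeasure (snd w) (\<Union>m. B \<inter> strip m)"
        using incseq_strip s by (intro SUP_emeasure_incseq) (auto simp: incseq_def)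
      moreover have "(\<Union>m. B \<inter> strip m) = B"
        using sets.sets_into_space[OF B] by (simp add: UN_strip Int_absorb2 flip: Int_UN_distrib)
      ultimately show ?thesis by simp
    qed
    ultimately show "(\<lambda>w. emeasure (snd w) B) \<in> borel_measurable ?S"
      using measurable_cong[of ?S "\<lambda>w. SUP m. emeasure (snd w) (B \<inter> strip m)" "\<lambda>w. emeasure (snd w) B"] by blast
  qed
  have id: "(\<lambda>w. w) \<in> ?S \<rightarrow>\<^sub>M MR \<Otimes>\<^sub>M LL"
    using measurable_Pair[OF f g] by simp
  show "sets (MR \<Otimes>\<^sub>M LL) \<subseteq> sigma_sets (space MR \<times> space LL) local_sets"
  proof
    fix A assume A: "A \<in> sets (MR \<Otimes>\<^sub>M LL)"
    have "(\<lambda>w. w) -` A \<inter> space ?S = A"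
      unfolding S(1) using sets.sets_into_space[OF A] by (auto simp: space_pair_measure)
    with measurable_sets[OF id A] show "A \<in> sigma_sets (space MR \<times> space LL) local_sets"
      unfolding S(2) by simp
  qed
qed

end

section \<open>The Mecke equation for a Poisson process on the product space\<close>

locale marked_poisson = marked_space M for M :: "'a measure" +
  fixes P :: "'w measure" and \<Phi> :: "'w \<Rightarrow> ('a \<times> real) measure"
  assumes pp: "poisson_process P (N_loc_alg M) (M \<Otimes>\<^sub>M half_line) \<Phi>"
begin

sublocale P: prob_space P
  using pp by (simp add: poisson_process_def)

lemma Phi_measurable [measurable]: "\<Phi> \<in> P \<rightarrow>\<^sub>M LL"
  using pp by (simp add: poisson_process_def N_loc_alg_eq)

lemma Phi_space: "\<omega> \<in> space P \<Longrightarrow> \<Phi> \<omega> \<in> counting_measures MR (strip_sets M)"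
  using measurable_space[OF Phi_measurable] by simp

lemma Phi_count:
  assumes "B \<in> sets MR" "emeasure MR B < \<infinity>"
  shows "P.prob {\<omega>\<in>space P. emeasure (\<Phi> \<omega>) B = of_nat k} = measure MR B ^ k / fact k * exp (- measure MR B)"
  using pp assms unfolding poisson_process_def by simp

lemma Phi_void:
  assumes "B \<in> sets MR" "emeasure MR B < \<infinity>"
  shows "emeasure P {\<omega>\<in>space P. emeasure (\<Phi> \<omega>) B = 0} = ennreal (exp (- measure MR B))"
  using Phi_count[OF assms, of 0] by (simp add: P.emeasure_eq_measure)

text \<open>Masses of the restriction are masses of \<open>\<Phi>\<close> on sets cut down to the
  strip, and cutting down preserves disjointness.\<close>

lemma strip_restriction_poisson:
  "poisson_process P (fin_counting MR) (restrict_to MR (strip m)) (\<lambda>\<omega>. restrict_to (\<Phi> \<omega>) (strip m))"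
proof -
  have fin: "emeasure MR (C \<inter> strip m) < \<infinity>" if "C \<in> sets MR" for C
    using emeasure_strip[of m] emeasure_mono[of "C \<inter> strip m" "strip m" MR] by (auto simp: top.not_eq_extremum intro: le_less_trans)
  have e: "emeasure (restrict_to MR (strip m)) C = emeasure MR (C \<inter> strip m)" if "C \<in> sets MR" for C
    using that by (simp add: emeasure_restrict_to)
  have m: "measure (restrict_to MR (strip m)) C = measure MR (C \<inter> strip m)" if "C \<in> sets MR" for C
    using e[OF that] by (simp add: measure_def)
  have ev: "emeasure (restrict_to (\<Phi> \<omega>) (strip m)) C = emeasure (\<Phi> \<omega>) (C \<inter> strip m)"
    if "\<omega> \<in> space P" "C \<in> sets MR" for \<omega> C
    using that LL_sets[OF Phi_space[OF that(1)]] by (simp add: emeasure_restrict_to)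
  have meas: "(\<lambda>\<omega>. restrict_to (\<Phi> \<omega>) (strip m)) \<in> P \<rightarrow>\<^sub>M fin_counting MR"
    by measurable
  have indep: "P.indep_vars (\<lambda>_. borel) (\<lambda>i \<omega>. emeasure (restrict_to (\<Phi> \<omega>) (strip m)) (C i)) {..<n}"
    if C: "\<forall>i<n. C i \<in> sets MR" "disjoint_family_on C {..<n}" for n :: nat and C
  proof -
    have "(\<forall>i<n. C i \<inter> strip m \<in> sets MR) \<and> disjoint_family_on (\<lambda>i. C i \<inter> strip m) {..<n}"
      using C by (auto simp: disjoint_family_on_def)
    then have base: "P.indep_vars (\<lambda>_. borel) (\<lambda>i \<omega>. emeasure (\<Phi> \<omega>) (C i \<inter> strip m)) {..<n}"
      using pp[unfolded poisson_process_def, THEN conjunct2, THEN conjunct2, THEN conjunct2, THEN conjunct2,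
        THEN spec[of _ n], THEN spec[of _ "\<lambda>i. C i \<inter> strip m"]] by simp
    have m': "(\<lambda>\<omega>. emeasure (restrict_to (\<Phi> \<omega>) (strip m)) (C i)) \<in> borel_measurable P" if "i < n" for i
      using that C(1) by (intro measurable_compose[OF meas measurable_emeasure_counting_algebra]) simp
    have "(\<lambda>\<omega>. emeasure (\<Phi> \<omega>) (C i \<inter> strip m)) -` A \<inter> space P =
      (\<lambda>\<omega>. emeasure (restrict_to (\<Phi> \<omega>) (strip m)) (C i)) -` A \<inter> space P" if "i < n" for i A
      using that C(1) ev by auto
    note same = this
    have "P.indep_sets (\<lambda>i. {(\<lambda>\<omega>. emeasure (restrict_to (\<Phi> \<omega>) (strip m)) (C i)) -` A \<inter> space P | A. A \<in> sets borel}) {..<n}"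
    proof (rule P.indep_sets_mono_sets)
      show "P.indep_sets (\<lambda>i. {(\<lambda>\<omega>. emeasure (\<Phi> \<omega>) (C i \<inter> strip m)) -` A \<inter> space P | A. A \<in> sets borel}) {..<n}"
        using base unfolding P.indep_vars_def2 by (rule conjunct2)
    qed (simp add: same)
    then show ?thesis
      using m' unfolding P.indep_vars_def2 by simp
  qed
  have count: "P.prob {\<omega>\<in>space P. emeasure (restrict_to (\<Phi> \<omega>) (strip m)) B = of_nat k} =
    measure (restrict_to MR (strip m)) B ^ k / fact k * exp (- measure (restrict_to MR (strip m)) B)"
    if B: "B \<in> sets MR" for B k
  proof -
    have "{\<omega>\<in>space P. emeasure (restrict_to (\<Phi> \<omega>) (strip m)) B = of_nat k} =
      {\<omega>\<in>space P. emeasure (\<Phi> \<omega>) (B \<inter> strip m) = of_nat k}"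
      using ev[OF _ B] by auto
    then show ?thesis
      using Phi_count[of "B \<inter> strip m" k] B fin[OF B] by (simp add: m)
  qed
  have inf: "emeasure (restrict_to MR (strip m)) B \<noteq> \<infinity>" if "B \<in> sets MR" for B
    using fin[OF that] e[OF that] by simp
  show ?thesis
    unfolding poisson_process_def using P.prob_space_axioms meas count inf indep by simp
qed

text \<open>\<open>campbell\<close> and \<open>palm\<close> are the two sides of the Mecke equation,
  named so that the Dynkin argument can treat them alike.\<close>

definition campbell :: "(('a \<times> real) \<times> ('a \<times> real) measure \<Rightarrow> ennreal) \<Rightarrow> ennreal" where
  "campbell f = (\<integral>\<^sup>+\<omega>. (\<integral>\<^sup>+z. f (z, \<Phi> \<omega>) \<partial>\<Phi> \<omega>) \<partial>P)"

definition palm :: "(('a \<times> real) \<times> ('a \<times> real) measure \<Rightarrow> ennreal) \<Rightarrow> ennreal" where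
  "palm f = (\<integral>\<^sup>+\<omega>. (\<integral>\<^sup>+z. f (z, \<Phi> \<omega> \<oplus>\<^sub>m return MR z) \<partial>MR) \<partial>P)"

lemma add_return_LL [measurable]:
  assumes "a \<in> \<Omega> \<rightarrow>\<^sub>M LL" "b \<in> \<Omega> \<rightarrow>\<^sub>M MR"
  shows "(\<lambda>\<omega>. a \<omega> \<oplus>\<^sub>m return MR (b \<omega>)) \<in> \<Omega> \<rightarrow>\<^sub>M LL"
  using assms strip_sets_sub by (intro measurable_add_measure measurable_compose[OF _ measurable_return_counting])

lemma campbell_inner_measurable:
  assumes [measurable]: "f \<in> borel_measurable (MR \<Otimes>\<^sub>M LL)"
  shows "(\<lambda>\<omega>. \<integral>\<^sup>+z. f (z, \<Phi> \<omega>) \<partial>\<Phi> \<omega>) \<in> borel_measurable P"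
  using nn_integral_LL_measurable[of \<Phi> P "\<lambda>w. f (snd w, \<Phi> (fst w))"] by simp

lemma campbell_suminf:
  fixes f :: "nat \<Rightarrow> _"
  assumes [measurable]: "\<And>i. f i \<in> borel_measurable (MR \<Otimes>\<^sub>M LL)"
  shows "campbell (\<lambda>w. \<Sum>i. f i w) = (\<Sum>i. campbell (f i))"
proof -
  have "campbell (\<lambda>w. \<Sum>i. f i w) = (\<integral>\<^sup>+\<omega>. (\<Sum>i. \<integral>\<^sup>+z. f i (z, \<Phi> \<omega>) \<partial>\<Phi> \<omega>) \<partial>P)"
    unfolding campbell_def
  proof (intro nn_integral_cong nn_integral_suminf)
    fix \<omega> i assume \<omega>: "\<omega> \<in> space P"
    then have [measurable]: "\<Phi> \<omega> \<in> space LL"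
      using measurable_space[OF Phi_measurable] by simp
    have "(\<lambda>z. f i (z, \<Phi> \<omega>)) \<in> borel_measurable MR"
      by measurable
    then show "(\<lambda>z. f i (z, \<Phi> \<omega>)) \<in> borel_measurable (\<Phi> \<omega>)"
      unfolding measurable_cong_sets[OF LL_sets[OF Phi_space[OF \<omega>]] refl] .
  qed
  also have "\<dots> = (\<Sum>i. campbell (f i))"
    unfolding campbell_def using campbell_inner_measurable[OF assms] by (rule nn_integral_suminf)
  finally show ?thesis .
qed

lemma campbell_add:
  assumes [measurable]: "f \<in> borel_measurable (MR \<Otimes>\<^sub>M LL)" "g \<in> borel_measurable (MR \<Otimes>\<^sub>M LL)"
  shows "campbell (\<lambda>w. f w + g w) = campbell f + campbell g"
proof -
  have "campbell (\<lambda>w. f w + g w) = (\<integral>\<^sup>+\<omega>. (\<integral>\<^sup>+z. f (z, \<Phi> \<omega>) \<partial>\<Phi> \<omega>) + (\<integral>\<^sup>+z. g (z, \<Phi> \<omega>) \<partial>\<Phi> \<omega>) \<partial>P)"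
    unfolding campbell_def
  proof (intro nn_integral_cong nn_integral_add)
    fix \<omega> assume \<omega>: "\<omega> \<in> space P"
    then have [measurable]: "\<Phi> \<omega> \<in> space LL"
      using measurable_space[OF Phi_measurable] by simp
    have "(\<lambda>z. f (z, \<Phi> \<omega>)) \<in> borel_measurable MR" "(\<lambda>z. g (z, \<Phi> \<omega>)) \<in> borel_measurable MR"
      by measurable
    then show "(\<lambda>z. f (z, \<Phi> \<omega>)) \<in> borel_measurable (\<Phi> \<omega>)" "(\<lambda>z. g (z, \<Phi> \<omega>)) \<in> borel_measurable (\<Phi> \<omega>)"
      unfolding measurable_cong_sets[OF LL_sets[OF Phi_space[OF \<omega>]] refl] .
  qed
  also have "\<dots> = campbell f + campbell g"
    unfolding campbell_def using campbell_inner_measurable[OF assms(1)] campbell_inner_measurable[OF assms(2)]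
    by (rule nn_integral_add)
  finally show ?thesis .
qed

lemma palm_add:
  assumes [measurable]: "f \<in> borel_measurable (MR \<Otimes>\<^sub>M LL)" "g \<in> borel_measurable (MR \<Otimes>\<^sub>M LL)"
  shows "palm (\<lambda>w. f w + g w) = palm f + palm g"
proof -
  have "palm (\<lambda>w. f w + g w) = (\<integral>\<^sup>+\<omega>. (\<integral>\<^sup>+z. f (z, \<Phi> \<omega> \<oplus>\<^sub>m return MR z) \<partial>MR) + (\<integral>\<^sup>+z. g (z, \<Phi> \<omega> \<oplus>\<^sub>m return MR z) \<partial>MR) \<partial>P)"
    unfolding palm_def
  proof (intro nn_integral_cong nn_integral_add)
    fix \<omega> assume \<omega>: "\<omega> \<in> space P"
    then have [measurable]: "\<Phi> \<omega> \<in> space LL"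
      using measurable_space[OF Phi_measurable] by simp
    show "(\<lambda>z. f (z, \<Phi> \<omega> \<oplus>\<^sub>m return MR z)) \<in> borel_measurable MR"
      by measurable
    show "(\<lambda>z. g (z, \<Phi> \<omega> \<oplus>\<^sub>m return MR z)) \<in> borel_measurable MR"
      by measurable
  qed
  also have "\<dots> = palm f + palm g"
    unfolding palm_def by (rule nn_integral_add) measurable
  finally show ?thesis .
qed

lemma palm_suminf:
  fixes f :: "nat \<Rightarrow> _"
  assumes [measurable]: "\<And>i. f i \<in> borel_measurable (MR \<Otimes>\<^sub>M LL)"
  shows "palm (\<lambda>w. \<Sum>i. f i w) = (\<Sum>i. palm (f i))"
proof -
  have "palm (\<lambda>w. \<Sum>i. f i w) = (\<integral>\<^sup>+\<omega>. (\<Sum>i. \<integral>\<^sup>+z. f i (z, \<Phi> \<omega> \<oplus>\<^sub>m return MR z) \<partial>MR) \<partial>P)"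
    unfolding palm_def
  proof (intro nn_integral_cong nn_integral_suminf)
    fix \<omega> i assume \<omega>: "\<omega> \<in> space P"
    then have [measurable]: "\<Phi> \<omega> \<in> space LL"
      using measurable_space[OF Phi_measurable] by simp
    show "(\<lambda>z. f i (z, \<Phi> \<omega> \<oplus>\<^sub>m return MR z)) \<in> borel_measurable MR"
      by measurable
  qed
  also have "\<dots> = (\<Sum>i. palm (f i))"
    unfolding palm_def by (rule nn_integral_suminf) measurable
  finally show ?thesis .
qed

text \<open>Inside one strip the law of \<open>\<Phi>\<close> is the explicit
  \<open>poisson_measure\<close>, for which the equation is known; the event involves the
  configuration through that restriction alone.\<close>

lemma mecke_local:
  assumes "A \<in> local_sets"
  shows "campbell (indicator A) = palm (indicator A)"
proof -
  obtain m D where D [measurable]: "D \<in> sets (MR \<Otimes>\<^sub>M fin_counting MR)"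
    and A: "A = {(z, \<theta>). z \<in> strip m \<and> \<theta> \<in> space LL \<and> (z, restrict_to \<theta> (strip m)) \<in> D}"
    using assms by (auto simp: local_sets_def)
  interpret J: poisson_insertion MR "strip m"
    using emeasure_strip[of m] by unfold_locales simp_all
  let ?\<xi> = "\<lambda>\<omega>. restrict_to (\<Phi> \<omega>) (strip m)"
  have fin: "finite_measure (restrict_to MR (strip m))"
    using emeasure_strip[of m] sets.sets_into_space[OF strip_sets_MR, of m]
    by (intro finite_measureI) (simp add: emeasure_restrict_to Int_absorb1)
  have "distr P (fin_counting MR) ?\<xi> = distr J.poisson_measure (fin_counting MR) (\<lambda>\<mu>. \<mu>)"
    by (rule poisson_process_distr_eq[OF strip_restriction_poisson J.poisson_process_poisson_measure _ fin]) simp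
  then have law: "distr P (fin_counting MR) ?\<xi> = J.poisson_measure"
    by (simp add: distr_id2)
  have \<xi>m [measurable]: "?\<xi> \<in> P \<rightarrow>\<^sub>M fin_counting MR"
    by measurable
  define f where "f z \<eta> = (indicator D (z, \<eta>) :: ennreal)" for z \<eta>
  have f [measurable]: "(\<lambda>(z, \<eta>). f z \<eta>) \<in> borel_measurable (MR \<Otimes>\<^sub>M fin_counting MR)"
    unfolding f_def by measurable
  have p [measurable]: "(\<lambda>\<eta>. \<integral>\<^sup>+z. f z \<eta> \<partial>\<eta>) \<in> borel_measurable (fin_counting MR)"
    using J.point_sum_measurable[OF f] unfolding J.point_sum_def[abs_def] .
  have q [measurable]: "(\<lambda>\<eta>. \<integral>\<^sup>+z. indicator (strip m) z * f z (\<eta> \<oplus>\<^sub>m return MR z) \<partial>MR) \<in> borel_measurable (fin_counting MR)"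
    using J.insert_sum_measurable[OF f] unfolding J.insert_sum_def[abs_def] .
  have "campbell (indicator A) = (\<integral>\<^sup>+\<omega>. (\<integral>\<^sup>+z. f z (?\<xi> \<omega>) \<partial>?\<xi> \<omega>) \<partial>P)"
    unfolding campbell_def
  proof (rule nn_integral_cong)
    fix \<omega> assume \<omega>: "\<omega> \<in> space P"
    have s: "sets (\<Phi> \<omega>) = sets MR"
      using LL_sets[OF Phi_space[OF \<omega>]] .
    have \<xi>: "?\<xi> \<omega> \<in> space (fin_counting MR)"
      using measurable_space[OF \<xi>m \<omega>] .
    have "(\<lambda>z. f z (?\<xi> \<omega>)) \<in> borel_measurable MR"
      using \<xi> by (intro J.marked_measurable_comp[OF f]) simp_all
    then have "(\<lambda>z. f z (?\<xi> \<omega>)) \<in> borel_measurable (\<Phi> \<omega>)"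
      unfolding measurable_cong_sets[OF s refl] .
    then have "(\<integral>\<^sup>+z. f z (?\<xi> \<omega>) \<partial>?\<xi> \<omega>) = (\<integral>\<^sup>+z. indicator (strip m) z * f z (?\<xi> \<omega>) \<partial>\<Phi> \<omega>)"
      using s by (intro nn_integral_restrict_to) simp_all
    also have "\<dots> = (\<integral>\<^sup>+z. indicator A (z, \<Phi> \<omega>) \<partial>\<Phi> \<omega>)"
      using Phi_space[OF \<omega>] by (intro nn_integral_cong) (auto simp: A f_def split: split_indicator)
    finally show "(\<integral>\<^sup>+z. indicator A (z, \<Phi> \<omega>) \<partial>\<Phi> \<omega>) = (\<integral>\<^sup>+z. f z (?\<xi> \<omega>) \<partial>?\<xi> \<omega>)" ..
  qed
  also have "\<dots> = (\<integral>\<^sup>+\<eta>. (\<integral>\<^sup>+z. f z \<eta> \<partial>\<eta>) \<partial>J.poisson_measure)"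
    unfolding law[symmetric] by (rule nn_integral_distr[symmetric]) simp_all
  also have "\<dots> = (\<integral>\<^sup>+\<eta>. (\<integral>\<^sup>+z. indicator (strip m) z * f z (\<eta> \<oplus>\<^sub>m return MR z) \<partial>MR) \<partial>J.poisson_measure)"
    by (rule J.poisson_mecke[OF f])
  also have "\<dots> = (\<integral>\<^sup>+\<omega>. (\<integral>\<^sup>+z. indicator (strip m) z * f z (?\<xi> \<omega> \<oplus>\<^sub>m return MR z) \<partial>MR) \<partial>P)"
    unfolding law[symmetric] by (rule nn_integral_distr) simp_all
  also have "\<dots> = palm (indicator A)"
    unfolding palm_def
  proof (intro nn_integral_cong)
    fix \<omega> z assume \<omega>: "\<omega> \<in> space P" and z: "z \<in> space MR"
    have "\<Phi> \<omega> \<oplus>\<^sub>m return MR z \<in> counting_measures MR (strip_sets M)"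
      using Phi_space[OF \<omega>] strip_sets_sub by (rule add_return_counting)
    then show "indicator (strip m) z * f z (?\<xi> \<omega> \<oplus>\<^sub>m return MR z) = indicator A (z, \<Phi> \<omega> \<oplus>\<^sub>m return MR z)"
      using restrict_strip_add_return[OF Phi_space[OF \<omega>], of z m] by (auto simp: A f_def split: split_indicator)
  qed
  finally show ?thesis .
qed

lemma strip_times_local: "strip m \<times> space LL \<in> local_sets"
proof -
  have "strip m \<times> space LL = {(z, \<theta>). z \<in> strip m \<and> \<theta> \<in> space LL \<and> (z, restrict_to \<theta> (strip m)) \<in> space (MR \<Otimes>\<^sub>M fin_counting MR)}"
    using sets.sets_into_space[OF strip_sets_MR, of m] measurable_space[OF restrict_strip_measurable]
    by (auto simp: space_pair_measure simp del: space_counting_algebra)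
  then show ?thesis
    by (simp only:) (rule local_setsI, simp)
qed

text \<open>The intersection with a strip keeps both sides finite, so that the complement step can
  subtract.\<close>

lemma mecke_strip:
  assumes "A \<in> sets (MR \<Otimes>\<^sub>M LL)"
  shows "campbell (indicator (A \<inter> strip m \<times> space LL)) = palm (indicator (A \<inter> strip m \<times> space LL))"
  using Int_stable_local_sets local_sets_sub assms[unfolded sets_local]
proof (induct rule: sigma_sets_induct_disjoint)
  case (basic A)
  then show ?case
    using Int_stable_local_sets strip_times_local[of m] by (intro mecke_local) (auto simp: Int_stable_def)
next
  case empty
  then show ?case
    by (simp add: campbell_def palm_def)
next
  case (compl A)
  have A: "A \<in> sets (MR \<Otimes>\<^sub>M LL)"
    using compl by (simp add: sets_local)
  have S: "strip m \<times> space LL \<in> sets (MR \<Otimes>\<^sub>M LL)"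
    by (intro pair_measureI strip_sets_MR sets.top)
  let ?S = "strip m \<times> space LL"
  let ?C = "(space MR \<times> space LL - A) \<inter> ?S"
  have C: "?C \<in> sets (MR \<Otimes>\<^sub>M LL)"
    using A S sets.Diff[OF sets.top A] by (simp only: space_pair_measure sets.Int)
  have sum: "(\<lambda>w. indicator (A \<inter> ?S) w + indicator ?C w :: ennreal) = indicator ?S"
  proof
    fix w
    have "w \<in> ?S \<Longrightarrow> w \<in> space MR \<times> space LL"
      using sets.sets_into_space[OF strip_sets_MR, of m] by auto
    then show "(indicator (A \<inter> ?S) w + indicator ?C w :: ennreal) = indicator ?S w"
      by (auto split: split_indicator)
  qed
  have m: "(indicator (A \<inter> ?S) :: _ \<Rightarrow> ennreal) \<in> borel_measurable (MR \<Otimes>\<^sub>M LL)"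
    "(indicator ?C :: _ \<Rightarrow> ennreal) \<in> borel_measurable (MR \<Otimes>\<^sub>M LL)"
    by (rule borel_measurable_indicator[OF sets.Int[OF A S]], rule borel_measurable_indicator[OF C])
  have 1: "campbell (indicator ?S) = campbell (indicator (A \<inter> ?S)) + campbell (indicator ?C)"
    unfolding campbell_add[OF m, symmetric] sum ..
  have 2: "palm (indicator ?S) = palm (indicator (A \<inter> ?S)) + palm (indicator ?C)"
    unfolding palm_add[OF m, symmetric] sum ..
  have "palm (indicator ?S) = (\<integral>\<^sup>+\<omega>. emeasure MR (strip m) \<partial>P)"
    unfolding palm_def
  proof (rule nn_integral_cong)
    fix \<omega> assume \<omega>: "\<omega> \<in> space P"
    have "\<Phi> \<omega> \<oplus>\<^sub>m return MR z \<in> counting_measures MR (strip_sets M)" for z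
      using Phi_space[OF \<omega>] strip_sets_sub by (rule add_return_counting)
    then have "(\<integral>\<^sup>+z. indicator ?S (z, \<Phi> \<omega> \<oplus>\<^sub>m return MR z) \<partial>MR) = (\<integral>\<^sup>+z. indicator (strip m) z \<partial>MR)"
      by (intro nn_integral_cong) (auto split: split_indicator)
    then show "(\<integral>\<^sup>+z. indicator ?S (z, \<Phi> \<omega> \<oplus>\<^sub>m return MR z) \<partial>MR) = emeasure MR (strip m)"
      by simp
  qed
  then have "palm (indicator ?S) \<noteq> \<infinity>"
    using emeasure_strip[of m] P.emeasure_space_1 by simp
  moreover have "campbell (indicator ?S) = palm (indicator ?S)"
    by (rule mecke_local[OF strip_times_local])
  ultimately have "palm (indicator (A \<inter> ?S)) + campbell (indicator ?C) = palm (indicator (A \<inter> ?S)) + palm (indicator ?C)"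
    and "palm (indicator (A \<inter> ?S)) \<noteq> \<infinity>"
    using 1 2 compl(2) by auto
  then show ?case
    by (simp only: ennreal_add_left_cancel) simp
next
  case (union A)
  have "A i \<in> sets (MR \<Otimes>\<^sub>M LL)" for i
    unfolding sets_local using union(2) by auto
  then have A: "A i \<inter> strip m \<times> space LL \<in> sets (MR \<Otimes>\<^sub>M LL)" for i
    by (intro sets.Int pair_measureI strip_sets_MR sets.top)
  have eq: "(\<lambda>w. \<Sum>i. indicator (A i \<inter> strip m \<times> space LL) w :: ennreal) = indicator ((\<Union>i. A i) \<inter> strip m \<times> space LL)"
  proof
    fix w
    have "disjoint_family (\<lambda>i. A i \<inter> strip m \<times> space LL)"
      using union(1) by (auto simp: disjoint_family_on_def)
    from suminf_indicator[OF this] show "(\<Sum>i. indicator (A i \<inter> strip m \<times> space LL) w :: ennreal) = indicator ((\<Union>i. A i) \<inter> strip m \<times> space LL) w"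
      by (simp only: Int_UN_distrib2 UN_extend_simps)
  qed
  show ?case
    using campbell_suminf[of "\<lambda>i. indicator (A i \<inter> strip m \<times> space LL)"]
      palm_suminf[of "\<lambda>i. indicator (A i \<inter> strip m \<times> space LL)"] A union(3)
    unfolding eq by simp
qed

text \<open>The disjoint differences of successive strips cut \<open>A\<close> into countably many
  pieces to which \<open>mecke_strip\<close> applies.\<close>

theorem mecke:
  assumes A: "A \<in> sets (MR \<Otimes>\<^sub>M LL)"
  shows "(\<integral>\<^sup>+\<omega>. (\<integral>\<^sup>+z. indicator A (z, \<Phi> \<omega>) \<partial>\<Phi> \<omega>) \<partial>P) =
    (\<integral>\<^sup>+\<omega>. (\<integral>\<^sup>+z. indicator A (z, \<Phi> \<omega> \<oplus>\<^sub>m return MR z) \<partial>MR) \<partial>P)"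
proof -
  define S where "S i = A \<inter> (disjointed strip i \<times> space LL)" for i
  have "range strip \<subseteq> sets MR"
    by auto
  then have d: "disjointed strip i \<in> sets MR" for i
    using sets.range_disjointed_sets[of strip MR] by auto
  then have S: "S i \<in> sets (MR \<Otimes>\<^sub>M LL)" for i
    unfolding S_def by (intro sets.Int pair_measureI A d sets.top)
  have "S i \<inter> strip i \<times> space LL = S i" for i
    using disjointed_subset[of strip i] by (auto simp: S_def)
  then have eq: "campbell (indicator (S i)) = palm (indicator (S i))" for i
    using mecke_strip[OF S, of i i] by simp
  have sum: "(\<lambda>w. \<Sum>i. indicator (S i) w :: ennreal) = indicator A"
  proof
    fix w
    have "disjoint_family S"
      using disjoint_family_disjointed[of strip] by (fastforce simp: disjoint_family_on_def S_def)
    from suminf_indicator[OF this] have "(\<Sum>i. indicator (S i) w :: ennreal) = indicator (\<Union>i. S i) w" .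
    also have "(\<Union>i. S i) = A \<inter> ((\<Union>i. disjointed strip i) \<times> space LL)"
      by (auto simp: S_def)
    also have "\<dots> = A"
      using sets.sets_into_space[OF A] unfolding UN_disjointed_eq UN_strip by (auto simp: space_pair_measure)
    finally show "(\<Sum>i. indicator (S i) w :: ennreal) = indicator A w" .
  qed
  have "campbell (indicator A) = palm (indicator A)"
    using campbell_suminf[of "\<lambda>i. indicator (S i)"] palm_suminf[of "\<lambda>i. indicator (S i)"] S eq
    unfolding sum by simp
  then show ?thesis
    by (simp add: campbell_def palm_def)
qed

end

section \<open>The embedding as an iteration\<close>

text \<open>A bounded set of natural numbers has a largest element, so the supremum is attained.
  This passes integer values on from strips to a region of unbounded height.\<close>

lemma SUP_of_nat_in_range:
  fixes g :: "nat \<Rightarrow> ennreal"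
  assumes "\<And>i. g i \<in> range of_nat" "(SUP i. g i) \<noteq> \<infinity>"
  shows "(SUP i. g i) \<in> range of_nat"
proof -
  have "\<forall>i. \<exists>n. g i = of_nat n"
    using assms(1) by blast
  then obtain h where h: "\<And>i. g i = of_nat (h i)"
    by metis
  obtain r where r: "(SUP i. g i) = ennreal r" "0 \<le> r"
    using assms(2) by (cases "SUP i. g i") auto
  have "of_nat (h i) \<le> ennreal r" for i
    using SUP_upper[of i UNIV g] h r by simp
  then have "real (h i) \<le> r" for i
    using r by (simp add: ennreal_of_nat_eq_real_of_nat)
  then have "h i \<le> nat \<lfloor>r\<rfloor>" for i
    by (simp add: le_nat_floor)
  then have fin: "finite (range h)"
    by (intro finite_subset[of "range h" "{..nat \<lfloor>r\<rfloor>}"]) auto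
  obtain i where i: "h i = Max (range h)"
    using Max_in[OF fin] by (metis UNIV_not_empty image_is_empty imageE)
  have "(SUP i. g i) = g i"
    using fin i by (intro antisym SUP_least SUP_upper) (auto simp: h)
  then show ?thesis
    using assms(1)[of i] by simp
qed

context gibbs_setting
begin

sublocale marked_space M ..

sublocale MRS: separated_space MR
  by (rule separated_spaceI[of "\<lambda>z. \<phi> (fst z)" MR "\<lambda>z. snd z"])
    (use phi_inj in \<open>auto simp: space_MR dest: inj_onD\<close>)

text \<open>The set under the graph of \<open>p\<close> over the positions in (c, b], that is, what
  the embedding inspects between \<open>c\<close> and \<open>b\<close> while its configuration is
  \<mu>. Its intensity is the integral of \<open>p\<close>.\<close>

definition region :: "ereal \<Rightarrow> ereal \<Rightarrow> 'a measure \<Rightarrow> ('a \<times> real) set" where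
  "region c b \<mu> = {(x, t). x \<in> space M \<and> c < ereal (\<phi> x) \<and> ereal (\<phi> x) \<le> b \<and> 0 \<le> t \<and> ennreal t \<le> p_fun M \<phi> \<kappa> x \<mu>}"

lemma region_sub: "region c b \<mu> \<subseteq> space MR"
  by (auto simp: region_def space_MR)

lemma region_pred_measurable:
  assumes [measurable]: "z \<in> \<Omega> \<rightarrow>\<^sub>M MR" "c \<in> \<Omega> \<rightarrow>\<^sub>M borel" "b \<in> \<Omega> \<rightarrow>\<^sub>M borel" "\<mu> \<in> \<Omega> \<rightarrow>\<^sub>M NN"
  shows "Measurable.pred \<Omega> (\<lambda>\<omega>. z \<omega> \<in> region (c \<omega>) (b \<omega>) (\<mu> \<omega>))"
proof -
  note p_fun_measurable[measurable]
  have [measurable]: "(\<lambda>\<omega>. snd (z \<omega>)) \<in> borel_measurable \<Omega>"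
    using measurable_compose[OF measurable_compose[OF assms(1) measurable_snd] measurable_half_line_borel] .
  have "Measurable.pred \<Omega> (\<lambda>\<omega>. c \<omega> < ereal (\<phi> (fst (z \<omega>))) \<and> ereal (\<phi> (fst (z \<omega>))) \<le> b \<omega> \<and>
    ennreal (snd (z \<omega>)) \<le> p_fun M \<phi> \<kappa> (fst (z \<omega>)) (\<mu> \<omega>))"
    by measurable
  then show ?thesis
  proof (rule measurable_cong[THEN iffD1, rotated])
    fix \<omega> assume "\<omega> \<in> space \<Omega>"
    then have "z \<omega> \<in> space M \<times> {0..}"
      using measurable_space[OF assms(1)] by (simp add: space_MR)
    then show "(c \<omega> < ereal (\<phi> (fst (z \<omega>))) \<and> ereal (\<phi> (fst (z \<omega>))) \<le> b \<omega> \<and>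
      ennreal (snd (z \<omega>)) \<le> p_fun M \<phi> \<kappa> (fst (z \<omega>)) (\<mu> \<omega>)) = (z \<omega> \<in> region (c \<omega>) (b \<omega>) (\<mu> \<omega>))"
      by (auto simp: region_def)
  qed
qed

lemma region_sets [measurable]:
  assumes "\<mu> \<in> counting_measures M (sets M)"
  shows "region c b \<mu> \<in> sets MR"
proof -
  have "Measurable.pred MR (\<lambda>z. z \<in> region c b \<mu>)"
    using assms by (intro region_pred_measurable) auto
  moreover have "region c b \<mu> = {z\<in>space MR. z \<in> region c b \<mu>}"
    using region_sub by auto
  ultimately show ?thesis
    by (simp add: pred_def)
qed

lemma region_emeasure_measurable:
  assumes [measurable]: "\<theta> \<in> \<Omega> \<rightarrow>\<^sub>M LL" "c \<in> \<Omega> \<rightarrow>\<^sub>M borel" "b \<in> \<Omega> \<rightarrow>\<^sub>M borel" "\<mu> \<in> \<Omega> \<rightarrow>\<^sub>M NN"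
  shows "(\<lambda>\<omega>. emeasure (\<theta> \<omega>) (region (c \<omega>) (b \<omega>) (\<mu> \<omega>))) \<in> borel_measurable \<Omega>"
proof (rule emeasure_LL_measurable[OF assms(1)])
  have "Measurable.pred (\<Omega> \<Otimes>\<^sub>M MR) (\<lambda>z. snd z \<in> region (c (fst z)) (b (fst z)) (\<mu> (fst z)))"
    by (intro region_pred_measurable) auto
  then show "{z\<in>space (\<Omega> \<Otimes>\<^sub>M MR). snd z \<in> region (c (fst z)) (b (fst z)) (\<mu> (fst z))} \<in> sets (\<Omega> \<Otimes>\<^sub>M MR)"
    by (simp add: pred_def)
qed (rule region_sub)

lemma emeasure_MR_region:
  assumes \<mu>: "\<mu> \<in> counting_measures M (sets M)"
  shows "emeasure MR (region c b \<mu>) = (\<integral>\<^sup>+x. of_bool (c < ereal (\<phi> x) \<and> ereal (\<phi> x) \<le> b) * p_fun M \<phi> \<kappa> x \<mu> \<partial>M)"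
proof -
  have "emeasure MR (region c b \<mu>) = (\<integral>\<^sup>+x. emeasure half_line (Pair x -` region c b \<mu>) \<partial>M)"
    by (rule L.emeasure_pair_measure_alt[OF region_sets[OF \<mu>]])
  also have "\<dots> = (\<integral>\<^sup>+x. of_bool (c < ereal (\<phi> x) \<and> ereal (\<phi> x) \<le> b) * p_fun M \<phi> \<kappa> x \<mu> \<partial>M)"
  proof (rule nn_integral_cong)
    fix x assume x: "x \<in> space M"
    have "Pair x -` region c b \<mu> = (if c < ereal (\<phi> x) \<and> ereal (\<phi> x) \<le> b then {t. 0 \<le> t \<and> ennreal t \<le> p_fun M \<phi> \<kappa> x \<mu>} else {})"
      using x by (auto simp: region_def)
    then show "emeasure half_line (Pair x -` region c b \<mu>) = of_bool (c < ereal (\<phi> x) \<and> ereal (\<phi> x) \<le> b) * p_fun M \<phi> \<kappa> x \<mu>"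
      by (simp add: emeasure_half_line_le)
  qed
  finally show ?thesis .
qed

text \<open>The region may be unbounded in the second coordinate, where integrality is not part of
  the definition. Finite mass and the limit over strips restore it, and the restricted measure is
  then a finite sum of point masses.\<close>

lemma LL_restrict_dirac_sum:
  assumes \<theta>: "\<theta> \<in> counting_measures MR (strip_sets M)" and R: "R \<in> sets MR" and fin: "emeasure \<theta> R \<noteq> \<infinity>"
  obtains zs where "set zs \<subseteq> R" "\<And>A. A \<in> sets MR \<Longrightarrow> emeasure \<theta> (A \<inter> R) = of_nat (length (filter (\<lambda>z. z \<in> A) zs))"
proof -
  have s: "sets \<theta> = sets MR"
    using LL_sets[OF \<theta>] .
  have "emeasure \<theta> (A \<inter> R) \<in> range of_nat" if A: "A \<in> sets MR" for A
  proof -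
    have "(SUP m. emeasure \<theta> (A \<inter> R \<inter> strip m)) = emeasure \<theta> (\<Union>m. A \<inter> R \<inter> strip m)"
      using A R s incseq_strip by (intro SUP_emeasure_incseq) (auto simp: incseq_def)
    also have "(\<Union>m. A \<inter> R \<inter> strip m) = A \<inter> R"
      using sets.sets_into_space[OF A] by (simp add: UN_strip Int_absorb2 le_infI1 flip: Int_UN_distrib)
    finally have eq: "emeasure \<theta> (A \<inter> R) = (SUP m. emeasure \<theta> (A \<inter> R \<inter> strip m))" ..
    have "emeasure \<theta> (A \<inter> R) \<le> emeasure \<theta> R"
      using R s by (intro emeasure_mono) auto
    then have "emeasure \<theta> (A \<inter> R) \<noteq> \<infinity>"
      using fin by (auto simp: top_unique)
    moreover have "emeasure \<theta> (A \<inter> R \<inter> strip m) \<in> range of_nat" for m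
      using A R by (intro counting_measuresD(2)[OF \<theta>] strip_in_strip_sets) auto
    ultimately show ?thesis
      unfolding eq by (intro SUP_of_nat_in_range)
  qed
  then have "restrict_to \<theta> R \<in> counting_measures MR (sets MR)"
    using R s by (auto simp: counting_measures_def emeasure_restrict_to)
  then obtain zs where zs: "set zs \<subseteq> space MR" "restrict_to \<theta> R = dirac_sum MR zs"
    by (rule MRS.counting_eq_dirac_sum)
  have *: "emeasure \<theta> (A \<inter> R) = of_nat (length (filter (\<lambda>z. z \<in> A) zs))" if "A \<in> sets MR" for A
    using emeasure_restrict_to[of R \<theta> A] that R s unfolding zs(2) by (simp add: emeasure_dirac_sum)
  have "filter (\<lambda>z. z \<in> space MR - R) zs = []"
  proof -
    have "(space MR - R) \<inter> R = {}"
      by auto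
    then have "of_nat (length (filter (\<lambda>z. z \<in> space MR - R) zs)) = (0 :: ennreal)"
      using *[OF sets.compl_sets[OF R]] by (simp only: emeasure_empty)
    then show ?thesis
      by (simp only: of_nat_eq_0_iff length_0_conv)
  qed
  then have "set zs \<subseteq> R"
    using zs(1) by (auto simp: filter_empty_conv)
  then show thesis
    using * by (rule that)
qed

text \<open>A state holds the position of the last point and the configuration so far. Ending with
  minus infinity and ending with infinity are treated alike, since in both cases
  \<open>embedding\<close> returns the points found so far.\<close>

definition next_ok :: "('a \<times> real) measure \<Rightarrow> ereal \<times> 'a measure \<Rightarrow> bool" where
  "next_ok \<theta> s \<longleftrightarrow> (\<integral>\<^sup>+x. of_bool (fst s < ereal (\<phi> x)) * p_fun M \<phi> \<kappa> x (snd s) \<partial>M) \<noteq> \<infinity> \<and>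
    emeasure \<theta> (region (fst s) \<infinity> (snd s)) \<noteq> \<infinity> \<and> emeasure \<theta> (region (fst s) \<infinity> (snd s)) \<noteq> 0"

definition candidates :: "('a \<times> real) measure \<Rightarrow> ereal \<times> 'a measure \<Rightarrow> 'a set" where
  "candidates \<theta> s = {x\<in>tail_set (fst s). \<exists>t\<ge>0. emeasure \<theta> {(x, t)} > 0 \<and> ennreal t \<le> p_fun M \<phi> \<kappa> x (snd s)}"

definition next_pt :: "('a \<times> real) measure \<Rightarrow> ereal \<times> 'a measure \<Rightarrow> 'a" where
  "next_pt \<theta> s = arg_min_on \<phi> (candidates \<theta> s)"

definition next_state :: "('a \<times> real) measure \<Rightarrow> ereal \<times> 'a measure \<Rightarrow> ereal \<times> 'a measure" where
  "next_state \<theta> s = (if next_ok \<theta> s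
    then (ereal (\<phi> (next_pt \<theta> s)), snd s \<oplus>\<^sub>m return M (next_pt \<theta> s)) else s)"

lemma candidates_eq:
  assumes \<theta>: "\<theta> \<in> counting_measures MR (strip_sets M)" and \<mu>: "\<mu> \<in> counting_measures M (sets M)"
    and zs: "set zs \<subseteq> region c \<infinity> \<mu>"
      "\<And>A. A \<in> sets MR \<Longrightarrow> emeasure \<theta> (A \<inter> region c \<infinity> \<mu>) = of_nat (length (filter (\<lambda>z. z \<in> A) zs))"
  shows "candidates \<theta> (c, \<mu>) = fst ` set zs"
proof -
  have iff: "emeasure \<theta> {z} > 0 \<longleftrightarrow> z \<in> set zs" if z: "z \<in> region c \<infinity> \<mu>" for z
  proof -
    have "{z} \<inter> region c \<infinity> \<mu> = {z}"
      using z by auto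
    then have "emeasure \<theta> {z} = of_nat (length (filter (\<lambda>y. y \<in> {z}) zs))"
      using zs(2)[OF MRS.singleton_sets[OF subsetD[OF region_sub z]]] by simp
    then show ?thesis
      by (auto simp: zero_less_iff_neq_zero filter_empty_conv)
  qed
  have "candidates \<theta> (c, \<mu>) = fst ` {z\<in>region c \<infinity> \<mu>. emeasure \<theta> {z} > 0}"
    by (force simp: candidates_def region_def tail_set_def)
  also have "{z\<in>region c \<infinity> \<mu>. emeasure \<theta> {z} > 0} = set zs"
    using iff zs(1) by blast
  finally show ?thesis .
qed

text \<open>Finite mass means finitely many candidates, so the minimum is attained. The last
  equivalence describes the level sets of the next position by masses of regions, which is the
  source of its measurability.\<close>

lemma next_pt_props:
  assumes \<theta>: "\<theta> \<in> counting_measures MR (strip_sets M)" and \<mu>: "\<mu> \<in> counting_measures M (sets M)"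
    and fin: "emeasure \<theta> (region c \<infinity> \<mu>) \<noteq> \<infinity>"
  shows "candidates \<theta> (c, \<mu>) = {} \<longleftrightarrow> emeasure \<theta> (region c \<infinity> \<mu>) = 0"
    and "emeasure \<theta> (region c \<infinity> \<mu>) \<noteq> 0 \<Longrightarrow> next_pt \<theta> (c, \<mu>) \<in> candidates \<theta> (c, \<mu>)"
    and "x \<in> candidates \<theta> (c, \<mu>) \<Longrightarrow> \<phi> (next_pt \<theta> (c, \<mu>)) \<le> \<phi> x"
    and "emeasure \<theta> (region c \<infinity> \<mu>) \<noteq> 0 \<Longrightarrow> \<phi> (next_pt \<theta> (c, \<mu>)) \<le> b \<longleftrightarrow> emeasure \<theta> (region c (ereal b) \<mu>) \<noteq> 0"
proof -
  obtain zs where zs: "set zs \<subseteq> region c \<infinity> \<mu>"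
      "\<And>A. A \<in> sets MR \<Longrightarrow> emeasure \<theta> (A \<inter> region c \<infinity> \<mu>) = of_nat (length (filter (\<lambda>z. z \<in> A) zs))"
    using LL_restrict_dirac_sum[OF \<theta> region_sets[OF \<mu>] fin] by metis
  note cand = candidates_eq[OF \<theta> \<mu> zs]
  have "filter (\<lambda>z. z \<in> region c \<infinity> \<mu>) zs = zs"
    using zs(1) by (auto simp: filter_id_conv)
  then have "emeasure \<theta> (region c \<infinity> \<mu>) = of_nat (length zs)"
    using zs(2)[OF region_sets[OF \<mu>, of c \<infinity>]] by simp
  then show empty: "candidates \<theta> (c, \<mu>) = {} \<longleftrightarrow> emeasure \<theta> (region c \<infinity> \<mu>) = 0"
    by (simp add: cand)
  have fin': "finite (candidates \<theta> (c, \<mu>))"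
    by (simp add: cand)
  then show mem: "next_pt \<theta> (c, \<mu>) \<in> candidates \<theta> (c, \<mu>)" if "emeasure \<theta> (region c \<infinity> \<mu>) \<noteq> 0"
    using that empty unfolding next_pt_def by (intro arg_min_if_finite(1)) auto
  show min: "\<phi> (next_pt \<theta> (c, \<mu>)) \<le> \<phi> x" if "x \<in> candidates \<theta> (c, \<mu>)" for x
    using arg_min_if_finite(2)[OF fin', of \<phi>] that unfolding next_pt_def by (auto simp: not_less)
  have "region c (ereal b) \<mu> \<inter> region c \<infinity> \<mu> = region c (ereal b) \<mu>"
    by (auto simp: region_def)
  then have "emeasure \<theta> (region c (ereal b) \<mu>) = of_nat (length (filter (\<lambda>z. z \<in> region c (ereal b) \<mu>) zs))"
    using zs(2)[OF region_sets[OF \<mu>, of c "ereal b"]] by simp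
  then have "emeasure \<theta> (region c (ereal b) \<mu>) \<noteq> 0 \<longleftrightarrow> (\<exists>z\<in>set zs. z \<in> region c (ereal b) \<mu>)"
    by (simp add: filter_empty_conv)
  also have "\<dots> \<longleftrightarrow> (\<exists>x\<in>candidates \<theta> (c, \<mu>). \<phi> x \<le> b)"
  proof -
    have "z \<in> region c (ereal b) \<mu> \<longleftrightarrow> \<phi> (fst z) \<le> b" if "z \<in> set zs" for z
      using zs(1) that by (auto simp: region_def)
    then show ?thesis
      by (simp add: cand)
  qed
  finally show "\<phi> (next_pt \<theta> (c, \<mu>)) \<le> b \<longleftrightarrow> emeasure \<theta> (region c (ereal b) \<mu>) \<noteq> 0" if "emeasure \<theta> (region c \<infinity> \<mu>) \<noteq> 0"
    using mem[OF that] min by (meson order_trans)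
qed

lemma next_pt_space:
  assumes \<theta>: "\<theta> \<in> counting_measures MR (strip_sets M)" and \<mu>: "snd s \<in> counting_measures M (sets M)"
    and ok: "next_ok \<theta> s"
  shows "next_pt \<theta> s \<in> space M" "fst s < ereal (\<phi> (next_pt \<theta> s))"
  using next_pt_props(2)[OF \<theta> \<mu>, of "fst s"] ok by (auto simp: next_ok_def candidates_def tail_set_def)

lemma next_ok_measurable [measurable]:
  assumes [measurable]: "\<theta> \<in> \<Omega> \<rightarrow>\<^sub>M LL" "s \<in> \<Omega> \<rightarrow>\<^sub>M borel \<Otimes>\<^sub>M NN"
  shows "Measurable.pred \<Omega> (\<lambda>\<omega>. next_ok (\<theta> \<omega>) (s \<omega>))"
proof -
  note p_fun_measurable[measurable] region_emeasure_measurable[measurable]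
  show ?thesis
    unfolding next_ok_def by measurable
qed

text \<open>The position of the next point has measurable level sets by
  \<open>next_pt_props\<close>; the measurable inverse of the coding carries this over to the point
  itself.\<close>

lemma next_state_measurable [measurable]:
  assumes \<theta> [measurable]: "\<theta> \<in> \<Omega> \<rightarrow>\<^sub>M LL" and s [measurable]: "s \<in> \<Omega> \<rightarrow>\<^sub>M borel \<Otimes>\<^sub>M NN"
  shows "(\<lambda>\<omega>. next_state (\<theta> \<omega>) (s \<omega>)) \<in> \<Omega> \<rightarrow>\<^sub>M borel \<Otimes>\<^sub>M NN"
proof (cases "space M = {}")
  case True
  have "\<not> next_ok (\<theta> \<omega>) (s \<omega>)" for \<omega>
  proof -
    have "region (fst (s \<omega>)) \<infinity> (snd (s \<omega>)) = {}"
      using True by (auto simp: region_def)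
    then show ?thesis
      by (simp add: next_ok_def)
  qed
  then show ?thesis
    using s by (simp add: next_state_def)
next
  case False
  then obtain x0 where x0: "x0 \<in> space M" by auto
  note region_emeasure_measurable[measurable]
  \<comment> \<open>Where there is no next point a fixed \<open>x0\<close> serves as value, which is
    why an empty space is treated apart.\<close>
  define y where "y \<omega> = (if next_ok (\<theta> \<omega>) (s \<omega>) then next_pt (\<theta> \<omega>) (s \<omega>) else x0)" for \<omega>
  have sp: "\<theta> \<omega> \<in> counting_measures MR (strip_sets M)" "snd (s \<omega>) \<in> counting_measures M (sets M)" if "\<omega> \<in> space \<Omega>" for \<omega>
    using measurable_space[OF \<theta> that] measurable_space[OF s that] by (auto simp: space_pair_measure)
  have y_space: "y \<omega> \<in> space M" if "\<omega> \<in> space \<Omega>" for \<omega>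
    using next_pt_space(1)[OF sp[OF that]] x0 by (simp add: y_def)
  have phi_y: "(\<lambda>\<omega>. \<phi> (y \<omega>)) \<in> borel_measurable \<Omega>"
    unfolding borel_measurable_iff_le
  proof
    fix a
    have "Measurable.pred \<Omega> (\<lambda>\<omega>. if next_ok (\<theta> \<omega>) (s \<omega>) then emeasure (\<theta> \<omega>) (region (fst (s \<omega>)) (ereal a) (snd (s \<omega>))) \<noteq> 0 else \<phi> x0 \<le> a)"
      by measurable
    moreover have "(if next_ok (\<theta> \<omega>) (s \<omega>) then emeasure (\<theta> \<omega>) (region (fst (s \<omega>)) (ereal a) (snd (s \<omega>))) \<noteq> 0 else \<phi> x0 \<le> a)
      \<longleftrightarrow> \<phi> (y \<omega>) \<le> a" if "\<omega> \<in> space \<Omega>" for \<omega>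
      using next_pt_props(4)[OF sp[OF that], of "fst (s \<omega>)" a] by (auto simp: y_def next_ok_def)
    ultimately show "{\<omega>\<in>space \<Omega>. \<phi> (y \<omega>) \<le> a} \<in> sets \<Omega>"
      unfolding pred_def by (simp cong: Collect_cong conj_cong)
  qed
  have [measurable]: "y \<in> \<Omega> \<rightarrow>\<^sub>M M"
  proof -
    have "(\<lambda>\<omega>. \<phi> (y \<omega>)) \<in> \<Omega> \<rightarrow>\<^sub>M restrict_space borel (\<phi> ` space M)"
      using phi_y y_space by (intro measurable_restrict_space2) auto
    then have "(\<lambda>\<omega>. inv_into (space M) \<phi> (\<phi> (y \<omega>))) \<in> \<Omega> \<rightarrow>\<^sub>M M"
      using coding unfolding borel_coding_def by (elim conjE) (rule measurable_compose)
    moreover have "inv_into (space M) \<phi> (\<phi> (y \<omega>)) = y \<omega>" if "\<omega> \<in> space \<Omega>" for \<omega>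
      using inv_into_f_f[OF phi_inj y_space[OF that]] .
    ultimately show ?thesis
      using measurable_cong[of \<Omega> "\<lambda>\<omega>. inv_into (space M) \<phi> (\<phi> (y \<omega>))" y] by blast
  qed
  have "(\<lambda>\<omega>. if next_ok (\<theta> \<omega>) (s \<omega>) then (ereal (\<phi> (y \<omega>)), snd (s \<omega>) \<oplus>\<^sub>m return M (y \<omega>)) else s \<omega>) \<in> \<Omega> \<rightarrow>\<^sub>M borel \<Otimes>\<^sub>M NN"
    by measurable
  moreover have "(\<lambda>\<omega>. if next_ok (\<theta> \<omega>) (s \<omega>) then (ereal (\<phi> (y \<omega>)), snd (s \<omega>) \<oplus>\<^sub>m return M (y \<omega>)) else s \<omega>) =
    (\<lambda>\<omega>. next_state (\<theta> \<omega>) (s \<omega>))"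
    by (auto simp: next_state_def y_def)
  ultimately show ?thesis
    by simp
qed

text \<open>Fixing the number n of accepted points excludes infinite runs and allows an induction
  that peels off the first point.\<close>

primrec stops_in :: "nat \<Rightarrow> 'a measure set \<Rightarrow> ('a \<times> real) measure \<Rightarrow> ereal \<times> 'a measure \<Rightarrow> bool" where
  "stops_in 0 A \<theta> s \<longleftrightarrow> \<not> next_ok \<theta> s \<and> snd s \<in> A"
| "stops_in (Suc n) A \<theta> s \<longleftrightarrow> next_ok \<theta> s \<and> stops_in n A \<theta> (next_state \<theta> s)"

lemma stops_in_measurable:
  assumes A: "A \<in> sets NN" and "\<theta> \<in> \<Omega> \<rightarrow>\<^sub>M LL" "s \<in> \<Omega> \<rightarrow>\<^sub>M borel \<Otimes>\<^sub>M NN"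
  shows "Measurable.pred \<Omega> (\<lambda>\<omega>. stops_in n A (\<theta> \<omega>) (s \<omega>))"
  using assms(2,3)
proof (induct n arbitrary: s)
  case 0
  note A[measurable] 0[measurable]
  show ?case
    unfolding stops_in.simps by measurable
next
  case (Suc n)
  note Suc(2,3)[measurable]
  have [measurable]: "Measurable.pred \<Omega> (\<lambda>\<omega>. stops_in n A (\<theta> \<omega>) (next_state (\<theta> \<omega>) (s \<omega>)))"
    using Suc(2) by (intro Suc(1)) measurable
  show ?case
    unfolding stops_in.simps by measurable
qed

lemma next_state_counting:
  assumes "\<theta> \<in> counting_measures MR (strip_sets M)" "snd s \<in> counting_measures M (sets M)"
  shows "snd (next_state \<theta> s) \<in> counting_measures M (sets M)"
  using assms by (simp add: next_state_def add_return_counting)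

text \<open>From the current position on, only points strictly to the right matter, and an extra
  point at or before it changes nothing. This undoes the point that the Mecke equation adds to the
  configuration.\<close>

lemma stops_in_add_return:
  assumes "\<theta> \<in> counting_measures MR (strip_sets M)" "snd s \<in> counting_measures M (sets M)"
    and "ereal (\<phi> (fst z)) \<le> fst s"
  shows "stops_in n A (\<theta> \<oplus>\<^sub>m return MR z) s \<longleftrightarrow> stops_in n A \<theta> s"
  using assms(2,3)
proof (induct n arbitrary: s)
  have ok: "next_ok (\<theta> \<oplus>\<^sub>m return MR z) s \<longleftrightarrow> next_ok \<theta> s"
    and pt: "next_pt (\<theta> \<oplus>\<^sub>m return MR z) s = next_pt \<theta> s"
    if s: "snd s \<in> counting_measures M (sets M)" "ereal (\<phi> (fst z)) \<le> fst s" for s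
  proof -
    have "emeasure (\<theta> \<oplus>\<^sub>m return MR z) A = emeasure \<theta> A" if "A \<in> sets MR" "z \<notin> A" for A
      using that LL_sets[OF assms(1)] by (simp add: emeasure_add_measure)
    note eq = this
    have "z \<notin> region (fst s) \<infinity> (snd s)"
      using s(2) by (auto simp: region_def)
    then show "next_ok (\<theta> \<oplus>\<^sub>m return MR z) s \<longleftrightarrow> next_ok \<theta> s"
      using region_sets[OF s(1)] by (simp add: next_ok_def eq)
    have "emeasure (\<theta> \<oplus>\<^sub>m return MR z) {(x, t)} = emeasure \<theta> {(x, t)}" if "x \<in> tail_set (fst s)" "0 \<le> t" for x t
    proof (rule eq)
      show "{(x, t)} \<in> sets MR"
        using that by (intro MRS.singleton_sets) (auto simp: tail_set_def space_MR)
      show "z \<notin> {(x, t)}"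
        using that s(2) by (auto simp: tail_set_def)
    qed
    then have "candidates (\<theta> \<oplus>\<^sub>m return MR z) s = candidates \<theta> s"
      unfolding candidates_def by (intro Collect_cong conj_cong ex_cong refl) auto
    then show "next_pt (\<theta> \<oplus>\<^sub>m return MR z) s = next_pt \<theta> s"
      by (simp add: next_pt_def)
  qed
  {
    case 0
    then show ?case
      by (simp add: ok)
  next
    case (Suc n)
    have st: "next_state (\<theta> \<oplus>\<^sub>m return MR z) s = next_state \<theta> s"
      using Suc(2,3) by (simp add: next_state_def ok pt)
    have "ereal (\<phi> (fst z)) \<le> fst (next_state \<theta> s)"
    proof (cases "next_ok \<theta> s")
      case True
      then show ?thesis
        using less_imp_le[OF le_less_trans[OF Suc(3) next_pt_space(2)[OF assms(1) Suc(2) True]]]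
        by (simp add: next_state_def)
    qed (use Suc(3) in \<open>simp add: next_state_def\<close>)
    then have "stops_in n A (\<theta> \<oplus>\<^sub>m return MR z) (next_state \<theta> s) \<longleftrightarrow> stops_in n A \<theta> (next_state \<theta> s)"
      using Suc(2) assms(1) by (intro Suc(1) next_state_counting)
    then show ?case
      using Suc(2,3) by (simp add: ok st)
  }
qed

text \<open>A point of \<open>S\<close> is alone in the region up to its own position, so it is the
  leftmost candidate and the iteration passes through it. There is at most one such point, and hence
  the mass of \<open>S\<close> is at most 1 and vanishes unless the iteration stops as
  required.\<close>

lemma stops_in_step:
  assumes \<theta>: "\<theta> \<in> counting_measures MR (strip_sets M)" and \<mu>: "\<mu> \<in> counting_measures M (sets M)"
    and fin: "emeasure \<theta> (region c \<infinity> \<mu>) \<noteq> \<infinity>"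
    and int: "(\<integral>\<^sup>+x. of_bool (c < ereal (\<phi> x)) * p_fun M \<phi> \<kappa> x \<mu> \<partial>M) \<noteq> \<infinity>"
    and S: "S \<in> sets MR"
    and S_sub: "\<And>z. z \<in> S \<Longrightarrow> z \<in> region c \<infinity> \<mu> \<and> emeasure \<theta> (region c (ereal (\<phi> (fst z))) \<mu>) = 1 \<and>
      stops_in n A \<theta> (ereal (\<phi> (fst z)), \<mu> \<oplus>\<^sub>m return M (fst z))"
  shows "emeasure \<theta> S \<le> of_bool (stops_in (Suc n) A \<theta> (c, \<mu>))"
proof -
  obtain zs where zs: "set zs \<subseteq> region c \<infinity> \<mu>"
      "\<And>A. A \<in> sets MR \<Longrightarrow> emeasure \<theta> (A \<inter> region c \<infinity> \<mu>) = of_nat (length (filter (\<lambda>z. z \<in> A) zs))"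
    using LL_restrict_dirac_sum[OF \<theta> region_sets[OF \<mu>] fin] by metis
  note cand = candidates_eq[OF \<theta> \<mu> zs]
  have "S \<inter> region c \<infinity> \<mu> = S"
    using S_sub by auto
  then have eS: "emeasure \<theta> S = of_nat (length (filter (\<lambda>z. z \<in> S) zs))"
    using zs(2)[OF S] by simp
  show ?thesis
  proof (cases "filter (\<lambda>z. z \<in> S) zs = []")
    case False
    then obtain z where z: "z \<in> set zs" "z \<in> S"
      by (auto simp: filter_empty_conv)
    have one: "length (filter (\<lambda>y. y \<in> region c (ereal (\<phi> (fst z))) \<mu>) zs) = 1" if "z \<in> S" for z
    proof -
      have "region c (ereal (\<phi> (fst z))) \<mu> \<inter> region c \<infinity> \<mu> = region c (ereal (\<phi> (fst z))) \<mu>"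
        by (auto simp: region_def)
      then have "of_nat (length (filter (\<lambda>y. y \<in> region c (ereal (\<phi> (fst z))) \<mu>) zs)) = (of_nat 1 :: ennreal)"
        using zs(2)[OF region_sets[OF \<mu>, of c "ereal (\<phi> (fst z))"]] S_sub[OF that] by simp
      then show ?thesis
        by (simp only: of_nat_eq_iff)
    qed
    have pos: "emeasure \<theta> (region c \<infinity> \<mu>) \<noteq> 0"
      using next_pt_props(1)[OF \<theta> \<mu> fin] z(1) cand by auto
    have ok: "next_ok \<theta> (c, \<mu>)"
      using fin int pos by (simp add: next_ok_def)
    have np: "fst y = next_pt \<theta> (c, \<mu>)" if y: "y \<in> set zs" "y \<in> S" for y
    proof -
      \<comment> \<open>The atom \<open>z0\<close> over the next point lies in the region up to the
        position of \<open>y\<close>, which holds one atom only, namely \<open>y\<close>.\<close>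
      obtain z0 where z0: "z0 \<in> set zs" "fst z0 = next_pt \<theta> (c, \<mu>)"
        using next_pt_props(2)[OF \<theta> \<mu> fin pos] cand by auto
      have "\<phi> (fst z0) \<le> \<phi> (fst y)"
        unfolding z0(2) using y cand by (intro next_pt_props(3)[OF \<theta> \<mu> fin]) auto
      then have "z0 \<in> set (filter (\<lambda>x. x \<in> region c (ereal (\<phi> (fst y))) \<mu>) zs)"
        "y \<in> set (filter (\<lambda>x. x \<in> region c (ereal (\<phi> (fst y))) \<mu>) zs)"
        using z0(1) y(1) zs(1) by (auto simp: region_def)
      moreover obtain u where "filter (\<lambda>x. x \<in> region c (ereal (\<phi> (fst y))) \<mu>) zs = [u]"
        using one[OF y(2)] by (auto simp: length_Suc_conv)
      ultimately have "z0 = y" by simp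
      then show ?thesis using z0 by simp
    qed
    have "stops_in n A \<theta> (next_state \<theta> (c, \<mu>))"
      using S_sub[OF z(2)] np[OF z] ok by (simp add: next_state_def)
    then have stop: "stops_in (Suc n) A \<theta> (c, \<mu>)"
      using ok by simp
    have "filter (\<lambda>y. y \<in> S) zs = filter (\<lambda>y. y \<in> S) (filter (\<lambda>y. y \<in> region c (ereal (\<phi> (fst z))) \<mu>) zs)"
      unfolding filter_filter
    proof (rule filter_cong[OF refl])
      fix y assume y: "y \<in> set zs"
      have "y \<in> region c (ereal (\<phi> (fst z))) \<mu>" if "y \<in> S"
        using np[OF y that] np[OF z] y zs(1) by (auto simp: region_def)
      then show "(y \<in> S) = (y \<in> region c (ereal (\<phi> (fst z))) \<mu> \<and> y \<in> S)"
        by blast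
    qed
    then have "length (filter (\<lambda>y. y \<in> S) zs) \<le> 1"
      using one[OF z(2)] length_filter_le[of "\<lambda>y. y \<in> S" "filter (\<lambda>y. y \<in> region c (ereal (\<phi> (fst z))) \<mu>) zs"] by simp
    then have "emeasure \<theta> S \<le> of_nat 1"
      unfolding eS by (rule of_nat_mono)
    then show ?thesis
      using stop by simp
  qed (simp add: eS)
qed

end

section \<open>Agreement of the iteration with the recursive definition of T\<close>

lemma (in gibbs_setting) next_point_eq:
  assumes \<theta>: "\<theta> \<in> counting_measures MR (strip_sets M)" and \<mu>: "snd s \<in> counting_measures M (sets M)"
  shows "next_ok \<theta> s \<Longrightarrow> next_point M \<phi> \<kappa> \<theta> (tail_set (fst s)) (snd s) = Fin (next_pt \<theta> s)"
    and "\<not> next_ok \<theta> s \<Longrightarrow> next_point M \<phi> \<kappa> \<theta> (tail_set (fst s)) (snd s) \<notin> range Fin"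
proof -
  have r: "{(x, t). x \<in> tail_set (fst s) \<and> 0 \<le> t \<and> ennreal t \<le> p_fun M \<phi> \<kappa> x (snd s)} = region (fst s) \<infinity> (snd s)"
    by (auto simp: region_def tail_set_def)
  have i: "(\<integral>\<^sup>+x. indicator (tail_set (fst s)) x * p_fun M \<phi> \<kappa> x (snd s) \<partial>M) =
    (\<integral>\<^sup>+x. of_bool (fst s < ereal (\<phi> x)) * p_fun M \<phi> \<kappa> x (snd s) \<partial>M)"
    by (intro nn_integral_cong) (auto simp: tail_set_def)
  have eq: "next_point M \<phi> \<kappa> \<theta> (tail_set (fst s)) (snd s) =
    (if (\<integral>\<^sup>+x. of_bool (fst s < ereal (\<phi> x)) * p_fun M \<phi> \<kappa> x (snd s) \<partial>M) = \<infinity> \<or>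
       emeasure \<theta> (region (fst s) \<infinity> (snd s)) = \<infinity> then Minf
     else if candidates \<theta> s = {} then Pinf else Fin (next_pt \<theta> s))"
    unfolding next_point_def Let_def r i candidates_def[symmetric] next_pt_def by simp
  have c: "candidates \<theta> s = {} \<longleftrightarrow> emeasure \<theta> (region (fst s) \<infinity> (snd s)) = 0"
    if "emeasure \<theta> (region (fst s) \<infinity> (snd s)) \<noteq> \<infinity>"
    using next_pt_props(1)[OF \<theta> \<mu> that] by simp
  show "next_ok \<theta> s \<Longrightarrow> next_point M \<phi> \<kappa> \<theta> (tail_set (fst s)) (snd s) = Fin (next_pt \<theta> s)"
    unfolding eq using c by (auto simp: next_ok_def)
  show "\<not> next_ok \<theta> s \<Longrightarrow> next_point M \<phi> \<kappa> \<theta> (tail_set (fst s)) (snd s) \<notin> range Fin"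
    unfolding eq using c by (auto simp: next_ok_def)
qed

lemma the_point_Fin [simp]: "the_point (Fin x) = x"
  by (simp add: the_point_def)

context gibbs_setting
begin

definition state :: "('a \<times> real) measure \<Rightarrow> nat \<Rightarrow> ereal \<times> 'a measure" where
  "state \<theta> n = (next_state \<theta> ^^ n) (-\<infinity>, null_measure M)"

lemma state_0 [simp]: "state \<theta> 0 = (-\<infinity>, null_measure M)"
  and state_Suc: "state \<theta> (Suc n) = next_state \<theta> (state \<theta> n)"
  by (simp_all add: state_def)

lemma state_counting:
  "\<theta> \<in> counting_measures MR (strip_sets M) \<Longrightarrow> snd (state \<theta> n) \<in> counting_measures M (sets M)"
  by (induct n) (auto simp: state_Suc intro!: next_state_counting)

lemma tail_set_MInf: "tail_set (-\<infinity>) = space M"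
  by (simp add: tail_set_def)

text \<open>With no point so far the threshold is minus infinity, whose tail is the whole space;
  thus the first step and the later ones take the same form.\<close>

lemma embedding_points_Suc:
  assumes "embedding_points M \<phi> \<kappa> \<theta> n = map Fin xs"
    and "snd (state \<theta> n) = dirac_sum M xs" "fst (state \<theta> n) = (if xs = [] then -\<infinity> else ereal (\<phi> (last xs)))"
  shows "embedding_points M \<phi> \<kappa> \<theta> (Suc n) =
    map Fin xs @ [next_point M \<phi> \<kappa> \<theta> (tail_set (fst (state \<theta> n))) (snd (state \<theta> n))]"
proof -
  have "map the_point (map Fin xs) = xs"
    by (simp add: o_def)
  then show ?thesis
    using assms by (simp add: Let_def last_map tail_set_MInf above_eq del: map_map)
qed

lemma embedding_points_alive:
  assumes \<theta>: "\<theta> \<in> counting_measures MR (strip_sets M)" and ok: "\<And>i. i < n \<Longrightarrow> next_ok \<theta> (state \<theta> i)"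
  shows "\<exists>xs. embedding_points M \<phi> \<kappa> \<theta> n = map Fin xs \<and> length xs = n \<and>
    snd (state \<theta> n) = dirac_sum M xs \<and> fst (state \<theta> n) = (if xs = [] then -\<infinity> else ereal (\<phi> (last xs)))"
  using ok
proof (induct n)
  case (Suc n)
  then obtain xs where xs: "embedding_points M \<phi> \<kappa> \<theta> n = map Fin xs" "length xs = n"
    "snd (state \<theta> n) = dirac_sum M xs" "fst (state \<theta> n) = (if xs = [] then -\<infinity> else ereal (\<phi> (last xs)))"
    by auto
  have "embedding_points M \<phi> \<kappa> \<theta> (Suc n) = map Fin (xs @ [next_pt \<theta> (state \<theta> n)])"
    unfolding embedding_points_Suc[OF xs(1,3,4)]
    using next_point_eq(1)[OF \<theta> state_counting[OF \<theta>]] Suc(2)[of n] by simp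
  moreover have "state \<theta> (Suc n) = (ereal (\<phi> (next_pt \<theta> (state \<theta> n))), dirac_sum M xs \<oplus>\<^sub>m return M (next_pt \<theta> (state \<theta> n)))"
    using Suc(2)[of n] xs(3) by (simp add: state_Suc next_state_def)
  ultimately show ?case
    using xs(2) by (intro exI[of _ "xs @ [next_pt \<theta> (state \<theta> n)]"]) simp
qed simp

lemma embedding_point_dead:
  assumes "embedding_point M \<phi> \<kappa> \<theta> (Suc n) \<notin> range Fin"
  shows "embedding_point M \<phi> \<kappa> \<theta> (Suc n + k) \<notin> range Fin"
proof (induct k)
  case (Suc k)
  have ne: "embedding_points M \<phi> \<kappa> \<theta> (Suc n + k) \<noteq> []"
    by (simp add: Let_def)
  have "embedding_points M \<phi> \<kappa> \<theta> (Suc (Suc n + k)) = embedding_points M \<phi> \<kappa> \<theta> (Suc n + k) @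
    [case last (embedding_points M \<phi> \<kappa> \<theta> (Suc n + k)) of
        Fin x \<Rightarrow> next_point M \<phi> \<kappa> \<theta> (above M \<phi> x) (dirac_sum M (map the_point (embedding_points M \<phi> \<kappa> \<theta> (Suc n + k))))
      | Minf \<Rightarrow> Minf | Pinf \<Rightarrow> Pinf]"
    using ne unfolding embedding_points.simps(2)[of _ _ _ _ "Suc n + k"] Let_def by (simp only: if_False)
  moreover have "last (embedding_points M \<phi> \<kappa> \<theta> (Suc n + k)) \<notin> range Fin"
    using Suc by (simp add: embedding_point_def)
  ultimately show ?case
    by (cases "last (embedding_points M \<phi> \<kappa> \<theta> (Suc n + k))") (simp_all add: embedding_point_def del: embedding_points.simps)
qed (use assms in simp)

lemma embedding_point_alive:
  assumes \<theta>: "\<theta> \<in> counting_measures MR (strip_sets M)" and ok: "\<And>i. i < n \<Longrightarrow> next_ok \<theta> (state \<theta> i)" and m: "1 \<le> m" "m \<le> n"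
  shows "embedding_point M \<phi> \<kappa> \<theta> m \<in> range Fin"
proof -
  obtain xs where "embedding_points M \<phi> \<kappa> \<theta> m = map Fin xs" "length xs = m"
    using embedding_points_alive[OF \<theta>, of m] ok m by auto
  then show ?thesis
    using m by (cases xs rule: rev_cases) (auto simp: embedding_point_def)
qed

lemma embedding_stopped:
  assumes \<theta>: "\<theta> \<in> counting_measures MR (strip_sets M)" and ok: "\<And>i. i < n \<Longrightarrow> next_ok \<theta> (state \<theta> i)"
    and stop: "\<not> next_ok \<theta> (state \<theta> n)"
  shows "embedding M \<phi> \<kappa> \<theta> = snd (state \<theta> n)"
proof -
  obtain xs where xs: "embedding_points M \<phi> \<kappa> \<theta> n = map Fin xs" "length xs = n"
    "snd (state \<theta> n) = dirac_sum M xs" "fst (state \<theta> n) = (if xs = [] then -\<infinity> else ereal (\<phi> (last xs)))"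
    using embedding_points_alive[OF \<theta> ok] by auto
  have "embedding_point M \<phi> \<kappa> \<theta> (Suc n) \<notin> range Fin"
    unfolding embedding_point_def embedding_points_Suc[OF xs(1,3,4)]
    using next_point_eq(2)[OF \<theta> state_counting[OF \<theta>] stop] by simp
  then have dead: "embedding_point M \<phi> \<kappa> \<theta> m \<notin> range Fin" if "n < m" for m
    using embedding_point_dead[of \<theta> n "m - Suc n"] that by simp
  have "{enat m | m. 1 \<le> m \<and> embedding_point M \<phi> \<kappa> \<theta> m \<in> range Fin} = {enat m | m. 1 \<le> m \<and> m \<le> n}"
    using embedding_point_alive[OF \<theta> ok] dead by (metis (no_types, lifting) not_less)
  moreover have "Sup {enat m | m. 1 \<le> m \<and> m \<le> n} = enat n"
  proof (rule antisym)
    show "Sup {enat m | m. 1 \<le> m \<and> m \<le> n} \<le> enat n"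
      by (rule Sup_least) auto
    show "enat n \<le> Sup {enat m | m. 1 \<le> m \<and> m \<le> n}"
    proof (cases n)
      case 0
      then show ?thesis by (simp add: enat_0)
    next
      case (Suc k)
      then show ?thesis by (intro Sup_upper) auto
    qed
  qed
  ultimately have "embedding_tau M \<phi> \<kappa> \<theta> = enat n"
    by (simp add: embedding_tau_def)
  moreover have "map the_point (map Fin xs) = xs"
    by (simp add: o_def)
  ultimately show ?thesis
    using xs by (simp add: embedding_def del: map_map)
qed

lemma embedding_unstopped:
  assumes \<theta>: "\<theta> \<in> counting_measures MR (strip_sets M)" and ok: "\<And>i. next_ok \<theta> (state \<theta> i)"
  shows "embedding M \<phi> \<kappa> \<theta> = null_measure M"
proof -
  have "embedding_tau M \<phi> \<kappa> \<theta> \<noteq> enat n" for n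
  proof
    assume tau: "embedding_tau M \<phi> \<kappa> \<theta> = enat n"
    have "embedding_point M \<phi> \<kappa> \<theta> (Suc n) \<in> range Fin"
      using ok by (intro embedding_point_alive[OF \<theta>, of "Suc n"]) auto
    then have "enat (Suc n) \<le> embedding_tau M \<phi> \<kappa> \<theta>"
      unfolding embedding_tau_def by (intro Sup_upper CollectI exI[of _ "Suc n"]) simp
    with tau show False by simp
  qed
  then have "embedding_tau M \<phi> \<kappa> \<theta> = \<infinity>"
    by (cases "embedding_tau M \<phi> \<kappa> \<theta>") auto
  then show ?thesis
    by (simp add: embedding_def)
qed

lemma stops_in_iff:
  "stops_in n A \<theta> s \<longleftrightarrow> (\<forall>i<n. next_ok \<theta> ((next_state \<theta> ^^ i) s)) \<and>
    \<not> next_ok \<theta> ((next_state \<theta> ^^ n) s) \<and> snd ((next_state \<theta> ^^ n) s) \<in> A"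
proof (induct n arbitrary: s)
  case (Suc n)
  have "(\<forall>i<Suc n. next_ok \<theta> ((next_state \<theta> ^^ i) s)) \<longleftrightarrow>
    next_ok \<theta> s \<and> (\<forall>i<n. next_ok \<theta> ((next_state \<theta> ^^ Suc i) s))"
    by (subst All_less_Suc2) simp
  then show ?case
    unfolding stops_in.simps Suc by (simp add: funpow_swap1)
qed simp

lemma stops_in_unique: "stops_in n A \<theta> s \<Longrightarrow> stops_in m B \<theta> s \<Longrightarrow> n = m"
  unfolding stops_in_iff by (metis linorder_neqE_nat)

lemma stops_in_embedding:
  assumes \<theta>: "\<theta> \<in> counting_measures MR (strip_sets M)"
  shows "stops_in n UNIV \<theta> (-\<infinity>, null_measure M) \<Longrightarrow>
      stops_in n A \<theta> (-\<infinity>, null_measure M) \<longleftrightarrow> embedding M \<phi> \<kappa> \<theta> \<in> A"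
    and "(\<And>n. \<not> stops_in n UNIV \<theta> (-\<infinity>, null_measure M)) \<Longrightarrow> embedding M \<phi> \<kappa> \<theta> = null_measure M"
proof -
  show "stops_in n A \<theta> (-\<infinity>, null_measure M) \<longleftrightarrow> embedding M \<phi> \<kappa> \<theta> \<in> A"
    if "stops_in n UNIV \<theta> (-\<infinity>, null_measure M)"
    using that embedding_stopped[OF \<theta>, of n] unfolding stops_in_iff state_def by auto
  assume never: "\<And>n. \<not> stops_in n UNIV \<theta> (-\<infinity>, null_measure M)"
  have "next_ok \<theta> (state \<theta> i)" for i
  proof (induct i rule: less_induct)
    case (less i)
    then show ?case
      using never[of i] unfolding stops_in_iff state_def by auto
  qed
  then show "embedding M \<phi> \<kappa> \<theta> = null_measure M"
    by (rule embedding_unstopped[OF \<theta>])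
qed

lemma embedding_counting: "embedding M \<phi> \<kappa> \<theta> \<in> counting_measures M (sets M)"
  by (auto simp: embedding_def split: enat.split)

lemma stops_in_UNIV_eq:
  assumes "\<theta> \<in> counting_measures MR (strip_sets M)"
  shows "stops_in n UNIV \<theta> (-\<infinity>, null_measure M) \<longleftrightarrow> stops_in n (space NN) \<theta> (-\<infinity>, null_measure M)"
  using state_counting[OF assms, of n] unfolding stops_in_iff state_def by simp

text \<open>For each n, stopping in \<open>A\<close> after n points is a measurable event. Runs that
  never stop are sent to the null measure, which accounts for the second alternative.\<close>

lemma embedding_measurable:
  assumes \<theta> [measurable]: "\<theta> \<in> \<Omega> \<rightarrow>\<^sub>M LL"
  shows "(\<lambda>\<omega>. embedding M \<phi> \<kappa> (\<theta> \<omega>)) \<in> \<Omega> \<rightarrow>\<^sub>M NN"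
proof (rule measurableI)
  show "embedding M \<phi> \<kappa> (\<theta> \<omega>) \<in> space NN" for \<omega>
    by (simp add: embedding_counting)
  fix A assume A: "A \<in> sets NN"
  let ?s = "(-\<infinity>, null_measure M) :: ereal \<times> 'a measure"
  have s: "(\<lambda>_. ?s) \<in> \<Omega> \<rightarrow>\<^sub>M borel \<Otimes>\<^sub>M NN"
    by (intro measurable_const) (simp add: space_pair_measure)
  have [measurable]: "Measurable.pred \<Omega> (\<lambda>\<omega>. stops_in n A (\<theta> \<omega>) ?s)"
    "Measurable.pred \<Omega> (\<lambda>\<omega>. stops_in n (space NN) (\<theta> \<omega>) ?s)" for n
    using stops_in_measurable[OF A \<theta> s] stops_in_measurable[OF sets.top \<theta> s] by auto
  have "{\<omega>\<in>space \<Omega>. (\<exists>n. stops_in n A (\<theta> \<omega>) ?s) \<or> (\<forall>n. \<not> stops_in n (space NN) (\<theta> \<omega>) ?s) \<and> null_measure M \<in> A} \<in> sets \<Omega>"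
    by measurable
  also have "{\<omega>\<in>space \<Omega>. (\<exists>n. stops_in n A (\<theta> \<omega>) ?s) \<or> (\<forall>n. \<not> stops_in n (space NN) (\<theta> \<omega>) ?s) \<and> null_measure M \<in> A} =
    (\<lambda>\<omega>. embedding M \<phi> \<kappa> (\<theta> \<omega>)) -` A \<inter> space \<Omega>"
  proof -
    have "(\<exists>n. stops_in n A (\<theta> \<omega>) ?s) \<or> (\<forall>n. \<not> stops_in n (space NN) (\<theta> \<omega>) ?s) \<and> null_measure M \<in> A \<longleftrightarrow>
      embedding M \<phi> \<kappa> (\<theta> \<omega>) \<in> A" if "\<omega> \<in> space \<Omega>" for \<omega>
    proof -
      have \<theta>': "\<theta> \<omega> \<in> counting_measures MR (strip_sets M)"
        using measurable_space[OF \<theta> that] by simp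
      show ?thesis
      proof (cases "\<exists>n. stops_in n UNIV (\<theta> \<omega>) ?s")
        case True
        then obtain n where n: "stops_in n UNIV (\<theta> \<omega>) ?s" by blast
        have "stops_in n (space NN) (\<theta> \<omega>) ?s"
          using n stops_in_UNIV_eq[OF \<theta>'] by blast
        moreover have "(\<exists>m. stops_in m A (\<theta> \<omega>) ?s) \<longleftrightarrow> stops_in n A (\<theta> \<omega>) ?s"
          using stops_in_unique n by blast
        ultimately show ?thesis
          using stops_in_embedding(1)[OF \<theta>' n, of A] by blast
      next
        case False
        then have "embedding M \<phi> \<kappa> (\<theta> \<omega>) = null_measure M"
          using stops_in_embedding(2)[OF \<theta>'] by blast
        moreover have "\<not> stops_in n A (\<theta> \<omega>) ?s" for n
          using False unfolding stops_in_iff by blast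
        moreover have "\<not> stops_in n (space NN) (\<theta> \<omega>) ?s" for n
          using False stops_in_UNIV_eq[OF \<theta>'] by blast
        ultimately show ?thesis
          by simp
      qed
    qed
    then show ?thesis by blast
  qed
  finally show "(\<lambda>\<omega>. embedding M \<phi> \<kappa> (\<theta> \<omega>)) -` A \<inter> space \<Omega> \<in> sets \<Omega>" .
qed

end

section \<open>The law of the embedding\<close>

locale embedding_setting = gibbs_setting M \<phi> \<kappa> + marked_poisson M P \<Phi>
  for M :: "'a measure" and \<phi> and \<kappa> and P :: "'w measure" and \<Phi>
begin

lemma tail_weight_PInf: "\<mu> \<in> counting_measures M (sets M) \<Longrightarrow> tail_weight \<infinity> \<mu> = 1"
  by (subst tail_weight_step) auto

text \<open>By \<open>p_fun_integral\<close> the intensity of the region is a logarithm; its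
  negative exponential, the void probability, is then a quotient of tail weights, which telescopes
  from step to step.\<close>

lemma measure_region:
  assumes \<mu>: "\<mu> \<in> counting_measures M (sets M)" and null: "emeasure \<mu> (tail_set c) = 0"
    and fin: "tail_weight c \<mu> < \<infinity>" and cb: "c \<le> b"
  shows "emeasure MR (region c b \<mu>) < \<infinity>"
    and "ennreal (exp (- measure MR (region c b \<mu>))) = tail_weight b \<mu> / tail_weight c \<mu>"
proof -
  have e: "emeasure MR (region c b \<mu>) = ennreal (ln (enn2real (tail_weight c \<mu>) / enn2real (tail_weight b \<mu>)))"
    unfolding emeasure_MR_region[OF \<mu>] by (rule p_fun_integral[OF assms])
  then show "emeasure MR (region c b \<mu>) < \<infinity>"
    by simp
  obtain f where f: "tail_weight c \<mu> = ennreal f" "0 \<le> f"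
    using fin by (cases "tail_weight c \<mu>") auto
  obtain f' where f': "tail_weight b \<mu> = ennreal f'" "0 \<le> f'"
    using tail_weight_antimono[OF \<mu> cb] f by (cases "tail_weight b \<mu>") (auto simp: top_unique)
  have "1 \<le> f'" "f' \<le> f"
    using tail_weight_ge_1[OF \<mu>, of b] tail_weight_antimono[OF \<mu> cb] f f' by simp_all
  then have "measure MR (region c b \<mu>) = ln (f / f')"
    using e f f' by (simp add: measure_def)
  then have "exp (- measure MR (region c b \<mu>)) = f' / f"
    using \<open>1 \<le> f'\<close> \<open>f' \<le> f\<close> by (simp add: exp_minus field_simps)
  then show "ennreal (exp (- measure MR (region c b \<mu>))) = tail_weight b \<mu> / tail_weight c \<mu>"
    using \<open>1 \<le> f'\<close> \<open>f' \<le> f\<close> f f' by (simp add: divide_ennreal)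
qed

text \<open>The Mecke equation bounds the mean number of points by the intensity, and a finite mean
  excludes infinite values almost surely.\<close>

lemma Phi_finite:
  assumes "R \<in> sets MR" "emeasure MR R < \<infinity>"
  shows "AE \<omega> in P. emeasure (\<Phi> \<omega>) R \<noteq> \<infinity>"
proof -
  have R: "R \<times> space LL \<in> sets (MR \<Otimes>\<^sub>M LL)"
    using assms(1) by (intro pair_measureI sets.top)
  have "(\<integral>\<^sup>+\<omega>. emeasure (\<Phi> \<omega>) R \<partial>P) = (\<integral>\<^sup>+\<omega>. (\<integral>\<^sup>+z. indicator (R \<times> space LL) (z, \<Phi> \<omega>) \<partial>\<Phi> \<omega>) \<partial>P)"
  proof (rule nn_integral_cong)
    fix \<omega> assume \<omega>: "\<omega> \<in> space P"
    have "(\<integral>\<^sup>+z. indicator (R \<times> space LL) (z, \<Phi> \<omega>) \<partial>\<Phi> \<omega>) = (\<integral>\<^sup>+z. indicator R z \<partial>\<Phi> \<omega>)"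
      using Phi_space[OF \<omega>] by (intro nn_integral_cong) (auto split: split_indicator)
    then show "emeasure (\<Phi> \<omega>) R = (\<integral>\<^sup>+z. indicator (R \<times> space LL) (z, \<Phi> \<omega>) \<partial>\<Phi> \<omega>)"
      using LL_sets[OF Phi_space[OF \<omega>]] assms(1) by simp
  qed
  also have "\<dots> = (\<integral>\<^sup>+\<omega>. (\<integral>\<^sup>+z. indicator (R \<times> space LL) (z, \<Phi> \<omega> \<oplus>\<^sub>m return MR z) \<partial>MR) \<partial>P)"
    by (rule mecke[OF R])
  also have "\<dots> \<le> (\<integral>\<^sup>+\<omega>. (\<integral>\<^sup>+z. indicator R z \<partial>MR) \<partial>P)"
    by (intro nn_integral_mono) (auto split: split_indicator)
  also have "\<dots> = emeasure MR R"
    using assms(1) P.emeasure_space_1 by simp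
  finally have "(\<integral>\<^sup>+\<omega>. emeasure (\<Phi> \<omega>) R \<partial>P) \<noteq> \<infinity>"
    using assms(2) by auto
  moreover have "(\<lambda>\<omega>. emeasure (\<Phi> \<omega>) R) \<in> borel_measurable P"
    by (rule measurable_compose[OF Phi_measurable measurable_emeasure_counting_algebra[OF assms(1)]])
  ultimately show ?thesis
    by (intro nn_integral_PInf_AE) auto
qed

text \<open>\<open>R\<close> collects the regions that earlier steps found empty. Keeping this
  requirement inside the event takes the place of conditioning on the past.\<close>

definition stop_prob :: "nat \<Rightarrow> 'a measure set \<Rightarrow> ('a \<times> real) set \<Rightarrow> ereal \<times> 'a measure \<Rightarrow> ennreal" where
  "stop_prob n A R s = emeasure P {\<omega>\<in>space P. emeasure (\<Phi> \<omega>) R = 0 \<and> stops_in n A (\<Phi> \<omega>) s}"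

lemma stop_event_sets:
  assumes "A \<in> sets NN" "R \<in> sets MR" "snd s \<in> counting_measures M (sets M)"
  shows "{\<omega>\<in>space P. emeasure (\<Phi> \<omega>) R = 0 \<and> stops_in n A (\<Phi> \<omega>) s} \<in> sets P"
proof -
  have "(\<lambda>_. s) \<in> P \<rightarrow>\<^sub>M borel \<Otimes>\<^sub>M NN"
    using assms(3) by (cases s) (intro measurable_const, simp add: space_pair_measure)
  then have [measurable]: "Measurable.pred P (\<lambda>\<omega>. stops_in n A (\<Phi> \<omega>) s)"
    by (rule stops_in_measurable[OF assms(1) Phi_measurable])
  have [measurable]: "(\<lambda>\<omega>. emeasure (\<Phi> \<omega>) R) \<in> borel_measurable P"
    by (rule measurable_compose[OF Phi_measurable measurable_emeasure_counting_algebra[OF assms(2)]])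
  show ?thesis
    by measurable
qed

text \<open>Having no points in \<open>R\<close> and none in the whole remaining region is enough to
  stop at once. The two sets are disjoint because \<open>R\<close> lies at or before
  \<open>c\<close>, and since the tail weight at infinity is 1, the second void probability is 1 /
  \<open>tail_weight c \<mu>\<close>.\<close>

lemma stop_prob_0:
  assumes A: "A \<in> sets NN" and \<mu>: "\<mu> \<in> counting_measures M (sets M)" and null: "emeasure \<mu> (tail_set c) = 0"
    and fin: "tail_weight c \<mu> < \<infinity>"
    and R: "R \<in> sets MR" "emeasure MR R < \<infinity>" and below: "\<And>z. z \<in> R \<Longrightarrow> ereal (\<phi> (fst z)) \<le> c"
  shows "ennreal (exp (- measure MR R)) * indicator A \<mu> \<le> stop_prob 0 A R (c, \<mu>) * tail_weight c \<mu>"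
proof (cases "\<mu> \<in> A")
  case True
  let ?R = "R \<union> region c \<infinity> \<mu>"
  have rf: "emeasure MR (region c \<infinity> \<mu>) < \<infinity>"
    and re: "ennreal (exp (- measure MR (region c \<infinity> \<mu>))) = 1 / tail_weight c \<mu>"
    using measure_region[OF \<mu> null fin, of \<infinity>] tail_weight_PInf[OF \<mu>] by auto
  have disj: "R \<inter> region c \<infinity> \<mu> = {}"
    using below by (fastforce simp: region_def)
  have "emeasure MR ?R \<le> emeasure MR R + emeasure MR (region c \<infinity> \<mu>)"
    using R region_sets[OF \<mu>] by (intro emeasure_subadditive) auto
  also have "\<dots> < \<infinity>"
    using R(2) rf by simp
  finally have Rf: "emeasure MR ?R < \<infinity>" .
  have "measure MR ?R = measure MR R + measure MR (region c \<infinity> \<mu>)"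
    using R rf region_sets[OF \<mu>] disj by (intro measure_Union) auto
  then have "ennreal (exp (- measure MR R)) * (1 / tail_weight c \<mu>) = ennreal (exp (- measure MR ?R))"
    unfolding re[symmetric] by (simp add: mult_exp_exp flip: ennreal_mult')
  also have "\<dots> = emeasure P {\<omega>\<in>space P. emeasure (\<Phi> \<omega>) ?R = 0}"
    using R region_sets[OF \<mu>] Rf by (intro Phi_void[symmetric]) auto
  also have "\<dots> \<le> stop_prob 0 A R (c, \<mu>)"
    unfolding stop_prob_def
  proof (rule emeasure_mono)
    show "{\<omega>\<in>space P. emeasure (\<Phi> \<omega>) ?R = 0} \<subseteq> {\<omega>\<in>space P. emeasure (\<Phi> \<omega>) R = 0 \<and> stops_in 0 A (\<Phi> \<omega>) (c, \<mu>)}"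
    proof safe
      fix \<omega> assume \<omega>: "\<omega> \<in> space P" "emeasure (\<Phi> \<omega>) ?R = 0"
      have "emeasure (\<Phi> \<omega>) R \<le> emeasure (\<Phi> \<omega>) ?R" "emeasure (\<Phi> \<omega>) (region c \<infinity> \<mu>) \<le> emeasure (\<Phi> \<omega>) ?R"
        using LL_sets[OF Phi_space[OF \<omega>(1)]] R(1) region_sets[OF \<mu>] by (auto intro!: emeasure_mono)
      with \<omega>(2) show "emeasure (\<Phi> \<omega>) R = 0" "stops_in 0 A (\<Phi> \<omega>) (c, \<mu>)"
        using True by (simp_all add: next_ok_def)
    qed
    show "{\<omega>\<in>space P. emeasure (\<Phi> \<omega>) R = 0 \<and> stops_in 0 A (\<Phi> \<omega>) (c, \<mu>)} \<in> sets P"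
      using \<mu> by (intro stop_event_sets A R) simp
  qed
  finally have le: "ennreal (exp (- measure MR R)) * (1 / tail_weight c \<mu>) \<le> stop_prob 0 A R (c, \<mu>)" .
  have "1 / tail_weight c \<mu> * tail_weight c \<mu> = 1"
    using fin tail_weight_ge_1[OF \<mu>, of c] by (metis ennreal_divide_self ennreal_divide_times infinity_ennreal_def mult_1 not_one_le_zero)
  then have "ennreal (exp (- measure MR R)) = ennreal (exp (- measure MR R)) * (1 / tail_weight c \<mu>) * tail_weight c \<mu>"
    by (simp add: mult.assoc)
  also have "\<dots> \<le> stop_prob 0 A R (c, \<mu>) * tail_weight c \<mu>"
    using le by (rule mult_right_mono) simp
  finally show ?thesis
    using True by simp
qed simp

text \<open>Classifies by the first accepted point \<open>z\<close>, with no other point in the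
  region up to it. Almost surely the number of such points of \<open>\<Phi>\<close> is at most the
  indicator of the event on the right; the Mecke equation turns its mean into an integral over
  \<open>z\<close>.\<close>

lemma stop_prob_Suc:
  assumes A: "A \<in> sets NN" and \<mu>: "\<mu> \<in> counting_measures M (sets M)" and null: "emeasure \<mu> (tail_set c) = 0"
    and fin: "tail_weight c \<mu> < \<infinity>"
    and R: "R \<in> sets MR" and below: "\<And>z. z \<in> R \<Longrightarrow> ereal (\<phi> (fst z)) \<le> c"
  shows "(\<integral>\<^sup>+z. indicator (region c \<infinity> \<mu>) z *
      stop_prob n A (R \<union> region c (ereal (\<phi> (fst z))) \<mu>) (ereal (\<phi> (fst z)), \<mu> \<oplus>\<^sub>m return M (fst z)) \<partial>MR)
    \<le> stop_prob (Suc n) A R (c, \<mu>)"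
proof -
  interpret PMR: pair_sigma_finite P MR ..
  have [measurable]: "\<mu> \<in> space NN" using \<mu> by simp
  note [measurable] = region_emeasure_measurable region_pred_measurable stops_in_measurable[OF A] R
  have [measurable]: "(\<lambda>\<theta>. emeasure \<theta> R) \<in> borel_measurable LL"
    using R by (rule measurable_emeasure_counting_algebra)
  \<comment> \<open>The point \<open>z\<close> lies in the region up to its own position, so the
    count is 1. After the Mecke equation \<open>z\<close> is the added point, and the same condition
    says that \<open>\<Phi>\<close> itself has no point there.\<close>
  define S where "S = {w\<in>space (MR \<Otimes>\<^sub>M LL). fst w \<in> region c \<infinity> \<mu> \<and>
    emeasure (snd w) (region c (ereal (\<phi> (fst (fst w)))) \<mu>) = 1 \<and> emeasure (snd w) R = 0 \<and>
    stops_in n A (snd w) (ereal (\<phi> (fst (fst w))), \<mu> \<oplus>\<^sub>m return M (fst (fst w)))}"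
  have S [measurable]: "S \<in> sets (MR \<Otimes>\<^sub>M LL)"
    unfolding S_def by measurable
  have "(\<integral>\<^sup>+z. indicator (region c \<infinity> \<mu>) z *
      stop_prob n A (R \<union> region c (ereal (\<phi> (fst z))) \<mu>) (ereal (\<phi> (fst z)), \<mu> \<oplus>\<^sub>m return M (fst z)) \<partial>MR)
    = (\<integral>\<^sup>+z. (\<integral>\<^sup>+\<omega>. indicator S (z, \<Phi> \<omega> \<oplus>\<^sub>m return MR z) \<partial>P) \<partial>MR)"
  proof (rule nn_integral_cong)
    fix z assume z: "z \<in> space MR"
    have fz: "fst z \<in> space M"
      using z by (auto simp: space_MR)
    show "indicator (region c \<infinity> \<mu>) z *
      stop_prob n A (R \<union> region c (ereal (\<phi> (fst z))) \<mu>) (ereal (\<phi> (fst z)), \<mu> \<oplus>\<^sub>m return M (fst z)) =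
      (\<integral>\<^sup>+\<omega>. indicator S (z, \<Phi> \<omega> \<oplus>\<^sub>m return MR z) \<partial>P)"
    proof (cases "z \<in> region c \<infinity> \<mu>")
      case True
      let ?E = "{\<omega>\<in>space P. emeasure (\<Phi> \<omega>) (R \<union> region c (ereal (\<phi> (fst z))) \<mu>) = 0 \<and>
        stops_in n A (\<Phi> \<omega>) (ereal (\<phi> (fst z)), \<mu> \<oplus>\<^sub>m return M (fst z))}"
      have E: "?E \<in> sets P"
        using \<mu> by (intro stop_event_sets A sets.Un R region_sets) auto
      have zr: "z \<in> region c (ereal (\<phi> (fst z))) \<mu>" and zR: "z \<notin> R"
        using True below[of z] by (auto simp: region_def)
      have "indicator S (z, \<Phi> \<omega> \<oplus>\<^sub>m return MR z) = (indicator ?E \<omega> :: ennreal)" if \<omega>: "\<omega> \<in> space P" for \<omega>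
      proof -
        have \<theta>: "\<Phi> \<omega> \<in> counting_measures MR (strip_sets M)"
          using Phi_space[OF \<omega>] .
        have s: "sets (\<Phi> \<omega>) = sets MR"
          using LL_sets[OF \<theta>] .
        have \<theta>': "\<Phi> \<omega> \<oplus>\<^sub>m return MR z \<in> counting_measures MR (strip_sets M)"
          using \<theta> strip_sets_sub by (rule add_return_counting)
        have e1: "emeasure (\<Phi> \<omega> \<oplus>\<^sub>m return MR z) (region c (ereal (\<phi> (fst z))) \<mu>) = 1 \<longleftrightarrow>
          emeasure (\<Phi> \<omega>) (region c (ereal (\<phi> (fst z))) \<mu>) = 0"
        proof -
          have "emeasure (\<Phi> \<omega> \<oplus>\<^sub>m return MR z) (region c (ereal (\<phi> (fst z))) \<mu>) =
            1 + emeasure (\<Phi> \<omega>) (region c (ereal (\<phi> (fst z))) \<mu>)"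
            using s zr region_sets[OF \<mu>] by (simp add: emeasure_add_measure add.commute)
          moreover have "1 + a = 1 \<longleftrightarrow> a = 0" for a :: ennreal
            using ennreal_add_left_cancel[of 1 a 0] by simp
          ultimately show ?thesis by simp
        qed
        have e2: "emeasure (\<Phi> \<omega> \<oplus>\<^sub>m return MR z) R = emeasure (\<Phi> \<omega>) R"
          using s zR R by (simp add: emeasure_add_measure)
        have e3: "stops_in n A (\<Phi> \<omega> \<oplus>\<^sub>m return MR z) (ereal (\<phi> (fst z)), \<mu> \<oplus>\<^sub>m return M (fst z)) \<longleftrightarrow>
          stops_in n A (\<Phi> \<omega>) (ereal (\<phi> (fst z)), \<mu> \<oplus>\<^sub>m return M (fst z))"
          using \<mu> by (intro stops_in_add_return \<theta>) auto
        have e4: "emeasure (\<Phi> \<omega>) (R \<union> region c (ereal (\<phi> (fst z))) \<mu>) = 0 \<longleftrightarrow>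
          emeasure (\<Phi> \<omega>) (region c (ereal (\<phi> (fst z))) \<mu>) = 0 \<and> emeasure (\<Phi> \<omega>) R = 0"
        proof -
          have m: "R \<in> sets (\<Phi> \<omega>)" "region c (ereal (\<phi> (fst z))) \<mu> \<in> sets (\<Phi> \<omega>)"
            using s R region_sets[OF \<mu>] by auto
          then have "emeasure (\<Phi> \<omega>) (R \<union> region c (ereal (\<phi> (fst z))) \<mu>) \<le> emeasure (\<Phi> \<omega>) R + emeasure (\<Phi> \<omega>) (region c (ereal (\<phi> (fst z))) \<mu>)"
            by (intro emeasure_subadditive)
          moreover have "emeasure (\<Phi> \<omega>) R \<le> emeasure (\<Phi> \<omega>) (R \<union> region c (ereal (\<phi> (fst z))) \<mu>)"
            "emeasure (\<Phi> \<omega>) (region c (ereal (\<phi> (fst z))) \<mu>) \<le> emeasure (\<Phi> \<omega>) (R \<union> region c (ereal (\<phi> (fst z))) \<mu>)"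
            using m by (auto intro!: emeasure_mono)
          ultimately show ?thesis
            by auto
        qed
        show ?thesis
          using \<omega> z True \<theta>' by (simp add: S_def indicator_def space_pair_measure e1 e2 e3 e4 conj_ac)
      qed
      then have "(\<integral>\<^sup>+\<omega>. indicator S (z, \<Phi> \<omega> \<oplus>\<^sub>m return MR z) \<partial>P) = (\<integral>\<^sup>+\<omega>. indicator ?E \<omega> \<partial>P)"
        by (rule nn_integral_cong)
      then show ?thesis
        using True E by (simp add: stop_prob_def)
    next
      case False
      then have "(\<integral>\<^sup>+\<omega>. indicator S (z, \<Phi> \<omega> \<oplus>\<^sub>m return MR z) \<partial>P) = (\<integral>\<^sup>+\<omega>. 0 \<partial>P)"
        by (intro nn_integral_cong) (simp add: S_def)
      then show ?thesis
        using False by simp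
    qed
  qed
  also have "\<dots> = (\<integral>\<^sup>+\<omega>. (\<integral>\<^sup>+z. indicator S (z, \<Phi> \<omega> \<oplus>\<^sub>m return MR z) \<partial>MR) \<partial>P)"
    by (rule PMR.Fubini') measurable
  also have "\<dots> = (\<integral>\<^sup>+\<omega>. (\<integral>\<^sup>+z. indicator S (z, \<Phi> \<omega>) \<partial>\<Phi> \<omega>) \<partial>P)"
    by (rule mecke[OF S, symmetric])
  also have "\<dots> \<le> (\<integral>\<^sup>+\<omega>. indicator {\<omega>\<in>space P. emeasure (\<Phi> \<omega>) R = 0 \<and> stops_in (Suc n) A (\<Phi> \<omega>) (c, \<mu>)} \<omega> \<partial>P)"
  proof (rule nn_integral_mono_AE)
    have rf: "emeasure MR (region c \<infinity> \<mu>) < \<infinity>"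
      using measure_region(1)[OF \<mu> null fin, of \<infinity>] by simp
    have int: "(\<integral>\<^sup>+x. of_bool (c < ereal (\<phi> x)) * p_fun M \<phi> \<kappa> x \<mu> \<partial>M) \<noteq> \<infinity>"
      using rf unfolding emeasure_MR_region[OF \<mu>] by simp
    have "AE \<omega> in P. emeasure (\<Phi> \<omega>) (region c \<infinity> \<mu>) \<noteq> \<infinity>"
      using rf by (intro Phi_finite region_sets \<mu>)
    then show "AE \<omega> in P. (\<integral>\<^sup>+z. indicator S (z, \<Phi> \<omega>) \<partial>\<Phi> \<omega>) \<le>
      indicator {\<omega>\<in>space P. emeasure (\<Phi> \<omega>) R = 0 \<and> stops_in (Suc n) A (\<Phi> \<omega>) (c, \<mu>)} \<omega>"
      using AE_space
    proof eventually_elim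
      fix \<omega> assume rfin: "emeasure (\<Phi> \<omega>) (region c \<infinity> \<mu>) \<noteq> \<infinity>" and \<omega>: "\<omega> \<in> space P"
      have \<theta>: "\<Phi> \<omega> \<in> counting_measures MR (strip_sets M)"
        using Phi_space[OF \<omega>] .
      have s: "sets (\<Phi> \<omega>) = sets MR"
        using LL_sets[OF \<theta>] .
      define S' where "S' = (\<lambda>z. (z, \<Phi> \<omega>)) -` S"
      have S': "S' \<in> sets MR"
        unfolding S'_def using sets_Pair2[OF S] .
      have "(\<integral>\<^sup>+z. indicator S (z, \<Phi> \<omega>) \<partial>\<Phi> \<omega>) = (\<integral>\<^sup>+z. indicator S' z \<partial>\<Phi> \<omega>)"
        by (intro nn_integral_cong) (simp add: S'_def indicator_def)
      then have eq: "(\<integral>\<^sup>+z. indicator S (z, \<Phi> \<omega>) \<partial>\<Phi> \<omega>) = emeasure (\<Phi> \<omega>) S'"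
        using S' s by simp
      show "(\<integral>\<^sup>+z. indicator S (z, \<Phi> \<omega>) \<partial>\<Phi> \<omega>) \<le>
        indicator {\<omega>\<in>space P. emeasure (\<Phi> \<omega>) R = 0 \<and> stops_in (Suc n) A (\<Phi> \<omega>) (c, \<mu>)} \<omega>"
      proof (cases "emeasure (\<Phi> \<omega>) R = 0")
        case True
        have "emeasure (\<Phi> \<omega>) S' \<le> of_bool (stops_in (Suc n) A (\<Phi> \<omega>) (c, \<mu>))"
          by (rule stops_in_step[OF \<theta> \<mu> rfin int S']) (simp add: S'_def S_def)
        then show ?thesis
          unfolding eq using True \<omega> by (simp add: indicator_def)
      next
        case False
        then have "S' = {}"
          by (auto simp: S'_def S_def)
        then show ?thesis
          unfolding eq by simp
      qed
    qed
  qed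
  also have "\<dots> = stop_prob (Suc n) A R (c, \<mu>)"
    unfolding stop_prob_def using \<mu> by (intro nn_integral_indicator stop_event_sets A R) simp
  finally show ?thesis .
qed

text \<open>Induction on n, peeling off the first accepted point x. With W_x the tail weight at
  \<phi>(x), the void probability W_x(\<mu>) / W_c(\<mu>) times p(x,\<mu>) is \<kappa>(x,\<mu>)
  W_x(\<mu> + \<delta>_x) / W_c(\<mu>), and the factor W_x(\<mu> + \<delta>_x) cancels against the
  one in the induction hypothesis.\<close>

theorem stop_prob_ge:
  assumes A: "A \<in> sets NN" and "\<mu> \<in> counting_measures M (sets M)" "emeasure \<mu> (tail_set c) = 0"
    and "tail_weight c \<mu> < \<infinity>"
    and "R \<in> sets MR" "emeasure MR R < \<infinity>" "\<And>z. z \<in> R \<Longrightarrow> ereal (\<phi> (fst z)) \<le> c"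
  shows "ennreal (exp (- measure MR R)) * insert_increasing n (indicator A) c \<mu> \<le> stop_prob n A R (c, \<mu>) * tail_weight c \<mu>"
  using assms(2-)
proof (induct n arbitrary: \<mu> c R)
  case 0
  then show ?case
    using stop_prob_0[OF A] by simp
next
  case (Suc n)
  note \<mu> = Suc(2) and null = Suc(3) and fin = Suc(4) and R = Suc(5,6) and below = Suc(7)
  have [measurable]: "\<mu> \<in> space NN" using \<mu> by simp
  have s: "sets \<mu> = sets M"
    using counting_measuresD(1)[OF \<mu>] .
  have iA: "(indicator A :: _ \<Rightarrow> ennreal) \<in> borel_measurable NN"
    using A by simp
  note insert_increasing_measurable_comp[OF iA, measurable] p_fun_measurable[measurable] region_sets[OF \<mu>, measurable]
  let ?W = "tail_weight"
  let ?\<mu> = "\<lambda>x. \<mu> \<oplus>\<^sub>m return M x"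
  let ?e = "ennreal (exp (- measure MR R))"
  define O' where "O' x = insert_increasing n (indicator A) (ereal (\<phi> x)) (?\<mu> x)" for x
  \<comment> \<open>The lower bound that the induction hypothesis yields, with the void
    probabilities of \<open>R\<close> and of the region up to \<open>x\<close> as separate
    factors.\<close>
  define h where "h x = ?e * (?W (ereal (\<phi> x)) \<mu> / ?W c \<mu>) * (O' x / ?W (ereal (\<phi> x)) (?\<mu> x))" for x
  have [measurable]: "O' \<in> borel_measurable M"
    unfolding O'_def by measurable
  have [measurable]: "h \<in> borel_measurable M"
    unfolding h_def by measurable
  have Wc: "?W c \<mu> \<noteq> 0" "?W c \<mu> \<noteq> \<top>"
    using tail_weight_ge_1[OF \<mu>, of c] fin by auto
  have h_le: "h (fst z) \<le> stop_prob n A (R \<union> region c (ereal (\<phi> (fst z))) \<mu>) (ereal (\<phi> (fst z)), ?\<mu> (fst z))"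
    if z: "z \<in> region c \<infinity> \<mu>" for z
  proof (cases "?W (ereal (\<phi> (fst z))) (?\<mu> (fst z)) < \<infinity>")
    case True
    let ?x = "fst z"
    let ?b = "ereal (\<phi> ?x)"
    let ?R = "R \<union> region c ?b \<mu>"
    have x: "?x \<in> space M" and cx: "c < ?b"
      using z by (auto simp: region_def)
    have \<mu>': "?\<mu> ?x \<in> counting_measures M (sets M)"
      using \<mu> by (intro add_return_counting) auto
    have rf: "emeasure MR (region c ?b \<mu>) < \<infinity>"
      and re: "ennreal (exp (- measure MR (region c ?b \<mu>))) = ?W ?b \<mu> / ?W c \<mu>"
      using measure_region[OF \<mu> null fin less_imp_le[OF cx]] .
    have disj: "R \<inter> region c ?b \<mu> = {}"
      using below by (fastforce simp: region_def)
    have "emeasure MR ?R \<le> emeasure MR R + emeasure MR (region c ?b \<mu>)"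
      using R by (intro emeasure_subadditive) auto
    also have "\<dots> < \<infinity>"
      using R(2) rf by simp
    finally have Rf: "emeasure MR ?R < \<infinity>" .
    have "measure MR ?R = measure MR R + measure MR (region c ?b \<mu>)"
      using R rf disj by (intro measure_Union) auto
    then have e: "ennreal (exp (- measure MR ?R)) = ?e * (?W ?b \<mu> / ?W c \<mu>)"
      unfolding re[symmetric] by (simp add: mult_exp_exp flip: ennreal_mult')
    have "emeasure \<mu> (tail_set ?b) \<le> emeasure \<mu> (tail_set c)"
      using cx s by (intro emeasure_mono) (auto simp: tail_set_def intro: less_trans)
    then have null': "emeasure (?\<mu> ?x) (tail_set ?b) = 0"
      using null s by (simp add: emeasure_add_measure tail_set_def[of ?b] indicator_def)
    have "ennreal (exp (- measure MR ?R)) * insert_increasing n (indicator A) ?b (?\<mu> ?x) \<le>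
      stop_prob n A ?R (?b, ?\<mu> ?x) * ?W ?b (?\<mu> ?x)"
    proof (rule Suc(1)[OF \<mu>' null' True _ Rf])
      show "ereal (\<phi> (fst y)) \<le> ?b" if "y \<in> ?R" for y
      proof (cases "y \<in> R")
        case True
        then show ?thesis
          by (rule less_imp_le[OF le_less_trans[OF below cx]])
      qed (use that in \<open>auto simp: region_def\<close>)
    qed (use R in auto)
    then have "?e * (?W ?b \<mu> / ?W c \<mu>) * O' ?x / ?W ?b (?\<mu> ?x) \<le> stop_prob n A ?R (?b, ?\<mu> ?x) * ?W ?b (?\<mu> ?x) / ?W ?b (?\<mu> ?x)"
      unfolding e O'_def by (rule divide_right_mono_ennreal)
    also have "\<dots> = stop_prob n A ?R (?b, ?\<mu> ?x)"
      using True tail_weight_ge_1[OF \<mu>', of ?b] by (intro ennreal_mult_divide_eq) auto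
    finally show ?thesis
      by (simp add: h_def ennreal_times_divide)
  next
    case False
    then have "?W (ereal (\<phi> (fst z))) (?\<mu> (fst z)) = \<top>"
      by (simp add: less_top[symmetric])
    then show ?thesis
      by (simp add: h_def)
  qed
  \<comment> \<open>Bounding by 0 loses nothing: the tail weight at \<open>c\<close> is finite, so
    almost every \<open>x\<close> beyond \<open>c\<close> at which the new tail weight is infinite
    has \<kappa> = 0.\<close>
  have kW: "(\<integral>\<^sup>+x. of_bool (c < ereal (\<phi> x)) * (ennreal (\<kappa> x \<mu>) * ?W (ereal (\<phi> x)) (?\<mu> x)) \<partial>M) \<noteq> \<infinity>"
    using tail_weight_step[OF \<mu>, of c] fin by auto
  have "AE x in M. of_bool (c < ereal (\<phi> x)) * (ennreal (\<kappa> x \<mu>) * ?W (ereal (\<phi> x)) (?\<mu> x)) \<noteq> \<infinity>"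
    using kW by (intro nn_integral_PInf_AE) measurable
  then have ae: "AE x in M. of_bool (c < ereal (\<phi> x)) * p_fun M \<phi> \<kappa> x \<mu> * h x * ?W c \<mu> =
    ?e * (of_bool (c < ereal (\<phi> x)) * ennreal (\<kappa> x \<mu>) * O' x)"
    using AE_space
  proof eventually_elim
    fix x assume f: "of_bool (c < ereal (\<phi> x)) * (ennreal (\<kappa> x \<mu>) * ?W (ereal (\<phi> x)) (?\<mu> x)) \<noteq> \<infinity>" and x: "x \<in> space M"
    show "of_bool (c < ereal (\<phi> x)) * p_fun M \<phi> \<kappa> x \<mu> * h x * ?W c \<mu> =
      ?e * (of_bool (c < ereal (\<phi> x)) * ennreal (\<kappa> x \<mu>) * O' x)"
    proof (cases "c < ereal (\<phi> x) \<and> ennreal (\<kappa> x \<mu>) \<noteq> 0")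
      case True
      let ?b = "ereal (\<phi> x)"
      have cx: "c < ?b" using True by simp
      have \<mu>': "?\<mu> x \<in> counting_measures M (sets M)"
        using \<mu> by (intro add_return_counting) auto
      have W': "?W ?b (?\<mu> x) \<noteq> 0" "?W ?b (?\<mu> x) \<noteq> \<top>"
        using f True tail_weight_ge_1[OF \<mu>', of ?b] by (auto simp: ennreal_mult_eq_top_iff)
      have Wx: "?W ?b \<mu> \<noteq> 0" "?W ?b \<mu> \<noteq> \<top>"
        using tail_weight_ge_1[OF \<mu>, of ?b] tail_weight_antimono[OF \<mu> less_imp_le[OF cx]] Wc by (auto simp: top_unique)
      have cancel: "a * inverse a = 1" if "a \<noteq> 0" "a \<noteq> \<top>" for a :: ennreal
        using that ennreal_divide_self[of a] by (simp add: divide_ennreal_def less_top)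
      have "p_fun M \<phi> \<kappa> x \<mu> * h x * ?W c \<mu> =
        (?W ?b (?\<mu> x) * inverse (?W ?b (?\<mu> x))) * (?W ?b \<mu> * inverse (?W ?b \<mu>)) * (?W c \<mu> * inverse (?W c \<mu>)) *
        (?e * (ennreal (\<kappa> x \<mu>) * O' x))"
        unfolding p_fun_eq[OF \<mu> null cx] h_def divide_ennreal_def by (simp only: ac_simps)
      then show ?thesis
        using cx by (simp add: cancel W' Wx Wc)
    next
      case False
      then have "of_bool (c < ereal (\<phi> x)) * p_fun M \<phi> \<kappa> x \<mu> = 0"
        using p_fun_eq[OF \<mu> null, of x] by auto
      moreover have "of_bool (c < ereal (\<phi> x)) * ennreal (\<kappa> x \<mu>) = 0"
        using False by auto
      ultimately show ?thesis
        by simp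
    qed
  qed
  have "?e * insert_increasing (Suc n) (indicator A) c \<mu> =
    (\<integral>\<^sup>+x. ?e * (of_bool (c < ereal (\<phi> x)) * ennreal (\<kappa> x \<mu>) * O' x) \<partial>M)"
    unfolding insert_increasing.simps O'_def[symmetric] by (rule nn_integral_cmult[symmetric]) measurable
  also have "\<dots> = (\<integral>\<^sup>+x. of_bool (c < ereal (\<phi> x)) * p_fun M \<phi> \<kappa> x \<mu> * h x * ?W c \<mu> \<partial>M)"
    using ae by (intro nn_integral_cong_AE) (auto elim: eventually_mono)
  also have "\<dots> = (\<integral>\<^sup>+x. of_bool (c < ereal (\<phi> x)) * p_fun M \<phi> \<kappa> x \<mu> * h x \<partial>M) * ?W c \<mu>"
    by (rule nn_integral_multc) measurable
  also have "(\<integral>\<^sup>+x. of_bool (c < ereal (\<phi> x)) * p_fun M \<phi> \<kappa> x \<mu> * h x \<partial>M) =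
    (\<integral>\<^sup>+x. (\<integral>\<^sup>+t. indicator (region c \<infinity> \<mu>) (x, t) * h x \<partial>half_line) \<partial>M)"
  proof (rule nn_integral_cong)
    fix x assume x: "x \<in> space M"
    have sec: "Pair x -` region c \<infinity> \<mu> \<in> sets half_line"
      by (rule sets_Pair1) measurable
    have "(\<integral>\<^sup>+t. indicator (region c \<infinity> \<mu>) (x, t) * h x \<partial>half_line) = (\<integral>\<^sup>+t. indicator (Pair x -` region c \<infinity> \<mu>) t * h x \<partial>half_line)"
      by (intro nn_integral_cong) (simp add: indicator_def)
    also have "\<dots> = emeasure half_line (Pair x -` region c \<infinity> \<mu>) * h x"
      by (subst nn_integral_multc[OF borel_measurable_indicator[OF sec]]) (simp add: sec)
    also have "Pair x -` region c \<infinity> \<mu> = (if c < ereal (\<phi> x) then {t. 0 \<le> t \<and> ennreal t \<le> p_fun M \<phi> \<kappa> x \<mu>} else {})"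
      using x by (auto simp: region_def)
    also have "emeasure half_line \<dots> = of_bool (c < ereal (\<phi> x)) * p_fun M \<phi> \<kappa> x \<mu>"
      by (simp add: emeasure_half_line_le)
    finally show "of_bool (c < ereal (\<phi> x)) * p_fun M \<phi> \<kappa> x \<mu> * h x =
      (\<integral>\<^sup>+t. indicator (region c \<infinity> \<mu>) (x, t) * h x \<partial>half_line)" ..
  qed
  also have "\<dots> = (\<integral>\<^sup>+z. indicator (region c \<infinity> \<mu>) z * h (fst z) \<partial>MR)"
    using L.nn_integral_fst[of "\<lambda>z. indicator (region c \<infinity> \<mu>) z * h (fst z)" M] by simp
  also have "\<dots> \<le> (\<integral>\<^sup>+z. indicator (region c \<infinity> \<mu>) z *
      stop_prob n A (R \<union> region c (ereal (\<phi> (fst z))) \<mu>) (ereal (\<phi> (fst z)), ?\<mu> (fst z)) \<partial>MR)"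
    using h_le by (intro nn_integral_mono) (auto split: split_indicator)
  also have "\<dots> \<le> stop_prob (Suc n) A R (c, \<mu>)"
    by (rule stop_prob_Suc[OF A \<mu> null fin R(1) below])
  finally show ?case
    by (simp add: mult_right_mono del: insert_increasing.simps)
qed

section \<open>Comparison of the law of the embedding with the Gibbs law\<close>

lemma embedding_law_ge:
  assumes A: "A \<in> sets NN" and fin: "tail_weight (-\<infinity>) (null_measure M) < \<infinity>"
  shows "total_weight (indicator A) \<le>
    emeasure (distr P NN (\<lambda>\<omega>. embedding M \<phi> \<kappa> (\<Phi> \<omega>))) A * tail_weight (-\<infinity>) (null_measure M)"
proof -
  let ?s = "(-\<infinity>, null_measure M) :: ereal \<times> 'a measure"
  let ?E = "\<lambda>n. {\<omega>\<in>space P. emeasure (\<Phi> \<omega>) {} = 0 \<and> stops_in n A (\<Phi> \<omega>) ?s}"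
  have E: "?E n \<in> sets P" for n
    by (intro stop_event_sets A) simp_all
  have T [measurable]: "(\<lambda>\<omega>. embedding M \<phi> \<kappa> (\<Phi> \<omega>)) \<in> P \<rightarrow>\<^sub>M NN"
    by (rule embedding_measurable[OF Phi_measurable])
  have "total_weight (indicator A) = (\<Sum>n. insert_increasing n (indicator A) (-\<infinity>) (null_measure M))"
    using A by (simp add: total_weight_eq weight_above_def)
  also have "\<dots> \<le> (\<Sum>n. stop_prob n A {} ?s * tail_weight (-\<infinity>) (null_measure M))"
  proof (rule suminf_le)
    show "insert_increasing n (indicator A) (-\<infinity>) (null_measure M) \<le> stop_prob n A {} ?s * tail_weight (-\<infinity>) (null_measure M)" for n
      using stop_prob_ge[OF A null_measure_counting _ fin, of "{}" n] by simp
  qed auto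
  also have "\<dots> = (\<Sum>n. stop_prob n A {} ?s) * tail_weight (-\<infinity>) (null_measure M)"
    by (rule ennreal_suminf_multc)
  also have "(\<Sum>n. stop_prob n A {} ?s) = emeasure P (\<Union>n. ?E n)"
    unfolding stop_prob_def
  proof (rule suminf_emeasure)
    show "disjoint_family ?E"
      using stops_in_unique by (fastforce simp: disjoint_family_on_def)
  qed (use E in auto)
  also have "\<dots> \<le> emeasure P ((\<lambda>\<omega>. embedding M \<phi> \<kappa> (\<Phi> \<omega>)) -` A \<inter> space P)"
  proof (rule emeasure_mono)
    show "(\<Union>n. ?E n) \<subseteq> (\<lambda>\<omega>. embedding M \<phi> \<kappa> (\<Phi> \<omega>)) -` A \<inter> space P"
    proof
      fix \<omega> assume "\<omega> \<in> (\<Union>n. ?E n)"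
      then obtain n where \<omega>: "\<omega> \<in> space P" and stop: "stops_in n A (\<Phi> \<omega>) ?s"
        by blast
      then have "stops_in n UNIV (\<Phi> \<omega>) ?s"
        unfolding stops_in_iff by blast
      then show "\<omega> \<in> (\<lambda>\<omega>. embedding M \<phi> \<kappa> (\<Phi> \<omega>)) -` A \<inter> space P"
        using stops_in_embedding(1)[OF Phi_space[OF \<omega>]] stop \<omega> by blast
    qed
    show "(\<lambda>\<omega>. embedding M \<phi> \<kappa> (\<Phi> \<omega>)) -` A \<inter> space P \<in> sets P"
      using A by (rule measurable_sets[OF T])
  qed
  also have "\<dots> = emeasure (distr P NN (\<lambda>\<omega>. embedding M \<phi> \<kappa> (\<Phi> \<omega>))) A"
    using A by (simp add: emeasure_distr)
  finally show ?thesis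
    by (simp add: mult_right_mono)
qed

theorem embedding_law:
  assumes fin: "tail_weight (-\<infinity>) (null_measure M) < \<infinity>"
  shows "distr P NN (\<lambda>\<omega>. embedding M \<phi> \<kappa> (\<Phi> \<omega>)) =
    scale_measure (1 / tail_weight (-\<infinity>) (null_measure M)) weighted_measure"
proof -
  let ?W = "tail_weight (-\<infinity>) (null_measure M)"
  let ?D = "distr P NN (\<lambda>\<omega>. embedding M \<phi> \<kappa> (\<Phi> \<omega>))"
  let ?G = "scale_measure (1 / ?W) weighted_measure"
  have W: "?W \<noteq> 0" "?W \<noteq> \<top>"
    using tail_weight_ge_1[OF null_measure_counting, of "-\<infinity>"] fin by auto
  have T [measurable]: "(\<lambda>\<omega>. embedding M \<phi> \<kappa> (\<Phi> \<omega>)) \<in> P \<rightarrow>\<^sub>M NN"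
    by (rule embedding_measurable[OF Phi_measurable])
  interpret D: prob_space ?D
    by (rule P.prob_space_distr[OF T])
  have G: "emeasure ?G A = total_weight (indicator A) / ?W" if "A \<in> sets NN" for A
    using that by (simp add: emeasure_weighted_measure divide_ennreal_def mult.commute)
  interpret G: prob_space ?G
  proof
    have "total_weight (indicator (space NN)) = total_weight (\<lambda>_. 1)"
      by (rule total_weight_cong) simp
    also have "\<dots> = ?W"
      by (simp add: total_weight_eq)
    finally show "emeasure ?G (space ?G) = 1"
      using G[OF sets.top] W by (simp add: space_scale_measure less_top)
  qed
  have le: "G.prob A \<le> D.prob A" if A: "A \<in> sets NN" for A
  proof -
    have "emeasure ?G A \<le> emeasure ?D A * ?W / ?W"
      unfolding G[OF A] by (rule divide_right_mono_ennreal[OF embedding_law_ge[OF A fin]])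
    also have "\<dots> = emeasure ?D A"
      using W by (rule ennreal_mult_divide_eq)
    finally show ?thesis
      by (simp add: G.emeasure_eq_measure D.emeasure_eq_measure del: emeasure_scale_measure)
  qed
  show ?thesis
  proof (rule measure_eqI)
    fix A assume "A \<in> sets ?D"
    then have A: "A \<in> sets NN" by simp
    \<comment> \<open>The inequalities for \<open>A\<close> and for its complement add up to 1 on
      both sides, so neither can be strict.\<close>
    have "G.prob (space NN - A) = 1 - G.prob A" "D.prob (space NN - A) = 1 - D.prob A"
      using G.prob_compl[of A] D.prob_compl[of A] A by (simp_all add: space_scale_measure)
    then have "G.prob A = D.prob A"
      using le[OF A] le[OF sets.compl_sets[OF A]] by linarith
    then show "emeasure ?D A = emeasure ?G A"
      by (simp add: G.emeasure_eq_measure D.emeasure_eq_measure del: emeasure_scale_measure)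
  qed simp
qed

text \<open>The normalizing constant is the same on both sides of \<open>total_weight_GNZ\<close>,
  so the identity passes to the law of the embedding.\<close>

theorem embedding_gibbs:
  assumes fin: "tail_weight (-\<infinity>) (null_measure M) < \<infinity>"
  shows "gibbs_process P M \<kappa> (\<lambda>\<omega>. embedding M \<phi> \<kappa> (\<Phi> \<omega>))"
  unfolding gibbs_process_def N_alg_eq
proof (intro conjI allI impI)
  show "prob_space P"
    by (rule P.prob_space_axioms)
  show T: "(\<lambda>\<omega>. embedding M \<phi> \<kappa> (\<Phi> \<omega>)) \<in> P \<rightarrow>\<^sub>M NN"
    by (rule embedding_measurable[OF Phi_measurable])
  fix f :: "'a \<times> 'a measure \<Rightarrow> real"
  assume "f \<in> borel_measurable (M \<Otimes>\<^sub>M NN) \<and> (\<forall>z\<in>space (M \<Otimes>\<^sub>M NN). 0 \<le> f z)"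
  then have [measurable]: "f \<in> borel_measurable (M \<Otimes>\<^sub>M NN)" by simp
  define g where "g x \<mu> = ennreal (f (x, \<mu>))" for x \<mu>
  have g: "(\<lambda>(x, \<mu>). g x \<mu>) \<in> borel_measurable (M \<Otimes>\<^sub>M NN)"
    unfolding g_def by measurable
  let ?T = "\<lambda>\<omega>. embedding M \<phi> \<kappa> (\<Phi> \<omega>)"
  let ?r = "1 / tail_weight (-\<infinity>) (null_measure M)"
  have law: "(\<integral>\<^sup>+\<omega>. F (?T \<omega>) \<partial>P) = ?r * total_weight F" if F: "F \<in> borel_measurable NN" for F
  proof -
    have "(\<integral>\<^sup>+\<omega>. F (?T \<omega>) \<partial>P) = (\<integral>\<^sup>+\<mu>. F \<mu> \<partial>distr P NN ?T)"
      using T F by (simp add: nn_integral_distr)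
    also have "\<dots> = ?r * (\<integral>\<^sup>+\<mu>. F \<mu> \<partial>weighted_measure)"
      unfolding embedding_law[OF fin]
      using F by (intro nn_integral_scale_measure) (simp add: measurable_cong_sets[OF sets_weighted_measure refl])
    finally show ?thesis
      by (simp add: nn_integral_weighted_measure[OF F])
  qed
  have "(\<integral>\<^sup>+\<omega>. (\<integral>\<^sup>+x. ennreal (f (x, ?T \<omega>)) \<partial>?T \<omega>) \<partial>P) = (\<integral>\<^sup>+\<omega>. point_sum g (?T \<omega>) \<partial>P)"
    by (simp add: point_sum_def g_def)
  also have "\<dots> = ?r * total_weight (insert_sum g)"
    unfolding law[OF point_sum_measurable[OF g]] total_weight_GNZ[OF g] ..
  also have "\<dots> = (\<integral>\<^sup>+\<omega>. insert_sum g (?T \<omega>) \<partial>P)"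
    by (rule law[OF insert_sum_measurable[OF g], symmetric])
  also have "\<dots> = (\<integral>\<^sup>+\<omega>. (\<integral>\<^sup>+x. ennreal (f (x, ?T \<omega> \<oplus>\<^sub>m return M x)) * ennreal (\<kappa> x (?T \<omega>)) \<partial>M) \<partial>P)"
    by (simp add: insert_sum_def g_def mult.commute)
  finally show "(\<integral>\<^sup>+\<omega>. (\<integral>\<^sup>+x. ennreal (f (x, ?T \<omega>)) \<partial>?T \<omega>) \<partial>P) =
    (\<integral>\<^sup>+\<omega>. (\<integral>\<^sup>+x. ennreal (f (x, ?T \<omega> \<oplus>\<^sub>m return M x)) * ennreal (\<kappa> x (?T \<omega>)) \<partial>M) \<partial>P)" .
qed

end

text \<open>The empty configuration has positive probability under \<open>\<Pi>\<^sub>\<lambda>\<close>, hence is stable.\<close>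

lemma (in gibbs_setting) stable_imp_finite_weight:
  assumes "AE \<psi> in poisson_law M M. \<psi> \<in> N_simple M \<longrightarrow> stable_config M \<kappa> \<psi>"
  shows "tail_weight (-\<infinity>) (null_measure M) < \<infinity>"
proof -
  interpret J: poisson_insertion M "space M"
    by unfold_locales simp_all
  have "restrict_to M (space M) = M"
    by (intro measure_eqI) (simp_all add: emeasure_restrict_to)
  then have pl: "poisson_law M M = J.poisson_measure"
    using J.poisson_law_eq[OF finite_measure_axioms] by simp
  have "stable_config M \<kappa> (null_measure M)"
  proof (rule ccontr)
    assume no: "\<not> stable_config M \<kappa> (null_measure M)"
    have "null_measure M \<in> N_simple M"
      by (simp add: N_simple_def N_alg_eq)
    \<comment> \<open>The null measure is the only configuration of mass zero. If it were unstable,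
      almost every configuration would have a point, against the positive void probability.\<close>
    have "AE \<psi> in J.poisson_measure. emeasure \<psi> (space M) \<noteq> 0"
      using assms unfolding pl
    proof (rule AE_mp, intro AE_I2 impI)
      fix \<psi> assume \<psi>: "\<psi> \<in> space J.poisson_measure" and st: "\<psi> \<in> N_simple M \<longrightarrow> stable_config M \<kappa> \<psi>"
      show "emeasure \<psi> (space M) \<noteq> 0"
      proof
        assume 0: "emeasure \<psi> (space M) = 0"
        have s: "sets \<psi> = sets M"
          using \<psi> by (simp add: counting_measures_def)
        have "emeasure \<psi> A = 0" if "A \<in> sets M" for A
          using 0 emeasure_mono[of A "space M" \<psi>] sets.sets_into_space[OF that] s by simp
        then have "\<psi> = null_measure M"
          using s by (intro measure_eqI) auto
        with st no \<open>null_measure M \<in> N_simple M\<close> show False by simp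
      qed
    qed
    moreover have "{\<psi>\<in>space NN. emeasure \<psi> (space M) = 0} \<in> sets NN"
    proof -
      have [measurable]: "(\<lambda>\<psi>. emeasure \<psi> (space M)) \<in> borel_measurable NN"
        by (rule measurable_emeasure_counting_algebra) simp
      show ?thesis
        by measurable
    qed
    ultimately have "emeasure J.poisson_measure {\<psi>\<in>space NN. emeasure \<psi> (space M) = 0} = 0"
      by (subst (asm) AE_iff_measurable[OF _ refl]) auto
    then show False
      using J.poisson_void[OF sets.top] by simp
  qed
  then have "partition_fun M \<kappa> (space M) (null_measure M) < \<infinity>"
    unfolding stable_config_def by (auto dest!: bspec[OF _ sets.top])
  then have "partition_fun M \<kappa> (tail_set (-\<infinity>)) (null_measure M) < \<infinity>"
    by (simp add: tail_set_def)
  then show ?thesis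
    unfolding partition_fun_tail_set[OF null_measure_counting]
    by (auto simp: ennreal_mult_less_top)
qed

theorem theorem5p1:
  fixes M :: "'a measure" and \<phi> :: "'a \<Rightarrow> real" and \<kappa> :: "'a \<Rightarrow> 'a measure \<Rightarrow> real"
    and P :: "'w measure" and \<Phi> :: "'w \<Rightarrow> ('a \<times> real) measure"
  assumes "borel_coding M \<phi>"
    and "finite_measure M"
    and "diffuse M"
    and "(\<lambda>(x, \<mu>). \<kappa> x \<mu>) \<in> borel_measurable (M \<Otimes>\<^sub>M N_alg M)"
    and "\<forall>x\<in>space M. \<forall>\<mu>\<in>space (N_alg M). 0 \<le> \<kappa> x \<mu>"
    and "\<forall>x\<in>space M. \<forall>y\<in>space M. \<forall>\<mu>\<in>space (N_alg M).
           \<kappa> x \<mu> * \<kappa> y (\<mu> \<oplus>\<^sub>m return M x) = \<kappa> y \<mu> * \<kappa> x (\<mu> \<oplus>\<^sub>m return M y)"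
    and "AE \<psi> in poisson_law M M. \<psi> \<in> N_simple M \<longrightarrow> stable_config M \<kappa> \<psi>"
    and "poisson_process P (N_loc_alg M) (M \<Otimes>\<^sub>M half_line) \<Phi>"
  shows "gibbs_process P M \<kappa> (\<lambda>\<omega>. embedding M \<phi> \<kappa> (\<Phi> \<omega>))"
proof -
  interpret gibbs_setting M \<phi> \<kappa>
    using assms(1-6) by (simp add: gibbs_setting_def gibbs_setting_axioms_def)
  interpret embedding_setting M \<phi> \<kappa> P \<Phi>
    by unfold_locales (rule assms(8))
  show ?thesis
    by (rule embedding_gibbs[OF stable_imp_finite_weight[OF assms(7)]])
qed

end
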